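(* Let $\mathcal{M}$ be a manifold of dimension $n\in\mathbb{N}$ and let $(a,b)\subset\mathbb{R}$ be a time interval. Suppose $g(\tau)$, $\tau\in(a,b)$, is a (reverse) Ricci flow on $\mathcal{M}$, i.e. a solution of $\frac{\partial g}{\partial\tau}=2\,\mathrm{Ric}(g(\tau))$, with bounded curvature. Let $N\in\mathbb{N}$ be sufficiently large that the symmetric $2$-tensor $\bar g=\bar g_N$ on $\hat{\mathcal{M}}:=\mathcal{M}\times(a,b)$ defined by $$\bar g_{ij}=g_{ij};\qquad \bar g_{00}=N+R;\qquad \bar g_{0i}=0$$ is positive definite. Then, up to errors of order $\frac1N$, the metric $\bar g$ is a gradient steady Ricci soliton on $\hat{\mathcal{M}}$: $$\mathrm{Ric}(\bar g)+\mathrm{Hess}_{\bar g}(-N\tau)\simeq 0,$$ by which is meant that the quantity $$N\left[\mathrm{Ric}(\bar g)+\mathrm{Hess}_{\bar g}(-N\tau)\right]$$ is locally bounded independently of $N$, with respect to any fixed metric on $\hat{\mathcal{M}}$; that is, for every fixed Riemannian metric $h$ on $\hat{\mathcal{M}}$ (independent of $N$) and every compact $K\subset\hat{\mathcal{M}}$ there is a constant $C$ such that for all such $N$ the $h$-norm of this tensor is at most $C$ at every point of $K$.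
   Context: Indices $i,j$ are coordinate indices on the $\mathcal{M}$ factor of $\hat{\mathcal{M}}=\mathcal{M}\times(a,b)$, and $0$ is the index of the time coordinate $\tau\in(a,b)$. $R=R(x,\tau)$ is the scalar curvature of $g(\tau)$ at $x\in\mathcal{M}$. At a point $(x,\tau)\in\hat{\mathcal{M}}$, $g_{ij}$ denotes the components of $g(\tau)$ at $x$. The function $-N\tau$ is regarded as a function on $\hat{\mathcal{M}}$ via $(x,\tau)\mapsto -N\tau$. $\mathrm{Ric}(\bar g)$ is the Ricci tensor and $\mathrm{Hess}_{\bar g}$ the Hessian (second covariant derivative) with respect to $\bar g$. *)

theory Defs
  imports "HOL-Analysis.Analysis"
begin

section \<open>Smooth maps between normed spaces\<close>

text \<open>Intended for open subsets \<open>S\<close> of finite-dimensional spaces, where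
  \<open>Ck_on k f S\<close> is the usual notion of being \<open>k\<close> times continuously differentiable.\<close>

primrec Ck_on ::
  "nat \<Rightarrow> ('b::real_normed_vector \<Rightarrow> 'c::real_normed_vector) \<Rightarrow> 'b set \<Rightarrow> bool" where
  "Ck_on 0 f S \<longleftrightarrow> continuous_on S f"
| "Ck_on (Suc k) f S \<longleftrightarrow>
     (\<forall>x\<in>S. f differentiable (at x)) \<and>
     (\<forall>v. Ck_on k (\<lambda>x. frechet_derivative f (at x) v) S)"

definition smooth_on ::
  "('b::real_normed_vector \<Rightarrow> 'c::real_normed_vector) \<Rightarrow> 'b set \<Rightarrow> bool" where
  "smooth_on f S \<longleftrightarrow> (\<forall>k. Ck_on k f S)"


section \<open>Smooth manifolds\<close>

text \<open>A manifold is a topological space with an indexed atlas \<open>(U\<^sub>\<alpha>, \<phi>\<^sub>\<alpha>)\<close>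
  modelled on a Euclidean space \<open>'e\<close>, so that its dimension is \<open>DIM('e)\<close>. The coordinates
  are those with respect to \<open>Basis :: 'e set\<close>, whose elements serve as coordinate indices.
  The values of \<open>chart_map M \<alpha>\<close> outside \<open>chart_dom M \<alpha>\<close> are irrelevant.\<close>

record ('i, 'a, 'e) charted_space =
  mtop :: "'a topology"
  charts :: "'i set"
  chart_dom :: "'i \<Rightarrow> 'a set"
  chart_map :: "'i \<Rightarrow> 'a \<Rightarrow> 'e"

abbreviation chart_image :: "('i, 'a, 'e) charted_space \<Rightarrow> 'i \<Rightarrow> 'e set" where
  "chart_image M \<alpha> \<equiv> chart_map M \<alpha> ` chart_dom M \<alpha>"

definition chart_inv :: "('i, 'a, 'e) charted_space \<Rightarrow> 'i \<Rightarrow> 'e \<Rightarrow> 'a" where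
  "chart_inv M \<alpha> = inv_into (chart_dom M \<alpha>) (chart_map M \<alpha>)"

definition smooth_manifold :: "('i, 'a, 'e::euclidean_space) charted_space \<Rightarrow> bool" where
  "smooth_manifold M \<longleftrightarrow>
     Hausdorff_space (mtop M) \<and> second_countable (mtop M) \<and>
     (\<Union>\<alpha>\<in>charts M. chart_dom M \<alpha>) = topspace (mtop M) \<and>
     (\<forall>\<alpha>\<in>charts M.
        openin (mtop M) (chart_dom M \<alpha>) \<and> open (chart_image M \<alpha>) \<and>
        homeomorphic_map (subtopology (mtop M) (chart_dom M \<alpha>))
          (top_of_set (chart_image M \<alpha>)) (chart_map M \<alpha>)) \<and>
     (\<forall>\<alpha>\<in>charts M. \<forall>\<beta>\<in>charts M.
        smooth_on (chart_map M \<beta> \<circ> chart_inv M \<alpha>)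
          (chart_map M \<alpha> ` (chart_dom M \<alpha> \<inter> chart_dom M \<beta>)))"

text \<open>The product \<open>M \<times> (a, b)\<close> with the product charts \<open>\<phi>\<^sub>\<alpha> \<times> id\<close>. Its coordinate
  indices are the vectors \<open>(i, 0)\<close> with \<open>i \<in> Basis\<close>, and \<open>(0, 1)\<close> for the time
  direction.\<close>

definition spacetime ::
  "('i, 'a, 'e) charted_space \<Rightarrow> real \<Rightarrow> real \<Rightarrow> ('i, 'a \<times> real, 'e \<times> real) charted_space" where
  "spacetime M a b =
     \<lparr> mtop = prod_topology (mtop M) (top_of_set {a<..<b}),
       charts = charts M,
       chart_dom = (\<lambda>\<alpha>. chart_dom M \<alpha> \<times> {a<..<b}),
       chart_map = (\<lambda>\<alpha> (p, t). (chart_map M \<alpha> p, t)) \<rparr>"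

text \<open>The partial derivative at the point \<open>p\<close> of \<open>f\<close>, read in the chart \<open>\<alpha>\<close>, in the
  coordinate direction \<open>i\<close>.\<close>

definition pderiv_chart ::
  "('i, 'a, 'e::euclidean_space) charted_space \<Rightarrow> 'i \<Rightarrow> 'e \<Rightarrow> ('a \<Rightarrow> real) \<Rightarrow> 'a \<Rightarrow> real" where
  "pderiv_chart M \<alpha> i f p =
     frechet_derivative (f \<circ> chart_inv M \<alpha>) (at (chart_map M \<alpha> p)) i"


section \<open>Covariant 2-tensors and Riemannian metrics\<close>

text \<open>\<open>T \<alpha> p\<close> is the coordinate expression in the chart \<open>\<alpha>\<close> of the bilinear form
  at the point \<open>p\<close>; in particular \<open>T \<alpha> p i j\<close>, for \<open>i\<close> and \<open>j\<close> in \<open>Basis\<close>,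
  is the component \<open>T\<^sub>i\<^sub>j\<close>.\<close>

type_synonym ('i, 'a, 'e) tensor2 = "'i \<Rightarrow> 'a \<Rightarrow> 'e \<Rightarrow> 'e \<Rightarrow> real"

definition positive_definite ::
  "('i, 'a, 'e::euclidean_space) charted_space \<Rightarrow> ('i, 'a, 'e) tensor2 \<Rightarrow> bool" where
  "positive_definite M G \<longleftrightarrow>
     (\<forall>\<alpha>\<in>charts M. \<forall>p\<in>chart_dom M \<alpha>. \<forall>u. u \<noteq> 0 \<longrightarrow> G \<alpha> p u u > 0)"

definition smooth_tensor2 ::
  "('i, 'a, 'e::euclidean_space) charted_space \<Rightarrow> ('i, 'a, 'e) tensor2 \<Rightarrow> bool" where
  "smooth_tensor2 M T \<longleftrightarrow>
     (\<forall>\<alpha>\<in>charts M. \<forall>p\<in>chart_dom M \<alpha>. bilinear (T \<alpha> p)) \<and>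
     (\<forall>\<alpha>\<in>charts M. \<forall>\<beta>\<in>charts M. \<forall>p\<in>chart_dom M \<alpha> \<inter> chart_dom M \<beta>. \<forall>u v.
        let D = frechet_derivative (chart_map M \<beta> \<circ> chart_inv M \<alpha>) (at (chart_map M \<alpha> p))
        in T \<alpha> p u v = T \<beta> p (D u) (D v)) \<and>
     (\<forall>\<alpha>\<in>charts M. \<forall>i\<in>Basis. \<forall>j\<in>Basis.
        smooth_on (\<lambda>y. T \<alpha> (chart_inv M \<alpha> y) i j) (chart_image M \<alpha>))"

definition riemannian_metric ::
  "('i, 'a, 'e::euclidean_space) charted_space \<Rightarrow> ('i, 'a, 'e) tensor2 \<Rightarrow> bool" where
  "riemannian_metric M G \<longleftrightarrow>
     smooth_tensor2 M G \<and>
     (\<forall>\<alpha>\<in>charts M. \<forall>p\<in>chart_dom M \<alpha>. \<forall>u v. G \<alpha> p u v = G \<alpha> p v u) \<and>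
     positive_definite M G"

text \<open>The component \<open>g\<^sup>i\<^sup>j\<close> of the inverse metric: the linear map inverted here has the
  matrix \<open>(g\<^sub>i\<^sub>j)\<close> with respect to \<open>Basis\<close>.\<close>

definition inv_metric :: "('i, 'a, 'e::euclidean_space) tensor2 \<Rightarrow> ('i, 'a, 'e) tensor2" where
  "inv_metric G \<alpha> p i j = inv (\<lambda>v. \<Sum>k\<in>Basis. G \<alpha> p k v *\<^sub>R k) j \<bullet> i"

text \<open>The pointwise norm of a covariant 2-tensor with respect to the metric \<open>h\<close>:
  \<open>\<bar>T\<bar>\<^sup>2 = h\<^sup>i\<^sup>k h\<^sup>j\<^sup>l T\<^sub>i\<^sub>j T\<^sub>k\<^sub>l\<close>.\<close>

definition tensor2_norm ::
  "('i, 'a, 'e::euclidean_space) tensor2 \<Rightarrow> ('i, 'a, 'e) tensor2 \<Rightarrow> 'i \<Rightarrow> 'a \<Rightarrow> real" where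
  "tensor2_norm h T \<alpha> p =
     sqrt (\<Sum>i\<in>Basis. \<Sum>j\<in>Basis. \<Sum>k\<in>Basis. \<Sum>l\<in>Basis.
       inv_metric h \<alpha> p i k * inv_metric h \<alpha> p j l * T \<alpha> p i j * T \<alpha> p k l)"


section \<open>Connection, curvature and Hessian\<close>

text \<open>\<open>christoffel M G \<alpha> p k i j\<close> is \<open>\<Gamma>\<^sup>k\<^sub>i\<^sub>j\<close>.\<close>

definition christoffel ::
  "('i, 'a, 'e::euclidean_space) charted_space \<Rightarrow> ('i, 'a, 'e) tensor2 \<Rightarrow>
   'i \<Rightarrow> 'a \<Rightarrow> 'e \<Rightarrow> 'e \<Rightarrow> 'e \<Rightarrow> real" where
  "christoffel M G \<alpha> p k i j =
     1 / 2 * (\<Sum>l\<in>Basis. inv_metric G \<alpha> p k l *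
       (pderiv_chart M \<alpha> i (\<lambda>q. G \<alpha> q j l) p
        + pderiv_chart M \<alpha> j (\<lambda>q. G \<alpha> q i l) p
        - pderiv_chart M \<alpha> l (\<lambda>q. G \<alpha> q i j) p))"

text \<open>\<open>riemann M G \<alpha> p l k i j\<close> is the component \<open>R\<^sup>l\<^sub>k\<^sub>i\<^sub>j\<close> with
  \<open>R(\<partial>\<^sub>i, \<partial>\<^sub>j) \<partial>\<^sub>k = R\<^sup>l\<^sub>k\<^sub>i\<^sub>j \<partial>\<^sub>l\<close>, where
  \<open>R(X, Y) Z = \<nabla>\<^sub>X \<nabla>\<^sub>Y Z - \<nabla>\<^sub>Y \<nabla>\<^sub>X Z - \<nabla>\<^bsub>[X, Y]\<^esub> Z\<close>. With the contraction below,
  round spheres have positive Ricci curvature.\<close>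

definition riemann ::
  "('i, 'a, 'e::euclidean_space) charted_space \<Rightarrow> ('i, 'a, 'e) tensor2 \<Rightarrow>
   'i \<Rightarrow> 'a \<Rightarrow> 'e \<Rightarrow> 'e \<Rightarrow> 'e \<Rightarrow> 'e \<Rightarrow> real" where
  "riemann M G \<alpha> p l k i j =
     pderiv_chart M \<alpha> i (\<lambda>q. christoffel M G \<alpha> q l j k) p
     - pderiv_chart M \<alpha> j (\<lambda>q. christoffel M G \<alpha> q l i k) p
     + (\<Sum>m\<in>Basis. christoffel M G \<alpha> p l i m * christoffel M G \<alpha> p m j k
                  - christoffel M G \<alpha> p l j m * christoffel M G \<alpha> p m i k)"

definition ricci ::
  "('i, 'a, 'e::euclidean_space) charted_space \<Rightarrow> ('i, 'a, 'e) tensor2 \<Rightarrow>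
   ('i, 'a, 'e) tensor2" where
  "ricci M G \<alpha> p j k = (\<Sum>i\<in>Basis. riemann M G \<alpha> p i k i j)"

definition scalar_curvature ::
  "('i, 'a, 'e::euclidean_space) charted_space \<Rightarrow> ('i, 'a, 'e) tensor2 \<Rightarrow>
   'i \<Rightarrow> 'a \<Rightarrow> real" where
  "scalar_curvature M G \<alpha> p =
     (\<Sum>i\<in>Basis. \<Sum>j\<in>Basis. inv_metric G \<alpha> p i j * ricci M G \<alpha> p i j)"

text \<open>The norm of the full curvature tensor:
  \<open>\<bar>Rm\<bar>\<^sup>2 = g\<^sub>l\<^sub>l\<^sub>' g\<^sup>k\<^sup>k\<^sup>' g\<^sup>i\<^sup>i\<^sup>' g\<^sup>j\<^sup>j\<^sup>' R\<^sup>l\<^sub>k\<^sub>i\<^sub>j R\<^sup>l\<^sup>'\<^sub>k\<^sub>'\<^sub>i\<^sub>'\<^sub>j\<^sub>'\<close>.\<close>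

definition riemann_norm ::
  "('i, 'a, 'e::euclidean_space) charted_space \<Rightarrow> ('i, 'a, 'e) tensor2 \<Rightarrow>
   'i \<Rightarrow> 'a \<Rightarrow> real" where
  "riemann_norm M G \<alpha> p =
     sqrt (\<Sum>l\<in>Basis. \<Sum>l'\<in>Basis. \<Sum>k\<in>Basis. \<Sum>k'\<in>Basis.
           \<Sum>i\<in>Basis. \<Sum>i'\<in>Basis. \<Sum>j\<in>Basis. \<Sum>j'\<in>Basis.
       G \<alpha> p l l' * inv_metric G \<alpha> p k k' * inv_metric G \<alpha> p i i' * inv_metric G \<alpha> p j j' *
       riemann M G \<alpha> p l k i j * riemann M G \<alpha> p l' k' i' j')"

text \<open>\<open>Hess f\<^sub>i\<^sub>j = \<partial>\<^sub>i \<partial>\<^sub>j f - \<Gamma>\<^sup>k\<^sub>i\<^sub>j \<partial>\<^sub>k f\<close>\<close>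

definition hessian ::
  "('i, 'a, 'e::euclidean_space) charted_space \<Rightarrow> ('i, 'a, 'e) tensor2 \<Rightarrow> ('a \<Rightarrow> real) \<Rightarrow>
   ('i, 'a, 'e) tensor2" where
  "hessian M G f \<alpha> p i j =
     pderiv_chart M \<alpha> i (\<lambda>q. pderiv_chart M \<alpha> j f q) p
     - (\<Sum>k\<in>Basis. christoffel M G \<alpha> p k i j * pderiv_chart M \<alpha> k f p)"


section \<open>Reverse Ricci flow and the space-time metric\<close>

text \<open>As usual, a flow is understood to be smooth jointly in space and time.\<close>

definition reverse_ricci_flow ::
  "('i, 'a, 'e::euclidean_space) charted_space \<Rightarrow> real \<Rightarrow> real \<Rightarrow>
   (real \<Rightarrow> ('i, 'a, 'e) tensor2) \<Rightarrow> bool" where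
  "reverse_ricci_flow M a b g \<longleftrightarrow>
     (\<forall>t\<in>{a<..<b}. riemannian_metric M (g t)) \<and>
     (\<forall>\<alpha>\<in>charts M. \<forall>i\<in>Basis. \<forall>j\<in>Basis.
        smooth_on (\<lambda>(y, t). g t \<alpha> (chart_inv M \<alpha> y) i j) (chart_image M \<alpha> \<times> {a<..<b})) \<and>
     (\<forall>t\<in>{a<..<b}. \<forall>\<alpha>\<in>charts M. \<forall>p\<in>chart_dom M \<alpha>. \<forall>i\<in>Basis. \<forall>j\<in>Basis.
        ((\<lambda>s. g s \<alpha> p i j) has_real_derivative 2 * ricci M (g t) \<alpha> p i j) (at t))"

definition bounded_curvature ::
  "('i, 'a, 'e::euclidean_space) charted_space \<Rightarrow> real \<Rightarrow> real \<Rightarrow>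
   (real \<Rightarrow> ('i, 'a, 'e) tensor2) \<Rightarrow> bool" where
  "bounded_curvature M a b g \<longleftrightarrow>
     (\<exists>C. \<forall>t\<in>{a<..<b}. \<forall>\<alpha>\<in>charts M. \<forall>p\<in>chart_dom M \<alpha>. riemann_norm M (g t) \<alpha> p \<le> C)"

text \<open>The bilinear form with components \<open>g\<^sub>i\<^sub>j\<close> in the space directions, \<open>N + R\<close> in
  the time direction and vanishing mixed components.\<close>

definition soliton_metric ::
  "('i, 'a, 'e::euclidean_space) charted_space \<Rightarrow> (real \<Rightarrow> ('i, 'a, 'e) tensor2) \<Rightarrow> nat \<Rightarrow>
   ('i, 'a \<times> real, 'e \<times> real) tensor2" where
  "soliton_metric M g N \<alpha> =
     (\<lambda>(p, t) (u, r) (v, s).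
        g t \<alpha> p u v + (real N + scalar_curvature M (g t) \<alpha> p) * r * s)"

end

theory Submission
  imports Defs
begin

text \<open>
  Write \<open>w = 1 / (N + R)\<close>. In product coordinates the Christoffel symbols of the space-time metric are
  \<open>\<Gamma>\<^sup>k\<^sub>i\<^sub>j\<close>, \<open>\<Gamma>\<^sup>k\<^sub>i\<^sub>0 = R\<^sup>k\<^sub>i\<close> and \<open>\<Gamma>\<^sup>k\<^sub>0\<^sub>0 = - \<nabla>\<^sup>k R / 2\<close> for the space components, which do not involve \<open>N\<close>, and
  \<open>w E\<^sub>p\<^sub>q\<close> for the time component, where \<open>E\<^sub>i\<^sub>j = - R\<^sub>i\<^sub>j\<close>, \<open>E\<^sub>i\<^sub>0 = \<partial>\<^sub>i R / 2\<close> and \<open>E\<^sub>0\<^sub>0 = \<partial>\<^sub>\<tau> R / 2\<close>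
  (\<open>levi_civita_st_metric\<close>). The Hessian of \<open>- N \<tau>\<close> is \<open>N w E = E - R w E\<close>. Consequently all components
  of \<open>Ric + Hess(- N \<tau>)\<close> are functions of the point and of \<open>w\<close> which are smooth up to \<open>w = 0\<close> and
  independent of \<open>N\<close> otherwise. If such a function vanishes at \<open>w = 0\<close>, it is \<open>O(w)\<close> by the mean value
  theorem, and \<open>N w\<close> is locally bounded (\<open>expands_0_bounded\<close>). It remains to show that the Ricci tensors of
  the space-time metrics tend to \<open>- E\<close> as \<open>N \<rightarrow> \<infinity>\<close> (\<open>limit_ricci_value\<close>).

  The limit is the Ricci tensor of the limit connection, which has no time component. Its space-space
  part is the Ricci tensor of the time slice. Its mixed part is \<open>\<nabla>\<^sup>k R\<^sub>i\<^sub>k - \<partial>\<^sub>i R = - \<partial>\<^sub>i R / 2\<close> by the contracted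
  Bianchi identity. Its time-time part is \<open>- \<Delta>R / 2 - \<partial>\<^sub>\<tau> R - \<bar>Ric\<bar>\<^sup>2\<close>, which is \<open>- \<partial>\<^sub>\<tau> R / 2\<close> by the evolution
  equation \<open>\<partial>\<^sub>\<tau> R = - \<Delta>R - 2 \<bar>Ric\<bar>\<^sup>2\<close>. This evolution equation is itself a Bianchi identity: it is the limit
  of the time component of the contracted Bianchi identity of the space-time metrics
  (\<open>limit_bianchi\<close>), in which the mixed part of the Ricci tensor is already known.

  The contracted Bianchi identity holds where the Christoffel symbols vanish, by a computation with
  third derivatives of the metric, and a quadratic change of coordinates makes them vanish at a given
  point (\<open>contracted_bianchi\<close>). This uses that the Ricci tensor is natural under changes of coordinates
  (\<open>ricci_pullback\<close>). The same naturality shows that the norm of \<open>Ric + Hess(- N \<tau>)\<close> does not depend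
  on the chart (\<open>scaled_error_norm_invariant\<close>), so that a finite subcover of the compact set by
  coordinate neighbourhoods gives a bound valid in all charts, of which there may be infinitely many.

  Local computations are free of indices: a tensor field is a function of the point with values in
  multilinear maps of the coordinate space, differentiated with constant vectors as arguments.
\<close>

section \<open>Directional derivatives and smooth functions\<close>

text \<open>The direction comes first, so that \<open>dderiv v\<close> is an operator on functions and second
  derivatives are written \<open>dderiv v (dderiv w f)\<close>.\<close>

definition dderiv :: "'b::real_normed_vector \<Rightarrow> ('b \<Rightarrow> 'c::real_normed_vector) \<Rightarrow> 'b \<Rightarrow> 'c" where
  "dderiv v f x = frechet_derivative f (at x) v"

lemma has_derivative_dderiv:
  "f differentiable at x \<Longrightarrow> (f has_derivative (\<lambda>v. dderiv v f x)) (at x)"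
  by (simp add: dderiv_def frechet_derivative_works[symmetric])

lemma dderiv_eqI: "(f has_derivative f') (at x) \<Longrightarrow> dderiv v f x = f' v"
  unfolding dderiv_def by (metis frechet_derivative_at)

text \<open>This includes points where the functions are not differentiable: on an open set the two functions have the same Frechet
  derivatives, so that the choice operator in \<open>frechet_derivative\<close> returns the same map.\<close>

lemma dderiv_cong_open:
  assumes "open S" "x \<in> S" "\<And>y. y \<in> S \<Longrightarrow> f y = g y"
  shows "dderiv v f x = dderiv v g x"
proof -
  have "(f has_derivative f') (at x) \<longleftrightarrow> (g has_derivative f') (at x)" for f'
    using has_derivative_transform_within_open[of _ f' x UNIV S] assms by metis
  then show ?thesis unfolding dderiv_def frechet_derivative_def by simp
qed

lemma differentiable_cong_open:
  assumes "f differentiable at x" "open S" "x \<in> S" "\<And>y. y \<in> S \<Longrightarrow> f y = g y"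
  shows "g differentiable at x"
  using assms has_derivative_transform_within_open[of f _ x UNIV S g]
  unfolding differentiable_def by blast

lemma dderiv_const [simp]: "dderiv v (\<lambda>x. c) x = 0"
  by (simp add: dderiv_def)

lemma dderiv_bounded_linear: "bounded_linear L \<Longrightarrow> dderiv v L x = L v"
  by (simp add: dderiv_eqI bounded_linear_imp_has_derivative)

lemma dderiv_add:
  "f differentiable at x \<Longrightarrow> g differentiable at x \<Longrightarrow>
     dderiv v (\<lambda>x. f x + g x) x = dderiv v f x + dderiv v g x"
  by (rule dderiv_eqI[OF has_derivative_add[OF has_derivative_dderiv has_derivative_dderiv]])

lemma dderiv_diff:
  "f differentiable at x \<Longrightarrow> g differentiable at x \<Longrightarrow>
     dderiv v (\<lambda>x. f x - g x) x = dderiv v f x - dderiv v g x"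
  by (rule dderiv_eqI[OF has_derivative_diff[OF has_derivative_dderiv has_derivative_dderiv]])

lemma dderiv_linear_comp:
  "bounded_linear L \<Longrightarrow> f differentiable at x \<Longrightarrow> dderiv v (\<lambda>x. L (f x)) x = L (dderiv v f x)"
  by (rule dderiv_eqI[OF bounded_linear.has_derivative[OF _ has_derivative_dderiv]])

lemma dderiv_bilinear_comp:
  assumes "bounded_bilinear B" "f differentiable at x" "g differentiable at x"
  shows "dderiv v (\<lambda>x. B (f x) (g x)) x = B (f x) (dderiv v g x) + B (dderiv v f x) (g x)"
  by (rule dderiv_eqI[OF bounded_bilinear.FDERIV[OF assms(1) has_derivative_dderiv has_derivative_dderiv]])
    (use assms in auto)

lemmas dderiv_scaleR = dderiv_bilinear_comp[OF bounded_bilinear_scaleR]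

lemma dderiv_sum:
  assumes "\<And>i. i \<in> I \<Longrightarrow> f i differentiable at x"
  shows "dderiv v (\<lambda>x. \<Sum>i\<in>I. f i x) x = (\<Sum>i\<in>I. dderiv v (f i) x)"
  by (rule dderiv_eqI[OF has_derivative_sum[OF has_derivative_dderiv]]) (use assms in auto)

lemma dderiv_compose:
  assumes "\<phi> differentiable at x" "f differentiable at (\<phi> x)"
  shows "dderiv v (\<lambda>x. f (\<phi> x)) x = dderiv (dderiv v \<phi> x) f (\<phi> x)"
  using dderiv_eqI[OF has_derivative_compose[OF has_derivative_dderiv[OF assms(1)]
      has_derivative_dderiv[OF assms(2)]]] .

lemma linear_dderiv: "f differentiable at x \<Longrightarrow> linear (\<lambda>v. dderiv v f x)"
  by (simp add: dderiv_def linear_frechet_derivative)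

lemma differentiable_linear_comp:
  "bounded_linear L \<Longrightarrow> f differentiable at x \<Longrightarrow> (\<lambda>x. L (f x)) differentiable at x"
  unfolding differentiable_def using bounded_linear.has_derivative by blast

lemma differentiable_bilinear_comp:
  "bounded_bilinear B \<Longrightarrow> f differentiable at x \<Longrightarrow> g differentiable at x \<Longrightarrow>
     (\<lambda>x. B (f x) (g x)) differentiable at x"
  unfolding differentiable_def using bounded_bilinear.FDERIV by blast

lemma differentiable_compose_at:
  "\<phi> differentiable at x \<Longrightarrow> f differentiable at (\<phi> x) \<Longrightarrow> (\<lambda>x. f (\<phi> x)) differentiable at x"
  unfolding differentiable_def using has_derivative_compose by blast

lemma Ck_on_Suc_dderiv:
  "Ck_on (Suc k) f S \<longleftrightarrow> (\<forall>x\<in>S. f differentiable at x) \<and> (\<forall>v. Ck_on k (dderiv v f) S)"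
  by (simp add: dderiv_def[abs_def])

declare Ck_on.simps(2) [simp del]

lemma Ck_on_cong:
  assumes "open S"
  shows "(\<And>x. x \<in> S \<Longrightarrow> f x = g x) \<Longrightarrow> Ck_on k f S \<Longrightarrow> Ck_on k g S"
proof (induction k arbitrary: f g)
  case 0
  then show ?case by (metis Ck_on.simps(1) continuous_on_cong)
next
  case (Suc k)
  have "\<And>x. x \<in> S \<Longrightarrow> g differentiable at x"
    using Suc.prems differentiable_cong_open[OF _ assms] unfolding Ck_on_Suc_dderiv by metis
  moreover have "Ck_on k (dderiv v g) S" for v
  proof (rule Suc.IH[of "dderiv v f"])
    show "dderiv v f x = dderiv v g x" if "x \<in> S" for x
      by (rule dderiv_cong_open[OF assms that]) (use Suc.prems in auto)
  qed (use Suc.prems in \<open>auto simp: Ck_on_Suc_dderiv\<close>)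
  ultimately show ?case by (auto simp: Ck_on_Suc_dderiv)
qed

lemma Ck_on_SucD: "Ck_on (Suc k) f S \<Longrightarrow> Ck_on k f S"
proof (induction k arbitrary: f)
  case 0
  then show ?case
    by (auto simp: Ck_on_Suc_dderiv intro!: continuous_at_imp_continuous_on
        differentiable_imp_continuous_within)
next
  case (Suc k)
  then show ?case by (metis Ck_on_Suc_dderiv)
qed

lemma Ck_on_subset: "Ck_on k f S \<Longrightarrow> T \<subseteq> S \<Longrightarrow> Ck_on k f T"
  by (induction k arbitrary: f) (auto simp: Ck_on_Suc_dderiv intro: continuous_on_subset)

lemma Ck_on_const: "Ck_on k (\<lambda>x. c) S"
proof (induction k arbitrary: c)
  case (Suc k)
  have "dderiv v (\<lambda>x. c) = (\<lambda>x. 0)" for v :: 'a by (simp add: fun_eq_iff)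
  then show ?case using Suc by (auto simp: Ck_on_Suc_dderiv)
qed simp

lemma Ck_on_bounded_linear:
  assumes "bounded_linear L" shows "Ck_on k L S"
proof (cases k)
  case 0
  then show ?thesis using assms by (simp add: linear_continuous_on)
next
  case (Suc m)
  have "dderiv v L = (\<lambda>x. L v)" for v using assms by (simp add: fun_eq_iff dderiv_bounded_linear)
  moreover have "L differentiable at x" for x
    using assms bounded_linear_imp_differentiable by blast
  ultimately show ?thesis using Suc by (simp add: Ck_on_Suc_dderiv Ck_on_const)
qed

lemma Ck_on_add:
  assumes "open S"
  shows "Ck_on k f S \<Longrightarrow> Ck_on k g S \<Longrightarrow> Ck_on k (\<lambda>x. f x + g x) S"
proof (induction k arbitrary: f g)
  case 0
  then show ?case by (simp add: continuous_on_add)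
next
  case (Suc k)
  have "Ck_on k (dderiv v (\<lambda>x. f x + g x)) S" for v
    by (rule Ck_on_cong[OF assms _ Suc.IH[of "dderiv v f" "dderiv v g"]])
      (use Suc.prems in \<open>auto simp: Ck_on_Suc_dderiv dderiv_add\<close>)
  then show ?case using Suc.prems by (auto simp: Ck_on_Suc_dderiv)
qed

lemma Ck_on_linear_comp:
  assumes "open S" "bounded_linear L"
  shows "Ck_on k f S \<Longrightarrow> Ck_on k (\<lambda>x. L (f x)) S"
proof (induction k arbitrary: f)
  case 0
  then show ?case using assms(2) by (simp add: bounded_linear.continuous_on)
next
  case (Suc k)
  have "Ck_on k (dderiv v (\<lambda>x. L (f x))) S" for v
    by (rule Ck_on_cong[OF assms(1) _ Suc.IH[of "dderiv v f"]])
      (use Suc.prems assms(2) in \<open>auto simp: Ck_on_Suc_dderiv dderiv_linear_comp\<close>)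
  then show ?case
    using Suc.prems assms(2) by (auto simp: Ck_on_Suc_dderiv intro: differentiable_linear_comp)
qed

lemma Ck_on_bilinear_comp:
  assumes "open S" "bounded_bilinear B"
  shows "Ck_on k f S \<Longrightarrow> Ck_on k g S \<Longrightarrow> Ck_on k (\<lambda>x. B (f x) (g x)) S"
proof (induction k arbitrary: f g)
  case 0
  then show ?case using assms(2) by (simp add: bounded_bilinear.continuous_on)
next
  case (Suc k)
  have "Ck_on k (dderiv v (\<lambda>x. B (f x) (g x))) S" for v
  proof (rule Ck_on_cong[OF assms(1)])
    show "Ck_on k (\<lambda>x. B (f x) (dderiv v g x) + B (dderiv v f x) (g x)) S"
      by (intro Ck_on_add[OF assms(1)] Suc.IH)
        (use Suc.prems Ck_on_SucD in \<open>auto simp: Ck_on_Suc_dderiv\<close>)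
  qed (use Suc.prems assms(2) in \<open>auto simp: Ck_on_Suc_dderiv dderiv_bilinear_comp\<close>)
  then show ?case
    using Suc.prems assms(2) by (auto simp: Ck_on_Suc_dderiv intro: differentiable_bilinear_comp)
qed

lemma Ck_on_sum:
  assumes "open S"
  shows "(\<And>i. i \<in> I \<Longrightarrow> Ck_on k (f i) S) \<Longrightarrow> Ck_on k (\<lambda>x. \<Sum>i\<in>I. f i x) S"
  by (induction I rule: infinite_finite_induct) (auto intro: Ck_on_const Ck_on_add[OF assms])

lemma dderiv_expand_direction:
  fixes f :: "'b::euclidean_space \<Rightarrow> 'c::real_normed_vector"
  assumes "f differentiable at x"
  shows "dderiv v f x = (\<Sum>b\<in>Basis. (v \<bullet> b) *\<^sub>R dderiv b f x)"
proof -
  interpret linear "\<lambda>v. dderiv v f x" by (rule linear_dderiv[OF assms])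
  show ?thesis
    by (subst euclidean_representation[of v, symmetric]) (simp add: sum scale del: euclidean_representation)
qed

text \<open>The chain rule differentiates \<open>f\<close> in a direction that varies with the point, whereas
  \<open>Ck_on\<close> speaks about fixed directions; expanding the direction in the basis bridges the gap.\<close>

lemma Ck_on_compose:
  fixes \<phi> :: "'a::real_normed_vector \<Rightarrow> 'b::euclidean_space" and f :: "'b \<Rightarrow> 'c::real_normed_vector"
  assumes "open S" "\<And>x. x \<in> S \<Longrightarrow> \<phi> x \<in> T"
  shows "Ck_on k \<phi> S \<Longrightarrow> Ck_on k f T \<Longrightarrow> Ck_on k (\<lambda>x. f (\<phi> x)) S"
proof (induction k arbitrary: f)
  case 0
  then show ?case using assms continuous_on_compose2[of T f S \<phi>] by force
next
  case (Suc k)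
  have diff: "\<phi> differentiable at x" "f differentiable at (\<phi> x)" if "x \<in> S" for x
    using Suc.prems that assms by (auto simp: Ck_on_Suc_dderiv)
  have "Ck_on k (dderiv v (\<lambda>x. f (\<phi> x))) S" for v
  proof (rule Ck_on_cong[OF assms(1)])
    show "Ck_on k (\<lambda>x. \<Sum>b\<in>Basis. (dderiv v \<phi> x \<bullet> b) *\<^sub>R dderiv b f (\<phi> x)) S"
      by (intro Ck_on_sum Ck_on_bilinear_comp[OF _ bounded_bilinear_scaleR]
          Ck_on_linear_comp[OF _ bounded_linear_inner_left] Suc.IH assms(1))
        (use Suc.prems Ck_on_SucD in \<open>auto simp: Ck_on_Suc_dderiv\<close>)
  next
    fix x assume "x \<in> S"
    then show "(\<Sum>b\<in>Basis. (dderiv v \<phi> x \<bullet> b) *\<^sub>R dderiv b f (\<phi> x)) = dderiv v (\<lambda>x. f (\<phi> x)) x"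
      using diff by (simp add: dderiv_compose dderiv_expand_direction[of f "\<phi> x" "dderiv v \<phi> x"])
  qed
  then show ?case using diff by (auto simp: Ck_on_Suc_dderiv intro: differentiable_compose_at)
qed

lemma dderiv_inverse:
  fixes f :: "'a::real_normed_vector \<Rightarrow> real"
  assumes "f x \<noteq> 0" "f differentiable at x"
  shows "dderiv v (\<lambda>x. inverse (f x)) x = - (inverse (f x) * inverse (f x) * dderiv v f x)"
proof (rule dderiv_eqI)
  show "((\<lambda>x. inverse (f x)) has_derivative
      (\<lambda>v. - (inverse (f x) * inverse (f x) * dderiv v f x))) (at x)"
    using Deriv.has_derivative_inverse[OF assms(1) has_derivative_dderiv[OF assms(2)]]
    by (simp add: mult.commute mult.left_commute)
qed

lemma smooth_on_differentiable: "smooth_on f S \<Longrightarrow> x \<in> S \<Longrightarrow> f differentiable at x"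
  unfolding smooth_on_def by (metis Ck_on_Suc_dderiv)

lemma smooth_on_dderiv: "smooth_on f S \<Longrightarrow> smooth_on (dderiv v f) S"
  unfolding smooth_on_def by (metis Ck_on_Suc_dderiv)

lemma smooth_on_continuous: "smooth_on f S \<Longrightarrow> continuous_on S f"
  unfolding smooth_on_def by (metis Ck_on.simps(1))

lemma smooth_on_cong:
  "open S \<Longrightarrow> smooth_on f S \<Longrightarrow> (\<And>x. x \<in> S \<Longrightarrow> f x = g x) \<Longrightarrow> smooth_on g S"
  unfolding smooth_on_def using Ck_on_cong by blast

lemma smooth_on_subset: "smooth_on f S \<Longrightarrow> T \<subseteq> S \<Longrightarrow> smooth_on f T"
  unfolding smooth_on_def using Ck_on_subset by blast

lemma smooth_on_const: "smooth_on (\<lambda>x. c) S"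
  unfolding smooth_on_def by (simp add: Ck_on_const)

lemma smooth_on_bounded_linear: "bounded_linear L \<Longrightarrow> smooth_on L S"
  unfolding smooth_on_def by (simp add: Ck_on_bounded_linear)

lemma smooth_on_linear_comp:
  "bounded_linear L \<Longrightarrow> open S \<Longrightarrow> smooth_on f S \<Longrightarrow> smooth_on (\<lambda>x. L (f x)) S"
  unfolding smooth_on_def by (simp add: Ck_on_linear_comp)

lemma smooth_on_bilinear_comp:
  "bounded_bilinear B \<Longrightarrow> open S \<Longrightarrow> smooth_on f S \<Longrightarrow> smooth_on g S \<Longrightarrow>
     smooth_on (\<lambda>x. B (f x) (g x)) S"
  unfolding smooth_on_def by (simp add: Ck_on_bilinear_comp)

lemma smooth_on_add:
  "open S \<Longrightarrow> smooth_on f S \<Longrightarrow> smooth_on g S \<Longrightarrow> smooth_on (\<lambda>x. f x + g x) S"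
  unfolding smooth_on_def by (simp add: Ck_on_add)

lemma smooth_on_minus: "open S \<Longrightarrow> smooth_on f S \<Longrightarrow> smooth_on (\<lambda>x. - f x) S"
  by (rule smooth_on_linear_comp[OF bounded_linear_minus[OF bounded_linear_ident]])

lemma smooth_on_diff:
  "open S \<Longrightarrow> smooth_on f S \<Longrightarrow> smooth_on g S \<Longrightarrow> smooth_on (\<lambda>x. f x - g x) S"
  using smooth_on_add[of S f "\<lambda>x. - g x"] smooth_on_minus[of S g] by simp

lemma smooth_on_sum:
  "open S \<Longrightarrow> (\<And>i. i \<in> I \<Longrightarrow> smooth_on (f i) S) \<Longrightarrow> smooth_on (\<lambda>x. \<Sum>i\<in>I. f i x) S"
  unfolding smooth_on_def by (simp add: Ck_on_sum)

lemma smooth_on_compose: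
  fixes \<phi> :: "'a::real_normed_vector \<Rightarrow> 'b::euclidean_space"
  shows "open S \<Longrightarrow> smooth_on \<phi> S \<Longrightarrow> smooth_on f T \<Longrightarrow> (\<And>x. x \<in> S \<Longrightarrow> \<phi> x \<in> T) \<Longrightarrow>
    smooth_on (\<lambda>x. f (\<phi> x)) S"
  unfolding smooth_on_def using Ck_on_compose by blast

lemmas smooth_on_scaleR = smooth_on_bilinear_comp[OF bounded_bilinear_scaleR]
lemmas smooth_on_mult = smooth_on_bilinear_comp[OF bounded_bilinear_mult[where 'a=real]]
lemmas smooth_on_inner_left = smooth_on_linear_comp[OF bounded_linear_inner_left]
lemmas smooth_on_fst = smooth_on_bounded_linear[OF bounded_linear_fst]
lemmas smooth_on_snd = smooth_on_bounded_linear[OF bounded_linear_snd]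

lemma smooth_on_Pair:
  assumes "open S" "smooth_on f S" "smooth_on g S"
  shows "smooth_on (\<lambda>x. (f x, g x)) S"
proof -
  have l: "bounded_linear (\<lambda>u. (u, 0))" "bounded_linear (\<lambda>u. (0, u))"
    by (simp_all add: bounded_linear_Pair bounded_linear_ident bounded_linear_zero)
  have "smooth_on (\<lambda>x. (f x, 0) + (0, g x)) S"
    by (intro smooth_on_add assms smooth_on_linear_comp[OF l(1)] smooth_on_linear_comp[OF l(2)])
  then show ?thesis by simp
qed

text \<open>Schwarz's theorem. Both iterated derivatives are limits of the same second difference
  quotient, to which the mean value theorem applies twice.\<close>

lemma second_difference_mean_value:
  fixes f :: "'a::real_normed_vector \<Rightarrow> real"
  assumes "open S" "smooth_on f S" "h > 0"
    and sub: "\<And>s t. s \<in> {0..h} \<Longrightarrow> t \<in> {0..h} \<Longrightarrow> x + s *\<^sub>R v + t *\<^sub>R w \<in> S"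
  obtains s t where "s \<in> {0..h}" "t \<in> {0..h}"
    "f (x + h *\<^sub>R v + h *\<^sub>R w) - f (x + h *\<^sub>R v) - (f (x + h *\<^sub>R w) - f x)
      = h * h * dderiv w (dderiv v f) (x + s *\<^sub>R v + t *\<^sub>R w)"
proof -
  have line: "((\<lambda>r. F (y + r *\<^sub>R u)) has_real_derivative dderiv u F (y + r *\<^sub>R u)) (at r)"
    if "F differentiable at (y + r *\<^sub>R u)" for F :: "'a \<Rightarrow> real" and y u r
  proof -
    have "((\<lambda>r. y + r *\<^sub>R u) has_derivative (\<lambda>c. c *\<^sub>R u)) (at r)"
      by (auto intro!: derivative_eq_intros)
    from has_derivative_compose[OF this has_derivative_dderiv[OF that]]
    show ?thesis
      using linear_cmul[OF linear_dderiv[OF that]]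
      by (simp add: has_field_derivative_def mult_commute_abs)
  qed
  define p where "p r = f (x + h *\<^sub>R w + r *\<^sub>R v) - f (x + r *\<^sub>R v)" for r
  have sub': "x + h *\<^sub>R w + r *\<^sub>R v \<in> S" "x + r *\<^sub>R v \<in> S" if "r \<in> {0..h}" for r
    using sub[of r h] sub[of r 0] that assms(3) by (auto simp: algebra_simps)
  have "\<exists>s>0. s < h \<and> p h - p 0 =
      (h - 0) * (dderiv v f (x + h *\<^sub>R w + s *\<^sub>R v) - dderiv v f (x + s *\<^sub>R v))"
  proof (rule MVT2[OF assms(3)])
    fix r assume "0 \<le> r" "r \<le> h"
    then show "(p has_real_derivative
        dderiv v f (x + h *\<^sub>R w + r *\<^sub>R v) - dderiv v f (x + r *\<^sub>R v)) (at r)"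
      unfolding p_def
      by (intro DERIV_diff line smooth_on_differentiable[OF assms(2)] sub') auto
  qed
  then obtain s where s: "0 < s" "s < h"
    "p h - p 0 = h * (dderiv v f (x + h *\<^sub>R w + s *\<^sub>R v) - dderiv v f (x + s *\<^sub>R v))" by auto
  have "\<exists>t>0. t < h \<and> dderiv v f ((x + s *\<^sub>R v) + h *\<^sub>R w) - dderiv v f ((x + s *\<^sub>R v) + 0 *\<^sub>R w)
      = (h - 0) * dderiv w (dderiv v f) ((x + s *\<^sub>R v) + t *\<^sub>R w)"
  proof (rule MVT2[OF assms(3)])
    fix r assume "0 \<le> r" "r \<le> h"
    then show "((\<lambda>r. dderiv v f ((x + s *\<^sub>R v) + r *\<^sub>R w)) has_real_derivative
        dderiv w (dderiv v f) ((x + s *\<^sub>R v) + r *\<^sub>R w)) (at r)"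
      using s by (intro line smooth_on_differentiable[OF smooth_on_dderiv[OF assms(2)]] sub) auto
  qed
  then obtain t where t: "0 < t" "t < h"
    "dderiv v f ((x + s *\<^sub>R v) + h *\<^sub>R w) - dderiv v f (x + s *\<^sub>R v)
      = h * dderiv w (dderiv v f) ((x + s *\<^sub>R v) + t *\<^sub>R w)" by auto
  have "f (x + h *\<^sub>R v + h *\<^sub>R w) - f (x + h *\<^sub>R v) - (f (x + h *\<^sub>R w) - f x) = p h - p 0"
    by (simp add: p_def algebra_simps)
  also have "\<dots> = h * h * dderiv w (dderiv v f) (x + s *\<^sub>R v + t *\<^sub>R w)"
  proof -
    have "x + h *\<^sub>R w + s *\<^sub>R v = (x + s *\<^sub>R v) + h *\<^sub>R w" by (simp add: algebra_simps)
    then show ?thesis using s(3) t(3) by (simp only: mult.assoc)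
  qed
  finally show ?thesis using s t by (intro that[of s t]) auto
qed

lemma dderiv_commute_real:
  fixes f :: "'a::real_normed_vector \<Rightarrow> real"
  assumes "open S" "smooth_on f S" "x \<in> S"
  shows "dderiv v (dderiv w f) x = dderiv w (dderiv v f) x"
proof (rule ccontr)
  define A where "A = dderiv w (dderiv v f)"
  define B where "B = dderiv v (dderiv w f)"
  assume "dderiv v (dderiv w f) x \<noteq> dderiv w (dderiv v f) x"
  then have e: "\<bar>A x - B x\<bar> / 2 > 0" by (simp add: A_def B_def)
  have cont: "isCont A x" "isCont B x"
    using assms smooth_on_continuous[OF smooth_on_dderiv[OF smooth_on_dderiv[OF assms(2)]]]
      continuous_on_eq_continuous_at[OF assms(1)] by (auto simp: A_def B_def)
  obtain d1 where d1: "d1 > 0" "\<And>y. dist y x < d1 \<Longrightarrow> \<bar>A y - A x\<bar> < \<bar>A x - B x\<bar> / 2"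
    using cont(1) e unfolding continuous_at_eps_delta by (metis dist_real_def dist_commute)
  obtain d2 where d2: "d2 > 0" "\<And>y. dist y x < d2 \<Longrightarrow> \<bar>B y - B x\<bar> < \<bar>A x - B x\<bar> / 2"
    using cont(2) e unfolding continuous_at_eps_delta by (metis dist_real_def dist_commute)
  obtain d3 where d3: "d3 > 0" "ball x d3 \<subseteq> S" using assms open_contains_ball by blast
  \<comment> \<open>a parallelogram of side \<open>h\<close> stays within distance \<open>d\<close> of \<open>x\<close>, where both second
    derivatives are closer to their values at \<open>x\<close> than half of their supposed difference\<close>
  define d where "d = min d1 (min d2 d3)"
  define h where "h = d / (2 * (norm v + norm w + 1))"
  have d: "d > 0" using d1 d2 d3 by (simp add: d_def)
  have n: "norm v + norm w + 1 > 0" by (smt (verit) norm_ge_zero)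
  have h: "h > 0" using d n by (simp add: h_def)
  have near: "dist (x + s *\<^sub>R v + t *\<^sub>R w) x < d" if "s \<in> {0..h}" "t \<in> {0..h}" for s t
  proof -
    have "dist (x + s *\<^sub>R v + t *\<^sub>R w) x \<le> \<bar>s\<bar> * norm v + \<bar>t\<bar> * norm w"
      using norm_triangle_ineq[of "s *\<^sub>R v" "t *\<^sub>R w"] by (simp add: dist_norm add.assoc)
    also have "\<dots> \<le> h * norm v + h * norm w"
      using that by (intro add_mono mult_right_mono) auto
    also have "\<dots> \<le> h * (norm v + norm w + 1)" using h by (simp add: algebra_simps)
    also have "\<dots> = d / 2" using n by (simp add: h_def field_simps)
    finally show ?thesis using d by simp
  qed
  have sub: "x + s *\<^sub>R v + t *\<^sub>R w \<in> S" if "s \<in> {0..h}" "t \<in> {0..h}" for s t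
    using near[OF that] d3 by (auto simp: d_def mem_ball dist_commute)
  obtain s t where st: "s \<in> {0..h}" "t \<in> {0..h}"
    "f (x + h *\<^sub>R v + h *\<^sub>R w) - f (x + h *\<^sub>R v) - (f (x + h *\<^sub>R w) - f x)
      = h * h * A (x + s *\<^sub>R v + t *\<^sub>R w)"
    using second_difference_mean_value[OF assms(1,2) h sub] unfolding A_def by blast
  have sub': "x + s *\<^sub>R w + t *\<^sub>R v \<in> S" if "s \<in> {0..h}" "t \<in> {0..h}" for s t
    using sub[OF that(2,1)] by (simp add: add_ac)
  obtain s' t' where st': "s' \<in> {0..h}" "t' \<in> {0..h}"
    "f (x + h *\<^sub>R w + h *\<^sub>R v) - f (x + h *\<^sub>R w) - (f (x + h *\<^sub>R v) - f x)
      = h * h * B (x + s' *\<^sub>R w + t' *\<^sub>R v)"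
    using second_difference_mean_value[OF assms(1,2) h sub'] unfolding B_def by blast
  have sw: "x + h *\<^sub>R w + h *\<^sub>R v = x + h *\<^sub>R v + h *\<^sub>R w" by simp
  have "h * h * A (x + s *\<^sub>R v + t *\<^sub>R w) = h * h * B (x + s' *\<^sub>R w + t' *\<^sub>R v)"
    using st(3) st'(3)[unfolded sw] by linarith
  then have "A (x + s *\<^sub>R v + t *\<^sub>R w) = B (x + s' *\<^sub>R w + t' *\<^sub>R v)" using h by simp
  moreover have "\<bar>A (x + s *\<^sub>R v + t *\<^sub>R w) - A x\<bar> < \<bar>A x - B x\<bar> / 2"
    using near[OF st(1,2)] by (intro d1) (auto simp: d_def)
  moreover have "\<bar>B (x + s' *\<^sub>R w + t' *\<^sub>R v) - B x\<bar> < \<bar>A x - B x\<bar> / 2"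
    using near[OF st'(2,1)] by (intro d2) (auto simp: d_def add_ac)
  ultimately show False by (smt (verit) field_sum_of_halves)
qed

lemma dderiv_commute:
  fixes f :: "'a::real_normed_vector \<Rightarrow> 'c::euclidean_space"
  assumes "open S" "smooth_on f S" "x \<in> S"
  shows "dderiv v (dderiv w f) x = dderiv w (dderiv v f) x"
proof (rule euclidean_eqI)
  fix b :: 'c assume "b \<in> Basis"
  have *: "dderiv u (\<lambda>y. f y \<bullet> b) y = dderiv u f y \<bullet> b" if "y \<in> S" for u y
    by (rule dderiv_linear_comp[OF bounded_linear_inner_left smooth_on_differentiable[OF assms(2) that]])
  have **: "dderiv u (\<lambda>y. dderiv u' f y \<bullet> b) x = dderiv u (dderiv u' f) x \<bullet> b" for u u'
    by (rule dderiv_linear_comp[OF bounded_linear_inner_left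
          smooth_on_differentiable[OF smooth_on_dderiv[OF assms(2)] assms(3)]])
  have "dderiv u (dderiv u' (\<lambda>y. f y \<bullet> b)) x = dderiv u (dderiv u' f) x \<bullet> b"
    for u u'
  proof -
    have "dderiv u (dderiv u' (\<lambda>y. f y \<bullet> b)) x = dderiv u (\<lambda>y. dderiv u' f y \<bullet> b) x"
      by (rule dderiv_cong_open[OF assms(1,3) *])
    then show ?thesis using ** by simp
  qed
  then show "dderiv v (dderiv w f) x \<bullet> b = dderiv w (dderiv v f) x \<bullet> b"
    using dderiv_commute_real[OF assms(1) _ assms(3), where f = "\<lambda>y. f y \<bullet> b" and v = v and w = w]
      smooth_on_inner_left[OF assms(1,2)] by metis
qed

section \<open>Inner products in terms of a fixed basis\<close>

text \<open>The \<open>j\<close>-th column of the inverse of the matrix of \<open>B\<close>. It represents the \<open>j\<close>-th coordinate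
  functional: \<open>B u (dual_vec B j) = u \<bullet> j\<close>.\<close>

definition dual_vec :: "('e::euclidean_space \<Rightarrow> 'e \<Rightarrow> real) \<Rightarrow> 'e \<Rightarrow> 'e" where
  "dual_vec B j = inv (\<lambda>v. \<Sum>k\<in>Basis. B k v *\<^sub>R k) j"

text \<open>The vector representing a linear functional, that is, the functional with its index raised.\<close>

definition raise :: "('e::euclidean_space \<Rightarrow> 'e \<Rightarrow> real) \<Rightarrow> ('e \<Rightarrow> real) \<Rightarrow> 'e" where
  "raise B \<theta> = (\<Sum>k\<in>Basis. \<theta> k *\<^sub>R dual_vec B k)"

text \<open>The contraction \<open>B\<^sup>i\<^sup>j T\<^sub>i\<^sub>j\<close> with the inverse matrix.\<close>

definition metric_trace ::
  "('e::euclidean_space \<Rightarrow> 'e \<Rightarrow> real) \<Rightarrow> ('e \<Rightarrow> 'e \<Rightarrow> real) \<Rightarrow> real" where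
  "metric_trace B T = (\<Sum>k\<in>Basis. T (dual_vec B k) k)"

lemma linear_expand:
  fixes f :: "'e::euclidean_space \<Rightarrow> 'c::real_vector"
  assumes "linear f"
  shows "f u = (\<Sum>k\<in>Basis. (u \<bullet> k) *\<^sub>R f k)"
proof -
  interpret linear f by fact
  show ?thesis
    by (subst euclidean_representation[of u, symmetric]) (simp add: sum scale del: euclidean_representation)
qed

lemma trace_commute:
  fixes f g :: "'e::euclidean_space \<Rightarrow> 'e"
  assumes "linear f" "linear g"
  shows "(\<Sum>k\<in>Basis. f (g k) \<bullet> k) = (\<Sum>k\<in>Basis. g (f k) \<bullet> k)"
proof -
  have "(\<Sum>k\<in>Basis. f (g k) \<bullet> k) = (\<Sum>k\<in>Basis. \<Sum>l\<in>Basis. (g k \<bullet> l) * (f l \<bullet> k))"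
    by (subst linear_expand[OF assms(1), of "g _"]) (simp add: inner_sum_left)
  also have "\<dots> = (\<Sum>l\<in>Basis. \<Sum>k\<in>Basis. (f l \<bullet> k) * (g k \<bullet> l))"
    by (subst sum.swap) (simp add: mult.commute)
  also have "\<dots> = (\<Sum>l\<in>Basis. g (f l) \<bullet> l)"
    by (subst linear_expand[OF assms(2), of "f _"]) (simp add: inner_sum_left)
  finally show ?thesis .
qed

lemma bilinearD:
  assumes "bilinear B"
  shows "linear (B u)" "linear (\<lambda>u. B u v)"
  using assms by (auto simp: bilinear_def)

lemmas bilinear_simps = bilinear_ladd bilinear_radd bilinear_lsub bilinear_rsub
  bilinear_lmul bilinear_rmul bilinear_lzero bilinear_rzero

locale inner_form =
  fixes B :: "'e::euclidean_space \<Rightarrow> 'e \<Rightarrow> real"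
  assumes bil: "bilinear B" and sym: "B u v = B v u" and pos: "u \<noteq> 0 \<Longrightarrow> B u u > 0"
begin

lemma nondegenerate:
  assumes "\<And>z. B u z = B v z" shows "u = v"
proof (rule ccontr)
  assume "u \<noteq> v"
  then have "B (u - v) (u - v) > 0" by (intro pos) simp
  moreover have "B (u - v) (u - v) = 0" using assms by (simp add: bilinear_lsub[OF bil])
  ultimately show False by simp
qed

lemma dual: "B u (dual_vec B j) = u \<bullet> j"
proof -
  define L where "L = (\<lambda>v. \<Sum>k\<in>Basis. B k v *\<^sub>R k)"
  have comp: "L v \<bullet> k = B k v" if "k \<in> Basis" for k v
    using that by (simp add: L_def inner_sum_left_Basis)
  have lin: "linear L"
    unfolding L_def
    by (intro linear_compose_sum ballI linear_compose[OF bilinearD(1)[OF bil], unfolded o_def])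
      (auto intro: linear_scale_left)
  have "inj L"
  proof (subst linear_injective_0[OF lin], intro allI impI)
    fix v assume "L v = 0"
    then have "B k v = 0" if "k \<in> Basis" for k using comp[OF that, of v] by simp
    then have "B v v = 0"
      by (subst linear_expand[OF bilinearD(2)[OF bil], of v v]) simp
    then show "v = 0" using pos[of v] by fastforce
  qed
  then have "surj L" using lin linear_injective_imp_surjective by blast
  then have "L (dual_vec B j) = j"
    unfolding dual_vec_def L_def[symmetric] by (rule surj_f_inv_f)
  then have "B k (dual_vec B j) = j \<bullet> k" if "k \<in> Basis" for k
    using comp[OF that, of "dual_vec B j"] by simp
  then have "B u (dual_vec B j) = (\<Sum>k\<in>Basis. (u \<bullet> k) * (j \<bullet> k))"
    by (subst linear_expand[OF bilinearD(2)[OF bil]]) simp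
  then show ?thesis by (simp add: euclidean_inner[of u j])
qed

lemma dual': "B (dual_vec B j) u = u \<bullet> j"
  by (simp add: sym[of _ u] dual)

lemma raise: "linear \<theta> \<Longrightarrow> B (raise B \<theta>) u = \<theta> u"
  unfolding raise_def
  by (subst linear_sum[OF bilinearD(2)[OF bil]])
    (simp add: bilinear_lmul[OF bil] dual' linear_expand[of \<theta> u] mult.commute)

lemma trace_eq_metric_trace:
  "(\<Sum>k\<in>Basis. f k \<bullet> k) = (\<Sum>k\<in>Basis. B (f k) (dual_vec B k))"
  by (simp add: dual)

text \<open>The inverse matrix is symmetric, whether or not \<open>T\<close> is.\<close>

lemma metric_trace_swap:
  assumes "bilinear T"
  shows "metric_trace B (\<lambda>u v. T v u) = metric_trace B T"
proof -
  have symd: "dual_vec B i \<bullet> j = dual_vec B j \<bullet> i" for i j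
    using dual[of "dual_vec B i" j] dual'[of i "dual_vec B j"] by simp
  have "metric_trace B (\<lambda>u v. T v u) = (\<Sum>k\<in>Basis. \<Sum>l\<in>Basis. (dual_vec B k \<bullet> l) * T k l)"
    unfolding metric_trace_def
    by (subst linear_expand[OF bilinearD(1)[OF assms]]) simp
  also have "\<dots> = (\<Sum>l\<in>Basis. \<Sum>k\<in>Basis. (dual_vec B l \<bullet> k) * T k l)"
    by (subst sum.swap) (simp add: symd)
  also have "\<dots> = metric_trace B T"
    unfolding metric_trace_def
    by (subst (2) linear_expand[OF bilinearD(2)[OF assms]]) simp
  finally show ?thesis .
qed

lemma metric_trace_form:
  assumes "linear f"
  shows "metric_trace B (\<lambda>u v. B u (f v)) = (\<Sum>k\<in>Basis. f k \<bullet> k)"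
  by (simp add: metric_trace_def dual')

lemma bilinear_form_repr:
  assumes "bilinear T"
  obtains f where "linear f" "\<And>u v. T u v = B u (f v)"
proof -
  define f where "f v = raise B (\<lambda>u. T u v)" for v
  have *: "B u (f v) = T u v" for u v
    unfolding f_def by (subst sym) (simp add: raise bilinearD[OF assms])
  have "linear f"
  proof (rule linearI)
    show "f (u + v) = f u + f v" for u v
      by (rule nondegenerate)
        (subst (1 2) sym, simp add: * bilinear_simps[OF bil] bilinear_simps[OF assms])
    show "f (c *\<^sub>R v) = c *\<^sub>R f v" for c v
      by (rule nondegenerate)
        (subst (1 2) sym, simp add: * bilinear_simps[OF bil] bilinear_simps[OF assms])
  qed
  then show ?thesis using that[of f] * by simp
qed

end

text \<open>Both sides are the trace of the endomorphism representing \<open>T\<close>; passing to the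
  pulled back inner product conjugates this endomorphism by \<open>A\<close>.\<close>

lemma metric_trace_pullback:
  fixes A :: "'e::euclidean_space \<Rightarrow> 'e"
  assumes "inner_form B" "inner_form B'" "linear A" "\<And>u v. B' u v = B (A u) (A v)" "bilinear T"
  shows "metric_trace B' (\<lambda>u v. T (A u) (A v)) = metric_trace B T"
proof -
  interpret inner_form B by fact
  interpret B': inner_form B' by fact
  have inj: "inj A"
    unfolding linear_injective_0[OF assms(3)]
    using B'.pos assms(4) by (metis bil bilinear_lzero less_irrefl)
  then obtain A' where A': "linear A'" "\<And>x. A' (A x) = x" "\<And>x. A (A' x) = x"
    using linear_injective_isomorphism[OF assms(3)] by blast
  obtain f where f: "linear f" "\<And>u v. T u v = B u (f v)"
    using bilinear_form_repr[OF assms(5)] by blast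
  have lin: "linear (\<lambda>v. f (A v))" "linear (\<lambda>v. A' (f (A v)))"
    using linear_compose[OF assms(3) f(1)] linear_compose[OF _ A'(1)] by (auto simp: o_def)
  have "metric_trace B' (\<lambda>u v. T (A u) (A v)) = metric_trace B' (\<lambda>u v. B' u (A' (f (A v))))"
    by (simp add: f assms(4) A')
  also have "\<dots> = (\<Sum>k\<in>Basis. A' (f (A k)) \<bullet> k)" by (rule B'.metric_trace_form[OF lin(2)])
  also have "\<dots> = (\<Sum>k\<in>Basis. f (A (A' k)) \<bullet> k)" by (rule trace_commute[OF A'(1) lin(1)])
  also have "\<dots> = metric_trace B T"
    using metric_trace_form[OF f(1)] by (simp add: A' f(2)[symmetric])
  finally show ?thesis .
qed


section \<open>Fields of linear and bilinear maps\<close>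

text \<open>Tensor fields in a coordinate domain are evaluated on constant vectors; these are the
  conditions under which they may also be evaluated on vector fields and differentiated by the
  product rule.\<close>

definition linear_field :: "'x::real_normed_vector set \<Rightarrow>
    ('x \<Rightarrow> 'e::euclidean_space \<Rightarrow> 'c::real_normed_vector) \<Rightarrow> bool" where
  "linear_field S A \<longleftrightarrow> open S \<and> (\<forall>x\<in>S. linear (A x)) \<and> (\<forall>u. smooth_on (\<lambda>x. A x u) S)"

definition bilinear_field :: "'x::real_normed_vector set \<Rightarrow>
    ('x \<Rightarrow> 'e::euclidean_space \<Rightarrow> 'e \<Rightarrow> 'c::real_normed_vector) \<Rightarrow> bool" where
  "bilinear_field S B \<longleftrightarrow> open S \<and> (\<forall>x\<in>S. bilinear (B x)) \<and> (\<forall>u v. smooth_on (\<lambda>x. B x u v) S)"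

lemma linear_fieldD:
  assumes "linear_field S A"
  shows "x \<in> S \<Longrightarrow> linear (A x)" "smooth_on (\<lambda>x. A x u) S"
  using assms by (simp_all add: linear_field_def)

lemma bilinear_fieldD:
  assumes "bilinear_field S B"
  shows "x \<in> S \<Longrightarrow> bilinear (B x)" "smooth_on (\<lambda>x. B x u v) S"
  using assms by (simp_all add: bilinear_field_def)

lemma linear_field_expand:
  "linear_field S A \<Longrightarrow> x \<in> S \<Longrightarrow> A x u = (\<Sum>i\<in>Basis. (u \<bullet> i) *\<^sub>R A x i)"
  using linear_expand unfolding linear_field_def by blast

text \<open>Expanding the argument in the basis reduces the rule to the product rule for its coordinates.\<close>

lemma linear_field_apply:
  assumes A: "linear_field S A" and V: "smooth_on V S"
  shows "smooth_on (\<lambda>x. A x (V x)) S"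
    and "x \<in> S \<Longrightarrow>
      dderiv X (\<lambda>y. A y (V y)) x = dderiv X (\<lambda>y. A y (V x)) x + A x (dderiv X V x)"
proof -
  have S: "open S" and lin: "\<And>x. x \<in> S \<Longrightarrow> linear (A x)" and sm: "\<And>u. smooth_on (\<lambda>x. A x u) S"
    using A by (auto simp: linear_field_def)
  have "smooth_on (\<lambda>x. \<Sum>i\<in>Basis. (V x \<bullet> i) *\<^sub>R A x i) S"
    by (intro smooth_on_sum smooth_on_scaleR smooth_on_inner_left S V sm)
  then show "smooth_on (\<lambda>x. A x (V x)) S"
    by (rule smooth_on_cong[OF S]) (rule linear_field_expand[OF A, symmetric])
  assume x: "x \<in> S"
  note d = smooth_on_differentiable[OF sm x] smooth_on_differentiable[OF V x]
  have dV: "(\<lambda>y. V y \<bullet> i) differentiable at x" for i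
    by (intro differentiable_linear_comp[OF bounded_linear_inner_left] d)
  have "dderiv X (\<lambda>y. A y (V y)) x = dderiv X (\<lambda>y. \<Sum>i\<in>Basis. (V y \<bullet> i) *\<^sub>R A y i) x"
    by (rule dderiv_cong_open[OF S x linear_field_expand[OF A]])
  also have "\<dots> = (\<Sum>i\<in>Basis. (V x \<bullet> i) *\<^sub>R dderiv X (\<lambda>y. A y i) x + (dderiv X V x \<bullet> i) *\<^sub>R A x i)"
    using d dV
    by (subst dderiv_sum) (simp_all add: dderiv_scaleR dderiv_linear_comp[OF bounded_linear_inner_left]
        differentiable_bilinear_comp[OF bounded_bilinear_scaleR])
  also have "\<dots> = (\<Sum>i\<in>Basis. (V x \<bullet> i) *\<^sub>R dderiv X (\<lambda>y. A y i) x) + A x (dderiv X V x)"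
    using linear_field_expand[OF A x, of "dderiv X V x"] by (simp add: sum.distrib)
  also have "(\<Sum>i\<in>Basis. (V x \<bullet> i) *\<^sub>R dderiv X (\<lambda>y. A y i) x)
      = dderiv X (\<lambda>y. \<Sum>i\<in>Basis. (V x \<bullet> i) *\<^sub>R A y i) x"
    using d by (subst dderiv_sum) (simp_all add: dderiv_scaleR)
  also have "\<dots> = dderiv X (\<lambda>y. A y (V x)) x"
    by (rule dderiv_cong_open[OF S x linear_field_expand[OF A, symmetric]])
  finally show "dderiv X (\<lambda>y. A y (V y)) x = dderiv X (\<lambda>y. A y (V x)) x + A x (dderiv X V x)" .
qed

lemma linear_field_dderiv:
  assumes A: "linear_field S A"
  shows "linear_field S (\<lambda>x u. dderiv X (\<lambda>y. A y u) x)"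
proof -
  have S: "open S" and lin: "\<And>x. x \<in> S \<Longrightarrow> linear (A x)" and sm: "\<And>u. smooth_on (\<lambda>x. A x u) S"
    using A by (auto simp: linear_field_def)
  have "linear (\<lambda>u. dderiv X (\<lambda>y. A y u) x)" if x: "x \<in> S" for x
  proof (rule linearI)
    fix u v and c :: real
    have "dderiv X (\<lambda>y. A y (u + v)) x = dderiv X (\<lambda>y. A y u + A y v) x"
      by (rule dderiv_cong_open[OF S x]) (rule linear_add[OF lin])
    then show "dderiv X (\<lambda>y. A y (u + v)) x = dderiv X (\<lambda>y. A y u) x + dderiv X (\<lambda>y. A y v) x"
      using smooth_on_differentiable[OF sm x] by (simp add: dderiv_add)
    have "dderiv X (\<lambda>y. A y (c *\<^sub>R u)) x = dderiv X (\<lambda>y. c *\<^sub>R A y u) x"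
      by (rule dderiv_cong_open[OF S x]) (rule linear_cmul[OF lin])
    then show "dderiv X (\<lambda>y. A y (c *\<^sub>R u)) x = c *\<^sub>R dderiv X (\<lambda>y. A y u) x"
      using smooth_on_differentiable[OF sm x] by (simp add: dderiv_scaleR)
  qed
  moreover have "smooth_on (\<lambda>x. dderiv X (\<lambda>y. A y u) x) S" for u
    by (rule smooth_on_dderiv[OF sm])
  ultimately show ?thesis using S by (simp add: linear_field_def)
qed

lemma linear_field_direction:
  fixes f :: "'e::euclidean_space \<Rightarrow> 'c::real_normed_vector"
  shows "open S \<Longrightarrow> smooth_on f S \<Longrightarrow> linear_field S (\<lambda>x u. dderiv u f x)"
  unfolding linear_field_def
  by (intro conjI ballI allI linear_dderiv smooth_on_dderiv) (simp_all add: smooth_on_differentiable)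

lemma bilinear_field_slots:
  assumes "bilinear_field S B"
  shows "linear_field S (\<lambda>x. B x u)" "linear_field S (\<lambda>x u. B x u v)"
  using assms unfolding bilinear_field_def linear_field_def bilinear_def by blast+

lemma bilinear_fieldI:
  assumes "\<And>u. linear_field S (\<lambda>x v. B x u v)" "\<And>v. linear_field S (\<lambda>x u. B x u v)"
  shows "bilinear_field S B"
  using assms unfolding bilinear_field_def linear_field_def bilinear_def by blast

lemma bilinear_field_apply:
  assumes B: "bilinear_field S B" and V: "smooth_on V S" and W: "smooth_on W S"
  shows "smooth_on (\<lambda>x. B x (V x) (W x)) S"
    and "x \<in> S \<Longrightarrow> dderiv X (\<lambda>y. B y (V y) (W y)) x
      = dderiv X (\<lambda>y. B y (V x) (W x)) x + B x (dderiv X V x) (W x) + B x (V x) (dderiv X W x)"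
proof -
  have S: "open S" and bil: "\<And>x. x \<in> S \<Longrightarrow> bilinear (B x)"
    using B by (auto simp: bilinear_field_def)
  have *: "linear_field S (\<lambda>x u. B x u (W x))"
    unfolding linear_field_def
    using S bilinearD(2)[OF bil] linear_field_apply(1)[OF bilinear_field_slots(1)[OF B] W] by simp
  show "smooth_on (\<lambda>x. B x (V x) (W x)) S" by (rule linear_field_apply(1)[OF * V])
  assume x: "x \<in> S"
  show "dderiv X (\<lambda>y. B y (V y) (W y)) x
      = dderiv X (\<lambda>y. B y (V x) (W x)) x + B x (dderiv X V x) (W x) + B x (V x) (dderiv X W x)"
    using linear_field_apply(2)[OF * V x]
      linear_field_apply(2)[OF bilinear_field_slots(1)[OF B] W x] by (simp add: add_ac)
qed

lemma bilinear_field_dderiv: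
  assumes "bilinear_field S B"
  shows "bilinear_field S (\<lambda>x u v. dderiv X (\<lambda>y. B y u v) x)"
  by (rule bilinear_fieldI)
    (rule linear_field_dderiv[OF bilinear_field_slots(1)[OF assms]],
      rule linear_field_dderiv[OF bilinear_field_slots(2)[OF assms]])


section \<open>Smoothness of the inverse metric\<close>

locale metric_field =
  fixes S :: "'x::real_normed_vector set" and G :: "'x \<Rightarrow> 'e::euclidean_space \<Rightarrow> 'e \<Rightarrow> real"
  assumes field: "bilinear_field S G"
    and Gsym: "x \<in> S \<Longrightarrow> G x u v = G x v u"
    and Gpos: "x \<in> S \<Longrightarrow> u \<noteq> 0 \<Longrightarrow> G x u u > 0"
begin

lemma openS: "open S"
  using field by (simp add: bilinear_field_def)

lemma Gbil: "x \<in> S \<Longrightarrow> bilinear (G x)"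
  using field by (simp add: bilinear_field_def)

lemma Gsmooth: "smooth_on (\<lambda>x. G x u v) S"
  using field by (simp add: bilinear_field_def)

lemmas Gdiff = smooth_on_differentiable[OF Gsmooth]

lemma inner_form: "x \<in> S \<Longrightarrow> inner_form (G x)"
  using Gbil Gsym Gpos by unfold_locales auto

text \<open>The identity \<open>G\<^sub>y\<^sup>-\<^sup>1 = G\<^sub>x\<^sup>-\<^sup>1 - G\<^sub>y\<^sup>-\<^sup>1 (G\<^sub>y - G\<^sub>x) G\<^sub>x\<^sup>-\<^sup>1\<close> for columns. It yields the continuity and the
  differentiability of the inverse matrix.\<close>

lemma dual_difference:
  assumes "x \<in> S" "y \<in> S"
  shows "dual_vec (G y) j = dual_vec (G x) j -
    (\<Sum>k\<in>Basis. (G y (dual_vec (G x) j) k - G x (dual_vec (G x) j) k) *\<^sub>R dual_vec (G y) k)"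
proof -
  interpret Gx: inner_form "G x" by (rule inner_form[OF assms(1)])
  interpret Gy: inner_form "G y" by (rule inner_form[OF assms(2)])
  define \<theta> where "\<theta> u = G y (dual_vec (G x) j) u - G x (dual_vec (G x) j) u" for u
  have "linear \<theta>" unfolding \<theta>_def
    by (intro linear_compose_sub bilinearD Gx.bil Gy.bil)
  then have "G y (dual_vec (G y) j) u = G y (dual_vec (G x) j - raise (G y) \<theta>) u" for u
    by (simp add: bilinear_lsub[OF Gy.bil] Gy.raise Gy.dual' \<theta>_def Gx.dual')
  then have "dual_vec (G y) j = dual_vec (G x) j - raise (G y) \<theta>" by (rule Gy.nondegenerate)
  then show ?thesis by (simp add: raise_def \<theta>_def)
qed

lemma dual_isCont:
  assumes x: "x \<in> S"
  shows "isCont (\<lambda>y. dual_vec (G y) j) x"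
proof -
  define F where "F k l y = G y (dual_vec (G x) k) l - G x (dual_vec (G x) k) l" for k l y
  define m where "m y = (\<Sum>k\<in>Basis. norm (dual_vec (G y) k))" for y
  have Gc: "isCont (\<lambda>y. G y u v) x" for u v
    using Gdiff[OF x] differentiable_imp_continuous_within by blast
  have near: "\<forall>\<^sub>F y in at x. y \<in> S"
    using openS x by (metis eventually_at_topological)
  have F: "((\<lambda>y. \<Sum>k\<in>Basis. \<Sum>l\<in>Basis. \<bar>F k l y\<bar>) \<longlongrightarrow> 0) (at x)"
  proof -
    have "isCont (\<lambda>y. \<Sum>k\<in>Basis. \<Sum>l\<in>Basis. \<bar>F k l y\<bar>) x"
      unfolding F_def by (intro continuous_intros Gc)
    then show ?thesis by (simp add: isCont_def F_def)
  qed
  have eq: "dual_vec (G y) k = dual_vec (G x) k - (\<Sum>l\<in>Basis. F k l y *\<^sub>R dual_vec (G y) l)"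
    if "y \<in> S" for k y
    unfolding F_def by (rule dual_difference[OF x that])
  have small: "norm (\<Sum>l\<in>Basis. F k l y *\<^sub>R dual_vec (G y) l) \<le> (\<Sum>l\<in>Basis. \<bar>F k l y\<bar>) * m y"
    for k y
  proof -
    have "norm (dual_vec (G y) l) \<le> m y" if "l \<in> Basis" for l
      unfolding m_def by (rule member_le_sum[OF that]) auto
    then have "norm (F k l y *\<^sub>R dual_vec (G y) l) \<le> \<bar>F k l y\<bar> * m y" if "l \<in> Basis" for l
      using that by (simp add: mult_left_mono)
    then show ?thesis unfolding sum_distrib_right by (intro sum_norm_le)
  qed
  \<comment> \<open>the difference formula gives \<open>m y \<le> m x + m y / 2\<close> near \<open>x\<close>, which bounds the inverse there\<close>
  have mbound: "\<forall>\<^sub>F y in at x. m y \<le> 2 * m x"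
    using near order_tendstoD(2)[OF F half_gt_zero[OF zero_less_one]]
  proof eventually_elim
    case (elim y)
    have "m y \<le> (\<Sum>k\<in>Basis. norm (dual_vec (G x) k) + (\<Sum>l\<in>Basis. \<bar>F k l y\<bar>) * m y)"
      unfolding m_def[of y]
    proof (rule sum_mono)
      fix k
      show "norm (dual_vec (G y) k) \<le>
          norm (dual_vec (G x) k) + (\<Sum>l\<in>Basis. \<bar>F k l y\<bar>) * (\<Sum>k\<in>Basis. norm (dual_vec (G y) k))"
        using arg_cong[OF eq[OF elim(1), of k], of norm] small[of k y, unfolded m_def]
          norm_triangle_ineq4[of "dual_vec (G x) k" "\<Sum>l\<in>Basis. F k l y *\<^sub>R dual_vec (G y) l"]
        by linarith
    qed
    also have "\<dots> = m x + (\<Sum>k\<in>Basis. \<Sum>l\<in>Basis. \<bar>F k l y\<bar>) * m y"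
      by (simp add: sum.distrib m_def[of x] sum_distrib_right)
    also have "\<dots> \<le> m x + (1/2) * m y"
      using elim by (intro add_left_mono mult_right_mono) (auto simp: m_def sum_nonneg)
    finally show ?case by simp
  qed
  have "((\<lambda>y. \<Sum>l\<in>Basis. F j l y *\<^sub>R dual_vec (G y) l) \<longlongrightarrow> 0) (at x)"
  proof (rule Lim_null_comparison)
    show "\<forall>\<^sub>F y in at x. norm (\<Sum>l\<in>Basis. F j l y *\<^sub>R dual_vec (G y) l)
        \<le> (\<Sum>l\<in>Basis. \<bar>F j l y\<bar>) * (2 * m x)"
      using mbound
    proof eventually_elim
      case (elim y)
      then show ?case
        using small[of j y] by (meson order_trans mult_left_mono sum_nonneg abs_ge_zero)
    qed
    have "isCont (\<lambda>y. (\<Sum>l\<in>Basis. \<bar>F j l y\<bar>) * (2 * m x)) x"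
      unfolding F_def by (intro continuous_intros Gc)
    then show "((\<lambda>y. (\<Sum>l\<in>Basis. \<bar>F j l y\<bar>) * (2 * m x)) \<longlongrightarrow> 0) (at x)"
      by (simp add: isCont_def F_def)
  qed
  then have "((\<lambda>y. dual_vec (G x) j - (\<Sum>l\<in>Basis. F j l y *\<^sub>R dual_vec (G y) l))
      \<longlongrightarrow> dual_vec (G x) j - 0) (at x)"
    by (intro tendsto_intros)
  moreover have "\<forall>\<^sub>F y in at x.
      dual_vec (G x) j - (\<Sum>l\<in>Basis. F j l y *\<^sub>R dual_vec (G y) l) = dual_vec (G y) j"
    using near by eventually_elim (rule eq[symmetric])
  ultimately show ?thesis unfolding isCont_def by (simp add: tendsto_cong)
qed

end

text \<open>Since \<open>f x = 0\<close>, the difference quotient of the product at \<open>x\<close> is that of \<open>f\<close> times \<open>h y\<close>, and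
  \<open>h y\<close> only has to converge.\<close>

lemma has_derivative_zero_times_continuous:
  fixes f :: "'x::real_normed_vector \<Rightarrow> real" and h :: "'x \<Rightarrow> 'c::real_normed_vector"
  assumes "(f has_derivative f') (at x)" "f x = 0" "isCont h x"
  shows "((\<lambda>y. f y *\<^sub>R h y) has_derivative (\<lambda>v. f' v *\<^sub>R h x)) (at x)"
proof -
  have 1: "((\<lambda>y. f y *\<^sub>R h x) has_derivative (\<lambda>v. f' v *\<^sub>R h x)) (at x)"
    by (rule has_derivative_scaleR_left[OF assms(1)])
  have 2: "((\<lambda>y. f y *\<^sub>R (h y - h x)) has_derivative (\<lambda>v. 0)) (at x)"
  proof -
    have "bounded_linear f'" using assms(1) by (rule has_derivative_bounded_linear)
    then obtain K where K: "\<And>v. norm (f' v) \<le> norm v * K" "K > 0"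
      using bounded_linear.pos_bounded by blast
    have e: "((\<lambda>y. norm (f y - f x - f' (y - x)) / norm (y - x)) \<longlongrightarrow> 0) (at x)"
      using assms(1) by (simp add: has_derivative_iff_norm)
    have h: "((\<lambda>y. norm (h y - h x)) \<longlongrightarrow> 0) (at x)"
      using assms(3) by (simp add: isCont_def LIM_zero_iff tendsto_norm_zero_iff)
    have "((\<lambda>y. norm (f y *\<^sub>R (h y - h x)) / norm (y - x)) \<longlongrightarrow> 0) (at x)"
    proof (rule Lim_null_comparison)
      show "\<forall>\<^sub>F y in at x. norm (norm (f y *\<^sub>R (h y - h x)) / norm (y - x))
          \<le> (norm (f y - f x - f' (y - x)) / norm (y - x) + K) * norm (h y - h x)"
        using eventually_neq_at_within[of x x UNIV]
      proof eventually_elim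
        case (elim y)
        have "norm (f y) \<le> norm (f y - f x - f' (y - x)) + norm (f' (y - x))"
          using norm_triangle_ineq[of "f y - f x - f' (y - x)" "f' (y - x)"] assms(2) by simp
        also have "\<dots> \<le> norm (f y - f x - f' (y - x)) + norm (y - x) * K" using K by simp
        finally have "norm (f y) / norm (y - x) \<le> norm (f y - f x - f' (y - x)) / norm (y - x) + K"
          using elim by (simp add: field_simps)
        then have "norm (f y) / norm (y - x) * norm (h y - h x)
            \<le> (norm (f y - f x - f' (y - x)) / norm (y - x) + K) * norm (h y - h x)"
          by (rule mult_right_mono) simp
        then show ?case by simp
      qed
      have "((\<lambda>y. (norm (f y - f x - f' (y - x)) / norm (y - x) + K) * norm (h y - h x))
          \<longlongrightarrow> (0 + K) * 0) (at x)"
        by (intro tendsto_intros e h)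
      then show "((\<lambda>y. (norm (f y - f x - f' (y - x)) / norm (y - x) + K) * norm (h y - h x))
          \<longlongrightarrow> 0) (at x)" by simp
    qed
    then show ?thesis by (simp add: has_derivative_iff_norm bounded_linear_zero assms(2))
  qed
  show ?thesis using has_derivative_add[OF 1 2] by (simp add: algebra_simps)
qed

context metric_field
begin

lemma dual_has_derivative:
  assumes x: "x \<in> S"
  shows "((\<lambda>y. dual_vec (G y) j) has_derivative
    (\<lambda>X. - (\<Sum>k\<in>Basis. dderiv X (\<lambda>y. G y (dual_vec (G x) j) k) x *\<^sub>R dual_vec (G x) k))) (at x)"
proof -
  have F: "((\<lambda>y. G y (dual_vec (G x) j) k - G x (dual_vec (G x) j) k) has_derivative
      (\<lambda>X. dderiv X (\<lambda>y. G y (dual_vec (G x) j) k) x)) (at x)" for k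
    using has_derivative_diff[OF has_derivative_dderiv[OF Gdiff[OF x]] has_derivative_const] by simp
  have Z: "((\<lambda>y. (G y (dual_vec (G x) j) k - G x (dual_vec (G x) j) k) *\<^sub>R dual_vec (G y) k)
      has_derivative (\<lambda>X. dderiv X (\<lambda>y. G y (dual_vec (G x) j) k) x *\<^sub>R dual_vec (G x) k)) (at x)" for k
    by (rule has_derivative_zero_times_continuous[OF F _ dual_isCont[OF x]]) simp
  have "((\<lambda>y. dual_vec (G x) j - (\<Sum>k\<in>Basis.
        (G y (dual_vec (G x) j) k - G x (dual_vec (G x) j) k) *\<^sub>R dual_vec (G y) k)) has_derivative
      (\<lambda>X. 0 - (\<Sum>k\<in>Basis. dderiv X (\<lambda>y. G y (dual_vec (G x) j) k) x *\<^sub>R dual_vec (G x) k))) (at x)"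
    by (intro has_derivative_diff[OF has_derivative_const has_derivative_sum] Z)
  then have "((\<lambda>y. dual_vec (G x) j - (\<Sum>k\<in>Basis.
        (G y (dual_vec (G x) j) k - G x (dual_vec (G x) j) k) *\<^sub>R dual_vec (G y) k)) has_derivative
      (\<lambda>X. - (\<Sum>k\<in>Basis. dderiv X (\<lambda>y. G y (dual_vec (G x) j) k) x *\<^sub>R dual_vec (G x) k))) (at x)"
    by simp
  then show ?thesis
    by (rule has_derivative_transform_within_open[OF _ openS x]) (rule dual_difference[OF x, symmetric])
qed

lemma dderiv_dual:
  "x \<in> S \<Longrightarrow> dderiv X (\<lambda>y. dual_vec (G y) j) x =
    - (\<Sum>k\<in>Basis. dderiv X (\<lambda>y. G y (dual_vec (G x) j) k) x *\<^sub>R dual_vec (G x) k)"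
  by (rule dderiv_eqI[OF dual_has_derivative])

text \<open>The derivative of the inverse matrix is a polynomial in the inverse matrix and the derivatives
  of \<open>G\<close>, so that each order of differentiability yields the next.\<close>

lemma smooth_dual: "smooth_on (\<lambda>x. dual_vec (G x) j) S"
  unfolding smooth_on_def
proof
  fix n show "Ck_on n (\<lambda>x. dual_vec (G x) j) S"
  proof (induction n arbitrary: j)
    case 0
    then show ?case by (simp add: dual_isCont continuous_at_imp_continuous_on)
  next
    case (Suc n)
    have "Ck_on n (dderiv X (\<lambda>y. dual_vec (G y) j)) S" for X
    proof (rule Ck_on_cong[OF openS])
      show "Ck_on n (\<lambda>x. - (\<Sum>k\<in>Basis. (\<Sum>i\<in>Basis. (dual_vec (G x) j \<bullet> i) *
          dderiv X (\<lambda>y. G y i k) x) *\<^sub>R dual_vec (G x) k)) S"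
        by (intro Ck_on_sum Ck_on_linear_comp[OF _ bounded_linear_minus[OF bounded_linear_ident]]
            Ck_on_bilinear_comp[OF _ bounded_bilinear_scaleR]
            Ck_on_bilinear_comp[OF _ bounded_bilinear_mult]
            Ck_on_linear_comp[OF _ bounded_linear_inner_left] openS Suc.IH)
          (use smooth_on_dderiv[OF Gsmooth] in \<open>auto simp: smooth_on_def\<close>)
    next
      fix x assume x: "x \<in> S"
      have "dderiv X (\<lambda>y. G y (dual_vec (G x) j) k) x = (\<Sum>i\<in>Basis. (dual_vec (G x) j \<bullet> i) *
          dderiv X (\<lambda>y. G y i k) x)" for k
        using linear_field_expand[OF linear_field_dderiv[OF bilinear_field_slots(2)[OF field]] x,
            where u = "dual_vec (G x) j"]
        unfolding real_scaleR_def .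
      then show "- (\<Sum>k\<in>Basis. (\<Sum>i\<in>Basis. (dual_vec (G x) j \<bullet> i) *
          dderiv X (\<lambda>y. G y i k) x) *\<^sub>R dual_vec (G x) k) = dderiv X (\<lambda>y. dual_vec (G y) j) x"
        by (simp add: dderiv_dual[OF x])
    qed
    moreover have "(\<lambda>y. dual_vec (G y) j) differentiable at x" if "x \<in> S" for x
      using dual_has_derivative[OF that] differentiable_def by blast
    ultimately show ?case by (simp add: Ck_on_Suc_dderiv)
  qed
qed

lemma smooth_raise:
  "(\<And>k. smooth_on (\<lambda>x. \<theta> x k) S) \<Longrightarrow> smooth_on (\<lambda>x. raise (G x) (\<theta> x)) S"
  unfolding raise_def by (intro smooth_on_sum smooth_on_scaleR smooth_dual openS)

lemma smooth_metric_trace: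
  assumes "bilinear_field S T"
  shows "smooth_on (\<lambda>x. metric_trace (G x) (T x)) S"
  unfolding metric_trace_def
  by (intro smooth_on_sum openS bilinear_field_apply(1)[OF assms smooth_dual smooth_on_const])

end

section \<open>Connection and curvature in a coordinate domain\<close>

definition koszul ::
  "('e::euclidean_space \<Rightarrow> 'e \<Rightarrow> 'e \<Rightarrow> real) \<Rightarrow> 'e \<Rightarrow> 'e \<Rightarrow> 'e \<Rightarrow> 'e \<Rightarrow> real" where
  "koszul G x X Y Z =
     (dderiv X (\<lambda>y. G y Y Z) x + dderiv Y (\<lambda>y. G y X Z) x - dderiv Z (\<lambda>y. G y X Y) x) / 2"

text \<open>The vector \<open>\<nabla>\<^sub>X Y\<close> for constant \<open>X\<close> and \<open>Y\<close>; its components are the Christoffel symbols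
  \<open>\<Gamma>\<^sup>k\<^sub>i\<^sub>j\<close>.\<close>

definition levi_civita ::
  "('e::euclidean_space \<Rightarrow> 'e \<Rightarrow> 'e \<Rightarrow> real) \<Rightarrow> 'e \<Rightarrow> 'e \<Rightarrow> 'e \<Rightarrow> 'e" where
  "levi_civita G x X Y = raise (G x) (koszul G x X Y)"

text \<open>The curvature of an arbitrary connection: the limit of the space-time connections as
  \<open>N \<rightarrow> \<infinity>\<close> need not be the Levi-Civita connection of a metric.\<close>

definition connection_curvature ::
  "('e::euclidean_space \<Rightarrow> 'e \<Rightarrow> 'e \<Rightarrow> 'e) \<Rightarrow> 'e \<Rightarrow> 'e \<Rightarrow> 'e \<Rightarrow> 'e \<Rightarrow> 'e" where
  "connection_curvature \<Gamma> x X Y Z =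
     dderiv X (\<lambda>y. \<Gamma> y Y Z) x - dderiv Y (\<lambda>y. \<Gamma> y X Z) x
     + \<Gamma> x X (\<Gamma> x Y Z) - \<Gamma> x Y (\<Gamma> x X Z)"

definition ricci_form ::
  "('e::euclidean_space \<Rightarrow> 'e \<Rightarrow> 'e \<Rightarrow> real) \<Rightarrow> 'e \<Rightarrow> 'e \<Rightarrow> 'e \<Rightarrow> real" where
  "ricci_form G x Y Z = (\<Sum>k\<in>Basis. connection_curvature (levi_civita G) x k Y Z \<bullet> k)"

definition scalar_curv :: "('e::euclidean_space \<Rightarrow> 'e \<Rightarrow> 'e \<Rightarrow> real) \<Rightarrow> 'e \<Rightarrow> real" where
  "scalar_curv G x = metric_trace (G x) (ricci_form G x)"

definition cov_deriv ::
  "('e::euclidean_space \<Rightarrow> 'e \<Rightarrow> 'e \<Rightarrow> real) \<Rightarrow> ('e \<Rightarrow> 'e \<Rightarrow> 'e \<Rightarrow> real) \<Rightarrow> 'e \<Rightarrow> 'e \<Rightarrow> 'e \<Rightarrow> 'e \<Rightarrow> real"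
  where
  "cov_deriv G T x W X Y =
     dderiv W (\<lambda>y. T y X Y) x - T x (levi_civita G x W X) Y - T x X (levi_civita G x W Y)"

lemma levi_civita_cong_open:
  assumes "open S" "x \<in> S" "\<And>y. y \<in> S \<Longrightarrow> G y = G' y"
  shows "levi_civita G x = levi_civita G' x"
proof -
  have "dderiv X (\<lambda>y. G y u v) x = dderiv X (\<lambda>y. G' y u v) x" for X u v
    by (rule dderiv_cong_open[OF assms(1,2)]) (simp add: assms(3))
  then have "koszul G x = koszul G' x" by (simp add: koszul_def fun_eq_iff)
  then show ?thesis by (intro ext) (simp add: levi_civita_def assms(2,3))
qed

lemma connection_curvature_cong_open:
  assumes "open S" "x \<in> S" "\<And>y. y \<in> S \<Longrightarrow> \<Gamma> y = \<Gamma>' y"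
  shows "connection_curvature \<Gamma> x = connection_curvature \<Gamma>' x"
proof -
  have "dderiv X (\<lambda>y. \<Gamma> y u v) x = dderiv X (\<lambda>y. \<Gamma>' y u v) x" for X u v
    by (rule dderiv_cong_open[OF assms(1,2)]) (simp add: assms(3))
  then show ?thesis by (simp add: connection_curvature_def fun_eq_iff assms(2,3))
qed

lemma ricci_form_cong_open:
  assumes "open S" "x \<in> S" "\<And>y. y \<in> S \<Longrightarrow> G y = G' y"
  shows "ricci_form G x = ricci_form G' x"
proof -
  have "connection_curvature (levi_civita G) x = connection_curvature (levi_civita G') x"
    by (rule connection_curvature_cong_open[OF assms(1,2)])
      (rule levi_civita_cong_open[OF assms(1) _ assms(3)])
  then show ?thesis by (simp add: ricci_form_def fun_eq_iff)
qed

lemma scalar_curv_cong_open: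
  assumes "open S" "x \<in> S" "\<And>y. y \<in> S \<Longrightarrow> G y = G' y"
  shows "scalar_curv G x = scalar_curv G' x"
  unfolding scalar_curv_def using ricci_form_cong_open[OF assms] assms(2,3) by simp

lemma linear_field_add:
  assumes "linear_field S A" "linear_field S B"
  shows "linear_field S (\<lambda>x u. A x u + B x u)"
  using assms unfolding linear_field_def by (simp add: smooth_on_add linear_compose_add)

lemma linear_field_diff:
  assumes "linear_field S A" "linear_field S B"
  shows "linear_field S (\<lambda>x u. A x u - B x u)"
  using assms unfolding linear_field_def by (simp add: smooth_on_diff linear_compose_sub)

lemma linear_field_bounded_linear:
  assumes "bounded_linear L" "linear_field S A"
  shows "linear_field S (\<lambda>x u. L (A x u))"
  unfolding linear_field_def
proof (intro conjI ballI allI)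
  show "linear (\<lambda>u. L (A x u))" if "x \<in> S" for x
    using linear_compose[OF _ bounded_linear.linear[OF assms(1)], of "A x"] assms(2) that
    by (simp add: o_def linear_field_def)
qed (use assms in \<open>auto simp: linear_field_def intro: smooth_on_linear_comp\<close>)

lemma linear_field_scaleR:
  assumes "linear_field S A" "smooth_on h S"
  shows "linear_field S (\<lambda>x u. A x u *\<^sub>R h x)"
  using assms unfolding linear_field_def
  by (auto simp: smooth_on_scaleR linear_iff scaleR_left_distrib)

lemma linear_field_sum:
  assumes "open S" "\<And>i. i \<in> I \<Longrightarrow> linear_field S (A i)"
  shows "linear_field S (\<lambda>x u. \<Sum>i\<in>I. A i x u)"
  using assms unfolding linear_field_def
  by (simp add: smooth_on_sum linear_compose_sum)

lemma linear_field_compose: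
  assumes "linear_field S A" "linear_field S A'"
  shows "linear_field S (\<lambda>x u. A x (A' x u))"
  using assms linear_field_apply(1)[OF assms(1)] linear_compose[unfolded o_def]
  unfolding linear_field_def by metis

lemma bilinear_field_fix_right:
  assumes "bilinear_field S B" "smooth_on V S"
  shows "linear_field S (\<lambda>x u. B x u (V x))"
  unfolding linear_field_def
  using assms bilinear_field_apply(1)[OF assms(1) smooth_on_const assms(2)] bilinearD(2)
  by (auto simp: bilinear_field_def)

locale connection_chart =
  fixes S :: "'e::euclidean_space set" and \<Gamma> :: "'e \<Rightarrow> 'e \<Rightarrow> 'e \<Rightarrow> 'e"
  assumes connection: "bilinear_field S \<Gamma>"
begin

lemma open_chart: "open S"
  using connection by (simp add: bilinear_field_def)

lemma smooth_connection: "smooth_on (\<lambda>x. \<Gamma> x X Y) S"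
  using connection by (simp add: bilinear_field_def)

lemma curvature_linear1: "linear_field S (\<lambda>x X. connection_curvature \<Gamma> x X Y Z)"
  unfolding connection_curvature_def
  by (intro linear_field_diff[OF linear_field_add[OF linear_field_diff]]
      linear_field_direction[OF open_chart smooth_connection]
      linear_field_dderiv[OF bilinear_field_slots(2)[OF connection]]
      bilinear_field_fix_right[OF connection smooth_connection]
      linear_field_compose[OF bilinear_field_slots(1)[OF connection] bilinear_field_slots(2)[OF connection]])

lemma curvature_linear2: "linear_field S (\<lambda>x Y. connection_curvature \<Gamma> x X Y Z)"
  unfolding connection_curvature_def
  by (intro linear_field_diff[OF linear_field_add[OF linear_field_diff]]
      linear_field_direction[OF open_chart smooth_connection]
      linear_field_dderiv[OF bilinear_field_slots(2)[OF connection]]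
      bilinear_field_fix_right[OF connection smooth_connection]
      linear_field_compose[OF bilinear_field_slots(1)[OF connection] bilinear_field_slots(2)[OF connection]])

lemma curvature_linear3: "linear_field S (\<lambda>x Z. connection_curvature \<Gamma> x X Y Z)"
  unfolding connection_curvature_def
  by (intro linear_field_diff[OF linear_field_add[OF linear_field_diff]]
      linear_field_dderiv[OF bilinear_field_slots(1)[OF connection]]
      linear_field_compose[OF bilinear_field_slots(1)[OF connection] bilinear_field_slots(1)[OF connection]])

lemma curvature_smooth: "smooth_on (\<lambda>x. connection_curvature \<Gamma> x X Y Z) S"
  using curvature_linear1 by (simp add: linear_field_def)

lemma connection_ricci_field:
  "bilinear_field S (\<lambda>x Y Z. \<Sum>k\<in>Basis. connection_curvature \<Gamma> x k Y Z \<bullet> k)"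
  by (rule bilinear_fieldI)
    (rule linear_field_sum[OF open_chart linear_field_bounded_linear[OF bounded_linear_inner_left curvature_linear3]],
      rule linear_field_sum[OF open_chart linear_field_bounded_linear[OF bounded_linear_inner_left curvature_linear2]])

end

locale metric_chart = metric_field S G
  for S :: "'e::euclidean_space set" and G :: "'e \<Rightarrow> 'e \<Rightarrow> 'e \<Rightarrow> real"
begin

abbreviation "\<Gamma> \<equiv> levi_civita G"

lemma koszul_field:
  "linear_field S (\<lambda>x X. koszul G x X Y Z)" "linear_field S (\<lambda>x Y. koszul G x X Y Z)"
  "linear_field S (\<lambda>x Z. koszul G x X Y Z)"
  unfolding koszul_def
  by (intro linear_field_bounded_linear[OF bounded_linear_divide]
      linear_field_diff[OF linear_field_add] linear_field_direction[OF openS Gsmooth]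
      linear_field_dderiv[OF bilinear_field_slots(1)[OF field]]
      linear_field_dderiv[OF bilinear_field_slots(2)[OF field]])+

lemma levi_civita_field: "bilinear_field S \<Gamma>"
  unfolding levi_civita_def raise_def
  by (rule bilinear_fieldI)
    (rule linear_field_sum[OF openS linear_field_scaleR[OF koszul_field(2) smooth_dual]],
      rule linear_field_sum[OF openS linear_field_scaleR[OF koszul_field(1) smooth_dual]])

sublocale connection_chart S \<Gamma>
  by unfold_locales (rule levi_civita_field)

lemma lc_bil: "x \<in> S \<Longrightarrow> bilinear (\<Gamma> x)"
  using levi_civita_field by (simp add: bilinear_field_def)

lemma levi_civita_koszul: "x \<in> S \<Longrightarrow> G x (\<Gamma> x X Y) Z = koszul G x X Y Z"
  unfolding levi_civita_def
  by (rule inner_form.raise[OF inner_form]) (use koszul_field(3) in \<open>auto simp: linear_field_def\<close>)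

lemma levi_civita_unique:
  "x \<in> S \<Longrightarrow> (\<And>Z. G x V Z = koszul G x X Y Z) \<Longrightarrow> \<Gamma> x X Y = V"
  by (rule inner_form.nondegenerate[OF inner_form]) (auto simp: levi_civita_koszul)

lemma dderiv_G_sym:
  assumes "x \<in> S" shows "dderiv X (\<lambda>y. G y u v) x = dderiv X (\<lambda>y. G y v u) x"
  by (rule dderiv_cong_open[OF openS assms]) (rule Gsym)

lemma levi_civita_sym: "x \<in> S \<Longrightarrow> \<Gamma> x X Y = \<Gamma> x Y X"
  by (rule levi_civita_unique) (auto simp: levi_civita_koszul koszul_def dderiv_G_sym[of x _ X Y])

lemma metric_compatible:
  "x \<in> S \<Longrightarrow> dderiv X (\<lambda>y. G y Y Z) x = G x (\<Gamma> x X Y) Z + G x Y (\<Gamma> x X Z)"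
  by (simp add: Gsym[of x Y "\<Gamma> x X Z"] levi_civita_koszul koszul_def dderiv_G_sym[of x _ Z Y]
      dderiv_G_sym[of x _ X Z] dderiv_G_sym[of x _ X Y] add_divide_distrib diff_divide_distrib)

lemma ricci_field: "bilinear_field S (ricci_form G)"
  using connection_ricci_field unfolding ricci_form_def .

lemma ricci_bil: "x \<in> S \<Longrightarrow> bilinear (ricci_form G x)"
  using ricci_field by (simp add: bilinear_field_def)

lemma ricci_smooth: "smooth_on (\<lambda>x. ricci_form G x Y Z) S"
  using ricci_field by (simp add: bilinear_field_def)

lemma scalar_curv_smooth: "smooth_on (scalar_curv G) S"
  using smooth_metric_trace[OF ricci_field] by (simp add: scalar_curv_def[abs_def])

end


section \<open>Naturality under changes of coordinates\<close>

definition pullback :: "('b::real_normed_vector \<Rightarrow> 'e::euclidean_space) \<Rightarrow>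
    ('e \<Rightarrow> 'e \<Rightarrow> 'e \<Rightarrow> 'c) \<Rightarrow> 'b \<Rightarrow> 'b \<Rightarrow> 'b \<Rightarrow> 'c" where
  "pullback \<phi> T y u v = T (\<phi> y) (dderiv u \<phi> y) (dderiv v \<phi> y)"

lemma dderiv_pullback:
  fixes \<phi> :: "'b::real_normed_vector \<Rightarrow> 'e::euclidean_space"
    and T :: "'e \<Rightarrow> 'e \<Rightarrow> 'e \<Rightarrow> 'c::real_normed_vector"
  assumes T: "bilinear_field S T" and S': "open S'" and \<phi>: "smooth_on \<phi> S'" "\<phi> ` S' \<subseteq> S"
  shows "smooth_on (\<lambda>y. pullback \<phi> T y u v) S'"
    and "y \<in> S' \<Longrightarrow> dderiv W (\<lambda>z. pullback \<phi> T z X Y) y =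
      dderiv (dderiv W \<phi> y) (\<lambda>x. T x (dderiv X \<phi> y) (dderiv Y \<phi> y)) (\<phi> y)
      + T (\<phi> y) (dderiv W (dderiv X \<phi>) y) (dderiv Y \<phi> y)
      + T (\<phi> y) (dderiv X \<phi> y) (dderiv W (dderiv Y \<phi>) y)"
proof -
  have sm: "smooth_on (\<lambda>x. T x u v) S" for u v
    using T by (simp add: bilinear_field_def)
  have comp: "bilinear_field S' (\<lambda>y. T (\<phi> y))"
    unfolding bilinear_field_def
  proof (intro conjI ballI allI)
    show "bilinear (T (\<phi> y))" if "y \<in> S'" for y
      using T \<phi>(2) that by (auto simp: bilinear_field_def)
    show "smooth_on (\<lambda>y. T (\<phi> y) u v) S'" for u v
      by (rule smooth_on_compose[OF S' \<phi>(1) sm]) (use \<phi>(2) in auto)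
  qed (rule S')
  note D = smooth_on_dderiv[OF \<phi>(1)]
  show "smooth_on (\<lambda>y. pullback \<phi> T y u v) S'"
    unfolding pullback_def by (rule bilinear_field_apply(1)[OF comp D D])
  assume y: "y \<in> S'"
  have "dderiv W (\<lambda>z. T (\<phi> z) u v) y = dderiv (dderiv W \<phi> y) (\<lambda>x. T x u v) (\<phi> y)" for u v
    by (rule dderiv_compose[OF smooth_on_differentiable[OF \<phi>(1) y]
          smooth_on_differentiable[OF sm]]) (use y \<phi>(2) in auto)
  then show "dderiv W (\<lambda>z. pullback \<phi> T z X Y) y =
      dderiv (dderiv W \<phi> y) (\<lambda>x. T x (dderiv X \<phi> y) (dderiv Y \<phi> y)) (\<phi> y)
      + T (\<phi> y) (dderiv W (dderiv X \<phi>) y) (dderiv Y \<phi> y)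
      + T (\<phi> y) (dderiv X \<phi> y) (dderiv W (dderiv Y \<phi>) y)"
    unfolding pullback_def by (subst bilinear_field_apply(2)[OF comp D D y]) simp
qed

locale coordinate_change = metric_chart S G
  for S :: "'e::euclidean_space set" and G +
  fixes S' :: "'e set" and \<phi> :: "'e \<Rightarrow> 'e"
  assumes openS': "open S'" and \<phi>_smooth: "smooth_on \<phi> S'" and \<phi>_into: "\<phi> ` S' \<subseteq> S"
    and \<phi>_immersion: "y \<in> S' \<Longrightarrow> dderiv u \<phi> y = 0 \<Longrightarrow> u = 0"
begin

abbreviation "D \<equiv> \<lambda>y u. dderiv u \<phi> y"
abbreviation "H \<equiv> \<lambda>y u v. dderiv u (dderiv v \<phi>) y"

lemma \<phi>_mem: "y \<in> S' \<Longrightarrow> \<phi> y \<in> S"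
  using \<phi>_into by auto

lemma D_linear: "y \<in> S' \<Longrightarrow> linear (D y)"
  by (rule linear_dderiv[OF smooth_on_differentiable[OF \<phi>_smooth]])

lemma D_inverse:
  assumes "y \<in> S'"
  obtains A where "linear A" "\<And>u. A (D y u) = u" "\<And>u. D y (A u) = u"
proof -
  have "inj (D y)"
    unfolding linear_injective_0[OF D_linear[OF assms]] using \<phi>_immersion[OF assms] by blast
  then show ?thesis using linear_injective_isomorphism[OF D_linear[OF assms]] that by blast
qed

lemma H_sym: "y \<in> S' \<Longrightarrow> H y u v = H y v u"
  by (rule dderiv_commute[OF openS' \<phi>_smooth])

lemma pullback_field:
  assumes "bilinear_field S T" shows "bilinear_field S' (pullback \<phi> T)"
proof -
  have "bilinear (pullback \<phi> T y)" if "y \<in> S'" for y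
  proof -
    have "bilinear (T (\<phi> y))" using assms \<phi>_mem[OF that] by (simp add: bilinear_field_def)
    then show ?thesis
      using linear_compose[OF D_linear[OF that], unfolded o_def]
      unfolding bilinear_def pullback_def by blast
  qed
  then show ?thesis
    using dderiv_pullback(1)[OF assms openS' \<phi>_smooth \<phi>_into] openS'
    by (simp add: bilinear_field_def)
qed

sublocale P: metric_chart S' "pullback \<phi> G"
proof unfold_locales
  show "bilinear_field S' (pullback \<phi> G)" by (rule pullback_field[OF field])
  show "pullback \<phi> G x u v = pullback \<phi> G x v u" if "x \<in> S'" for x u v
    unfolding pullback_def by (rule Gsym[OF \<phi>_mem[OF that]])
  show "0 < pullback \<phi> G x u u" if "x \<in> S'" "u \<noteq> 0" for x u
    unfolding pullback_def using Gpos[OF \<phi>_mem[OF that(1)]] \<phi>_immersion that by blast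
qed

lemmas dderiv_pullback' = dderiv_pullback(2)[OF _ openS' \<phi>_smooth \<phi>_into]

text \<open>The second derivatives of the change of coordinates are symmetric, so that in the Koszul
  formula of the pulled back metric only the terms in \<open>D\<^sup>2\<phi>(X, Y)\<close> do not cancel.\<close>

lemma levi_civita_pullback:
  assumes y: "y \<in> S'"
  shows "D y (P.\<Gamma> y X Y) = H y X Y + \<Gamma> (\<phi> y) (D y X) (D y Y)"
proof -
  note b = Gbil[OF \<phi>_mem[OF y]]
  obtain A where A: "\<And>u. D y (A u) = u" using D_inverse[OF y] by blast
  have "G (\<phi> y) (D y (P.\<Gamma> y X Y)) z = G (\<phi> y) (H y X Y + \<Gamma> (\<phi> y) (D y X) (D y Y)) z" for z
  proof -
    define Z where "Z = A z"
    have z: "z = D y Z" by (simp add: Z_def A)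
    have "G (\<phi> y) (D y (P.\<Gamma> y X Y)) z = koszul (pullback \<phi> G) y X Y Z"
      using P.levi_civita_koszul[OF y] by (simp add: pullback_def z)
    also have "\<dots> = koszul G (\<phi> y) (D y X) (D y Y) (D y Z) + G (\<phi> y) (H y X Y) (D y Z)"
      unfolding koszul_def dderiv_pullback'[OF field y]
      by (simp add: H_sym[OF y, of Y X] H_sym[OF y, of Z] Gsym[OF \<phi>_mem[OF y], of "H y X Z"]
          Gsym[OF \<phi>_mem[OF y], of _ "H y Y Z"] field_simps)
    also have "\<dots> = G (\<phi> y) (H y X Y + \<Gamma> (\<phi> y) (D y X) (D y Y)) z"
      by (simp add: bilinear_ladd[OF b] levi_civita_koszul[OF \<phi>_mem[OF y]] z)
    finally show ?thesis .
  qed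
  then show ?thesis by (rule inner_form.nondegenerate[OF inner_form[OF \<phi>_mem[OF y]]])
qed

lemma dderiv_levi_civita_pullback:
  assumes y: "y \<in> S'"
  shows "D y (dderiv W (\<lambda>z. P.\<Gamma> z X Y) y) =
    dderiv W (dderiv X (dderiv Y \<phi>)) y + dderiv (D y W) (\<lambda>x. \<Gamma> x (D y X) (D y Y)) (\<phi> y)
    + \<Gamma> (\<phi> y) (H y W X) (D y Y) + \<Gamma> (\<phi> y) (D y X) (H y W Y) - H y W (P.\<Gamma> y X Y)"
proof -
  have "dderiv W (\<lambda>z. D z (P.\<Gamma> z X Y)) y = H y W (P.\<Gamma> y X Y) + D y (dderiv W (\<lambda>z. P.\<Gamma> z X Y) y)"
    by (rule linear_field_apply(2)[OF linear_field_direction[OF openS' \<phi>_smooth] P.smooth_connection y])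
  moreover have "dderiv W (\<lambda>z. D z (P.\<Gamma> z X Y)) y = dderiv W (\<lambda>z. H z X Y + pullback \<phi> \<Gamma> z X Y) y"
    by (rule dderiv_cong_open[OF openS' y]) (simp add: levi_civita_pullback pullback_def)
  moreover have "dderiv W (\<lambda>z. H z X Y + pullback \<phi> \<Gamma> z X Y) y
      = dderiv W (\<lambda>z. H z X Y) y + dderiv W (\<lambda>z. pullback \<phi> \<Gamma> z X Y) y"
    by (rule dderiv_add)
      (rule smooth_on_differentiable[OF _ y],
        intro smooth_on_dderiv \<phi>_smooth dderiv_pullback(1)[OF connection openS' \<phi>_smooth \<phi>_into])+
  ultimately show ?thesis
    unfolding dderiv_pullback'[OF connection y] by (simp add: algebra_simps)
qed

text \<open>Differentiating the transformation law of the Christoffel symbols once more, the third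
  derivatives of the change of coordinates are symmetric and drop out of the curvature.\<close>

lemma curvature_pullback:
  assumes y: "y \<in> S'"
  shows "D y (connection_curvature P.\<Gamma> y W X Y)
    = connection_curvature \<Gamma> (\<phi> y) (D y W) (D y X) (D y Y)"
proof -
  have third: "dderiv W (dderiv X (dderiv Y \<phi>)) y = dderiv X (dderiv W (dderiv Y \<phi>)) y"
    by (rule dderiv_commute[OF openS' smooth_on_dderiv[OF \<phi>_smooth] y])
  note lin = linear_add[OF D_linear[OF y]] linear_diff[OF D_linear[OF y]]
  show ?thesis
    unfolding connection_curvature_def lin dderiv_levi_civita_pullback[OF y]
      levi_civita_pullback[OF y] bilinear_radd[OF lc_bil[OF \<phi>_mem[OF y]]]
    by (simp add: third H_sym[OF y, of X W] algebra_simps)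
qed

text \<open>The curvature endomorphisms of the two metrics are conjugate under the differential of
  \<open>\<phi>\<close>, hence have the same trace.\<close>

lemma ricci_pullback:
  assumes y: "y \<in> S'"
  shows "ricci_form (pullback \<phi> G) y = pullback \<phi> (ricci_form G) y"
proof (intro ext)
  fix Y Z
  obtain A where A: "linear A" "\<And>u. A (D y u) = u" "\<And>u. D y (A u) = u"
    using D_inverse[OF y] by blast
  define f where "f u = connection_curvature \<Gamma> (\<phi> y) u (D y Y) (D y Z)" for u
  have "linear f"
    unfolding f_def using curvature_linear1 \<phi>_mem[OF y] by (simp add: linear_field_def)
  from linear_compose[OF D_linear[OF y] this] have lin: "linear (\<lambda>u. f (D y u))"
    by (simp add: o_def)
  have "ricci_form (pullback \<phi> G) y Y Z = (\<Sum>k\<in>Basis. A (f (D y k)) \<bullet> k)"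
    unfolding ricci_form_def f_def by (simp add: curvature_pullback[OF y, symmetric] A)
  also have "\<dots> = (\<Sum>k\<in>Basis. f (D y (A k)) \<bullet> k)" by (rule trace_commute[OF A(1) lin])
  finally show "ricci_form (pullback \<phi> G) y Y Z = pullback \<phi> (ricci_form G) y Y Z"
    by (simp add: A ricci_form_def f_def pullback_def)
qed

lemma scalar_curv_pullback:
  assumes y: "y \<in> S'"
  shows "scalar_curv (pullback \<phi> G) y = scalar_curv G (\<phi> y)"
  unfolding scalar_curv_def ricci_pullback[OF y] pullback_def[of \<phi> "ricci_form G", abs_def]
  by (rule metric_trace_pullback[OF inner_form[OF \<phi>_mem[OF y]] P.inner_form[OF y] D_linear[OF y]
        _ ricci_bil[OF \<phi>_mem[OF y]]]) (simp add: pullback_def)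

lemma cov_deriv_pullback:
  assumes "bilinear_field S T" and y: "y \<in> S'"
  shows "cov_deriv (pullback \<phi> G) (pullback \<phi> T) y W X Y
    = cov_deriv G T (\<phi> y) (D y W) (D y X) (D y Y)"
proof -
  have "bilinear (T (\<phi> y))" using assms \<phi>_mem by (simp add: bilinear_field_def)
  then show ?thesis
    unfolding cov_deriv_def dderiv_pullback'[OF assms]
    by (simp add: pullback_def levi_civita_pullback[OF y] bilinear_ladd bilinear_radd)
qed

end

section \<open>The contracted second Bianchi identity\<close>

lemma dderiv_half_combination:
  fixes f g h :: "'a::real_normed_vector \<Rightarrow> real"
  assumes "f differentiable at x" "g differentiable at x" "h differentiable at x"
  shows "dderiv W (\<lambda>z. (f z + g z - h z) / 2) x = (dderiv W f x + dderiv W g x - dderiv W h x) / 2"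
proof -
  have "dderiv W (\<lambda>z. (f z + g z - h z) / 2) x = dderiv W (\<lambda>z. f z + g z - h z) x / 2"
    using assms by (intro dderiv_linear_comp bounded_linear_divide) auto
  then show ?thesis using assms by (simp add: dderiv_add dderiv_diff)
qed

context metric_chart
begin

definition "third W X Y u v x = dderiv W (dderiv X (dderiv Y (\<lambda>y. G y u v))) x"

lemma third_sym:
  assumes x: "x \<in> S"
  shows "third W X Y u v x = third X W Y u v x" "third W X Y u v x = third W Y X u v x"
    "third W X Y u v x = third W X Y v u x"
proof -
  show "third W X Y u v x = third X W Y u v x"
    unfolding third_def by (rule dderiv_commute[OF openS smooth_on_dderiv[OF Gsmooth] x])
  show "third W X Y u v x = third W Y X u v x"
    unfolding third_def
    by (rule dderiv_cong_open[OF openS x]) (rule dderiv_commute[OF openS Gsmooth])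
  have 1: "dderiv Y (\<lambda>y. G y u v) y = dderiv Y (\<lambda>y. G y v u) y" if "y \<in> S" for y
    by (rule dderiv_G_sym[OF that])
  have 2: "dderiv X (dderiv Y (\<lambda>y. G y u v)) y = dderiv X (dderiv Y (\<lambda>y. G y v u)) y" if "y \<in> S" for y
    by (rule dderiv_cong_open[OF openS that 1])
  show "third W X Y u v x = third W X Y v u x"
    unfolding third_def by (rule dderiv_cong_open[OF openS x 2])
qed

lemma third_bilinear_values:
  assumes "x \<in> S" shows "bilinear (\<lambda>u v. third W X Y u v x)"
  using bilinear_field_dderiv[OF bilinear_field_dderiv[OF bilinear_field_dderiv[OF field]]] assms
  by (simp add: bilinear_field_def third_def)

lemma third_linear_direction:
  assumes "x \<in> S" shows "linear (\<lambda>Y. third W X Y u v x)"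
  using linear_field_dderiv[OF linear_field_dderiv[OF linear_field_direction[OF openS Gsmooth]]] assms
  by (simp add: linear_field_def third_def)

lemma third_bilinear_mixed:
  assumes x: "x \<in> S"
  shows "bilinear (\<lambda>a b. third W X a b v x)"
  using third_linear_direction[OF x] bilinearD(2)[OF third_bilinear_values[OF x]]
  unfolding bilinear_def by blast

text \<open>Where the Christoffel symbols vanish, so do the first derivatives of the metric. Differentiating
  \<open>G(\<Gamma>(X, Y), Z)\<close> twice therefore only differentiates \<open>\<Gamma>\<close>, and the derivative of the curvature
  becomes linear in the third derivatives of the metric.\<close>

lemma dderiv_curvature_normal:
  assumes x: "x \<in> S" and normal: "\<And>X Y. \<Gamma> x X Y = 0"
  shows "G x (dderiv W (\<lambda>y. connection_curvature \<Gamma> y X Y Z) x) V =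
    (third W X Z Y V x - third W X V Y Z x - third W Y Z X V x + third W Y V X Z x) / 2"
proof -
  have dG0: "dderiv X (\<lambda>y. G y u v) x = 0" for X u v
    by (simp add: metric_compatible[OF x] normal bilinear_simps[OF Gbil[OF x]])
  have d\<Gamma>: "dderiv X (\<lambda>y. \<Gamma> y Y 0) x = 0" for X Y
  proof -
    have "dderiv X (\<lambda>y. \<Gamma> y Y 0) x = dderiv X (\<lambda>y. 0) x"
      by (rule dderiv_cong_open[OF openS x]) (rule bilinear_rzero[OF lc_bil])
    then show ?thesis by simp
  qed
  have second: "G x (dderiv W (dderiv X (\<lambda>z. \<Gamma> z Y Z)) x) V =
      (third W X Y Z V x + third W X Z Y V x - third W X V Y Z x) / 2" for X Y Z V
  proof -
    have "dderiv X (\<lambda>z. koszul G z Y Z V) y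
        = dderiv X (\<lambda>z. G z (\<Gamma> y Y Z) V) y + G y (dderiv X (\<lambda>z. \<Gamma> z Y Z) y) V" if "y \<in> S" for y
    proof -
      have "dderiv X (\<lambda>z. koszul G z Y Z V) y = dderiv X (\<lambda>z. G z (\<Gamma> z Y Z) V) y"
        by (rule dderiv_cong_open[OF openS that]) (simp add: levi_civita_koszul)
      then show ?thesis
        using linear_field_apply(2)[OF bilinear_field_slots(2)[OF field] smooth_connection that] by simp
    qed
    then have "dderiv W (dderiv X (\<lambda>z. koszul G z Y Z V)) x = dderiv W (\<lambda>y.
        dderiv X (\<lambda>z. G z (\<Gamma> y Y Z) V) y + G y (dderiv X (\<lambda>z. \<Gamma> z Y Z) y) V) x"
      by (rule dderiv_cong_open[OF openS x])
    also have "\<dots> = dderiv W (\<lambda>y. dderiv X (\<lambda>z. G z (\<Gamma> y Y Z) V) y) x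
        + dderiv W (\<lambda>y. G y (dderiv X (\<lambda>z. \<Gamma> z Y Z) y) V) x"
      by (intro dderiv_add smooth_on_differentiable[OF _ x]
          linear_field_apply(1)[OF linear_field_dderiv[OF bilinear_field_slots(2)[OF field]] smooth_connection]
          linear_field_apply(1)[OF bilinear_field_slots(2)[OF field] smooth_on_dderiv[OF smooth_connection]])
    also have "dderiv W (\<lambda>y. dderiv X (\<lambda>z. G z (\<Gamma> y Y Z) V) y) x = 0"
    proof -
      have lin: "linear (\<lambda>u. dderiv W (\<lambda>y. dderiv X (\<lambda>z. G z u V) y) x)"
        using linear_field_dderiv[OF linear_field_dderiv[OF bilinear_field_slots(2)[OF field]]] x
        by (simp add: linear_field_def)
      show ?thesis
        by (subst linear_field_apply(2)[OF linear_field_dderiv[OF bilinear_field_slots(2)[OF field]]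
              smooth_connection x]) (simp add: dG0 normal linear_0[OF lin])
    qed
    also have "dderiv W (\<lambda>y. G y (dderiv X (\<lambda>z. \<Gamma> z Y Z) y) V) x
        = G x (dderiv W (dderiv X (\<lambda>z. \<Gamma> z Y Z)) x) V"
      by (subst linear_field_apply(2)[OF bilinear_field_slots(2)[OF field]
            smooth_on_dderiv[OF smooth_connection] x]) (simp add: dG0)
    finally have "G x (dderiv W (dderiv X (\<lambda>z. \<Gamma> z Y Z)) x) V = dderiv W (dderiv X (\<lambda>z. koszul G z Y Z V)) x"
      by simp
    also have "\<dots> = dderiv W (\<lambda>y. (dderiv X (dderiv Y (\<lambda>z. G z Z V)) y
        + dderiv X (dderiv Z (\<lambda>z. G z Y V)) y - dderiv X (dderiv V (\<lambda>z. G z Y Z)) y) / 2) x"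
      unfolding koszul_def
      by (rule dderiv_cong_open[OF openS x], rule dderiv_half_combination)
        (rule smooth_on_differentiable[OF smooth_on_dderiv[OF Gsmooth]], assumption)+
    also have "\<dots> = (third W X Y Z V x + third W X Z Y V x - third W X V Y Z x) / 2"
      unfolding third_def
      by (intro dderiv_half_combination smooth_on_differentiable[OF _ x] smooth_on_dderiv Gsmooth)
    finally show ?thesis .
  qed
  have quad: "dderiv W (\<lambda>y. \<Gamma> y X (\<Gamma> y Y Z)) x = 0" for X Y
    by (subst linear_field_apply(2)[OF bilinear_field_slots(1)[OF connection] smooth_connection x])
      (simp add: normal d\<Gamma>)
  have d1: "dderiv X (\<lambda>y. \<Gamma> y Y Z) differentiable at x" for X Y Z
    by (rule smooth_on_differentiable[OF smooth_on_dderiv[OF smooth_connection] x])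
  have d2: "(\<lambda>y. \<Gamma> y X (\<Gamma> y Y Z)) differentiable at x" for X Y Z
    by (rule smooth_on_differentiable[OF
          linear_field_apply(1)[OF bilinear_field_slots(1)[OF connection] smooth_connection] x])
  have "dderiv W (\<lambda>y. connection_curvature \<Gamma> y X Y Z) x
      = dderiv W (dderiv X (\<lambda>z. \<Gamma> z Y Z)) x - dderiv W (dderiv Y (\<lambda>z. \<Gamma> z X Z)) x"
    unfolding connection_curvature_def using d1 d2 by (simp add: dderiv_add dderiv_diff quad)
  then show ?thesis
    using third_sym(2)[OF x, where X = X and Y = Y]
    by (simp add: bilinear_lsub[OF Gbil[OF x]] second diff_divide_distrib[symmetric])
qed

lemma dderiv_ricci_normal:
  assumes x: "x \<in> S" and normal: "\<And>X Y. \<Gamma> x X Y = 0"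
  shows "dderiv W (\<lambda>y. ricci_form G y Y Z) x = (\<Sum>i\<in>Basis.
    (third W i Z Y (dual_vec (G x) i) x - third W i (dual_vec (G x) i) Y Z x
     - third W Y Z i (dual_vec (G x) i) x + third W Y (dual_vec (G x) i) i Z x) / 2)"
proof -
  have d: "(\<lambda>y. connection_curvature \<Gamma> y k Y Z) differentiable at x" for k
    by (rule smooth_on_differentiable[OF curvature_smooth x])
  have "dderiv W (\<lambda>y. ricci_form G y Y Z) x
      = (\<Sum>k\<in>Basis. dderiv W (\<lambda>y. connection_curvature \<Gamma> y k Y Z) x \<bullet> k)"
    unfolding ricci_form_def
    using d by (subst dderiv_sum)
      (simp_all add: dderiv_linear_comp[OF bounded_linear_inner_left]
        differentiable_linear_comp[OF bounded_linear_inner_left])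
  also have "\<dots> = (\<Sum>k\<in>Basis. G x (dderiv W (\<lambda>y. connection_curvature \<Gamma> y k Y Z) x) (dual_vec (G x) k))"
    by (rule inner_form.trace_eq_metric_trace[OF inner_form[OF x]])
  finally show ?thesis by (simp add: dderiv_curvature_normal[OF x normal])
qed

text \<open>Both sides are full contractions of the third derivatives of the metric, and there are only two
  such contractions: \<open>A = G\<^sup>k\<^sup>l G\<^sup>i\<^sup>j \<partial>\<^sub>Z \<partial>\<^sub>l \<partial>\<^sub>i G\<^sub>k\<^sub>j\<close> and \<open>C = G\<^sup>k\<^sup>l G\<^sup>i\<^sup>j \<partial>\<^sub>Z \<partial>\<^sub>l \<partial>\<^sub>k G\<^sub>i\<^sub>j\<close>. Each side is
  \<open>A - C\<close>.\<close>

lemma contracted_bianchi_normal: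
  assumes x: "x \<in> S" and normal: "\<And>X Y. \<Gamma> x X Y = 0"
  shows "2 * metric_trace (G x) (\<lambda>u v. cov_deriv G (ricci_form G) x u v Z) = dderiv Z (scalar_curv G) x"
proof -
  interpret i: inner_form "G x" by (rule inner_form[OF x])
  define e where "e k = dual_vec (G x) k" for k
  define t where "t W X Y u v = third W X Y u v x" for W X Y u v
  have t1: "t W X Y u v = t X W Y u v" and t2: "t W X Y u v = t W Y X u v"
    and t3: "t W X Y u v = t W X Y v u" for W X Y u v
    unfolding t_def by (rule third_sym[OF x])+
  have dric: "dderiv W (\<lambda>y. ricci_form G y Y Z) x = (\<Sum>i\<in>Basis.
      (t W i Z Y (e i) - t W i (e i) Y Z - t W Y Z i (e i) + t W Y (e i) i Z) / 2)" for W Y Z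
    unfolding t_def e_def by (rule dderiv_ricci_normal[OF x normal])
  define A where "A = (\<Sum>k\<in>Basis. \<Sum>i\<in>Basis. t Z (e k) i k (e i))"
  define C where "C = (\<Sum>k\<in>Basis. \<Sum>i\<in>Basis. t Z (e k) k i (e i))"
  have "metric_trace (G x) (\<lambda>u v. cov_deriv G (ricci_form G) x u v Z) =
      (\<Sum>k\<in>Basis. dderiv (e k) (\<lambda>y. ricci_form G y k Z) x)"
    unfolding metric_trace_def cov_deriv_def normal
    by (simp add: bilinear_simps[OF ricci_bil[OF x]] e_def)
  then have lhs: "2 * metric_trace (G x) (\<lambda>u v. cov_deriv G (ricci_form G) x u v Z) =
      (\<Sum>k\<in>Basis. \<Sum>i\<in>Basis. t (e k) i Z k (e i)) - (\<Sum>k\<in>Basis. \<Sum>i\<in>Basis. t (e k) i (e i) k Z)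
      - (\<Sum>k\<in>Basis. \<Sum>i\<in>Basis. t (e k) k Z i (e i)) + (\<Sum>k\<in>Basis. \<Sum>i\<in>Basis. t (e k) k (e i) i Z)"
    by (simp add: dric sum.distrib sum_subtractf sum_divide_distrib[symmetric])
  have l1: "(\<Sum>k\<in>Basis. \<Sum>i\<in>Basis. t (e k) i Z k (e i)) = A"
    unfolding A_def by (intro sum.cong refl) (metis t1 t2)
  have l2: "(\<Sum>k\<in>Basis. \<Sum>i\<in>Basis. t (e k) k (e i) i Z) = (\<Sum>k\<in>Basis. \<Sum>i\<in>Basis. t (e k) i (e i) k Z)"
    by (subst sum.swap) (intro sum.cong refl, metis t1 t2)
  have l3: "(\<Sum>k\<in>Basis. \<Sum>i\<in>Basis. t (e k) k Z i (e i)) = C"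
    unfolding C_def by (intro sum.cong refl) (metis t1 t2)
  have dual0: "dderiv Z (\<lambda>y. dual_vec (G y) k) x = 0" for k
    by (simp add: dderiv_dual[OF x] metric_compatible[OF x] normal bilinear_simps[OF i.bil])
  have "dderiv Z (scalar_curv G) x = (\<Sum>k\<in>Basis. dderiv Z (\<lambda>y. ricci_form G y (dual_vec (G y) k) k) x)"
    unfolding scalar_curv_def[abs_def] metric_trace_def
    by (intro dderiv_sum smooth_on_differentiable[OF _ x]
        bilinear_field_apply(1)[OF ricci_field smooth_dual smooth_on_const])
  also have "\<dots> = (\<Sum>k\<in>Basis. dderiv Z (\<lambda>y. ricci_form G y (e k) k) x)"
    unfolding bilinear_field_apply(2)[OF ricci_field smooth_dual smooth_on_const x] e_def
    by (simp add: dual0 bilinear_simps[OF ricci_bil[OF x]])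
  also have "\<dots> = ((\<Sum>k\<in>Basis. \<Sum>i\<in>Basis. t Z i k (e k) (e i)) - (\<Sum>k\<in>Basis. \<Sum>i\<in>Basis. t Z i (e i) (e k) k)
      - (\<Sum>k\<in>Basis. \<Sum>i\<in>Basis. t Z (e k) k i (e i)) + (\<Sum>k\<in>Basis. \<Sum>i\<in>Basis. t Z (e k) (e i) i k)) / 2"
    by (simp add: dric sum.distrib sum_subtractf sum_divide_distrib[symmetric])
  finally have rhs: "dderiv Z (scalar_curv G) x = \<dots>" .
  have bil: "bilinear (\<lambda>a b. t W X a b v)" for W X v
    unfolding t_def by (rule third_bilinear_mixed[OF x])
  have swap: "(\<Sum>k\<in>Basis. t W X k (e k) v) = (\<Sum>k\<in>Basis. t W X (e k) k v)" for W X v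
    using i.metric_trace_swap[OF bil[of W X v]] by (simp add: metric_trace_def e_def)
  have r1: "(\<Sum>k\<in>Basis. \<Sum>i\<in>Basis. t Z i k (e k) (e i)) = A"
  proof -
    have "(\<Sum>k\<in>Basis. \<Sum>i\<in>Basis. t Z i k (e k) (e i)) = (\<Sum>i\<in>Basis. \<Sum>k\<in>Basis. t Z i (e k) k (e i))"
      by (subst sum.swap) (simp add: swap)
    also have "\<dots> = A" unfolding A_def by (subst sum.swap) (intro sum.cong refl, metis t2)
    finally show ?thesis .
  qed
  have r2: "(\<Sum>k\<in>Basis. \<Sum>i\<in>Basis. t Z i (e i) (e k) k) = C"
    unfolding C_def by (subst sum.swap) (intro sum.cong refl, metis t2 t3)
  have r4: "(\<Sum>k\<in>Basis. \<Sum>i\<in>Basis. t Z (e k) (e i) i k) = A"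
    unfolding A_def swap[symmetric] by (intro sum.cong refl) (rule t3)
  show ?thesis unfolding lhs rhs l1 l2 l3 r1 r2 r4 C_def[symmetric] by simp
qed

text \<open>The identity is independent of coordinates, and the Christoffel symbols at a point
  \<open>x\<close> vanish in the coordinates \<open>x + y - \<Gamma>(y, y) / 2\<close>.\<close>

theorem contracted_bianchi:
  assumes x: "x \<in> S"
  shows "2 * metric_trace (G x) (\<lambda>u v. cov_deriv G (ricci_form G) x u v Z) = dderiv Z (scalar_curv G) x"
proof -
  define q where "q = \<Gamma> x"
  have q: "bounded_bilinear q"
    unfolding q_def using lc_bil[OF x] bilinear_conv_bounded_bilinear by blast
  interpret q: bounded_bilinear q by fact
  define \<phi> where "\<phi> y = x + y - (1/2) *\<^sub>R q y y" for y
  have d\<phi>: "(\<phi> has_derivative (\<lambda>u. u - q y u)) (at y)" for y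
  proof -
    have "q u y = q y u" for u unfolding q_def by (rule levi_civita_sym[OF x])
    then have "(\<lambda>u. 0 + u - (1/2) *\<^sub>R (q y u + q u y)) = (\<lambda>u. u - q y u)"
      by (simp add: scaleR_2[symmetric])
    moreover have "(\<phi> has_derivative (\<lambda>u. 0 + u - (1/2) *\<^sub>R (q y u + q u y))) (at y)"
      unfolding \<phi>_def
      by (intro has_derivative_diff has_derivative_add has_derivative_const has_derivative_ident
          has_derivative_scaleR_right q.FDERIV)
    ultimately show ?thesis by simp
  qed
  have D: "dderiv u \<phi> = (\<lambda>y. u - q y u)" for u
    by (rule ext) (rule dderiv_eqI[OF d\<phi>])
  have H: "dderiv u (dderiv v \<phi>) y = - q u v" for u v y
  proof (rule dderiv_eqI)
    show "(dderiv v \<phi> has_derivative (\<lambda>u. - q u v)) (at y)"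
      unfolding D using has_derivative_diff[OF has_derivative_const
          bounded_linear_imp_has_derivative[OF q.bounded_linear_left]] by simp
  qed
  have smooth: "smooth_on \<phi> UNIV"
    unfolding \<phi>_def
    by (intro smooth_on_diff smooth_on_add smooth_on_const open_UNIV
        smooth_on_bounded_linear[OF bounded_linear_ident] smooth_on_scaleR smooth_on_bilinear_comp[OF q])
  obtain K where K: "K > 0" "\<And>a b. norm (q a b) \<le> norm a * norm b * K"
    using q.pos_bounded by blast
  \<comment> \<open>for \<open>K * norm y < 1\<close> the differential \<open>u \<mapsto> u - q y u\<close> is injective\<close>
  define S' where "S' = ball 0 (1 / K) \<inter> \<phi> -` S"
  have "open (\<phi> -` S)"
    by (rule open_vimage[OF openS smooth_on_continuous[OF smooth]])
  then have openS': "open S'" by (auto simp: S'_def)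
  have 0: "0 \<in> S'" using x K by (simp add: S'_def \<phi>_def q.zero_left)
  interpret C: coordinate_change S G S' \<phi>
  proof
    show "open S'" by (rule openS')
    show "smooth_on \<phi> S'" by (rule smooth_on_subset[OF smooth subset_UNIV])
    show "\<phi> ` S' \<subseteq> S" by (auto simp: S'_def)
    fix y u assume y: "y \<in> S'" and "dderiv u \<phi> y = 0"
    then have "norm u = norm (q y u)" by (simp add: D)
    then have "norm u \<le> (norm y * K) * norm u" using K(2)[of y u] by (simp add: mult_ac)
    moreover have "norm y * K < 1" using y K(1) by (simp add: S'_def field_simps)
    ultimately show "u = 0"
      by (metis mult_less_cancel_right2 norm_ge_zero not_less norm_eq_zero order_le_less)
  qed
  have \<phi>0: "\<phi> 0 = x" by (simp add: \<phi>_def q.zero_left)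
  have D0: "dderiv u \<phi> 0 = u" for u by (simp add: D q.zero_left)
  have normal: "C.P.\<Gamma> 0 X Y = 0" for X Y
    using C.levi_civita_pullback[OF 0, of X Y] unfolding D0 H \<phi>0 by (simp add: q_def)
  have cov: "cov_deriv (pullback \<phi> G) (ricci_form (pullback \<phi> G)) 0 u v Z
      = cov_deriv G (ricci_form G) x u v Z" for u v
  proof -
    have "cov_deriv (pullback \<phi> G) (ricci_form (pullback \<phi> G)) 0 u v Z
        = cov_deriv (pullback \<phi> G) (pullback \<phi> (ricci_form G)) 0 u v Z"
      unfolding cov_deriv_def C.ricci_pullback[OF 0]
      by (simp add: dderiv_cong_open[OF openS' 0, of "\<lambda>y. ricci_form (pullback \<phi> G) y v Z"
            "\<lambda>y. pullback \<phi> (ricci_form G) y v Z"] C.ricci_pullback)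
    then show ?thesis using C.cov_deriv_pullback[OF ricci_field 0] by (simp add: D0 \<phi>0)
  qed
  have G0: "pullback \<phi> G 0 = G x" by (simp add: pullback_def fun_eq_iff D0 \<phi>0)
  have "dderiv Z (scalar_curv (pullback \<phi> G)) 0 = dderiv Z (\<lambda>y. scalar_curv G (\<phi> y)) 0"
    by (rule dderiv_cong_open[OF openS' 0]) (rule C.scalar_curv_pullback)
  also have "\<dots> = dderiv (dderiv Z \<phi> 0) (scalar_curv G) (\<phi> 0)"
    by (rule dderiv_compose[OF smooth_on_differentiable[OF C.\<phi>_smooth 0]
          smooth_on_differentiable[OF scalar_curv_smooth C.\<phi>_mem[OF 0]]])
  finally have "dderiv Z (scalar_curv (pullback \<phi> G)) 0 = dderiv Z (scalar_curv G) x"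
    unfolding D0 \<phi>0 .
  then show ?thesis
    using C.P.contracted_bianchi_normal[OF 0 normal, where Z = Z] unfolding cov G0 by simp
qed

end

section \<open>Expansions in a large parameter\<close>

lemma dderiv_Pair:
  assumes "f differentiable at x" "g differentiable at x"
  shows "dderiv v (\<lambda>x. (f x, g x)) x = (dderiv v f x, dderiv v g x)"
    "(\<lambda>x. (f x, g x)) differentiable at x"
  using has_derivative_Pair[OF has_derivative_dderiv[OF assms(1)] has_derivative_dderiv[OF assms(2)]]
    dderiv_eqI unfolding differentiable_def by blast+

lemma dderiv_product_direction:
  fixes f :: "'a::real_normed_vector \<times> real \<Rightarrow> 'c::real_normed_vector"
  assumes "f differentiable at z"
  shows "dderiv p f z = dderiv (fst p, 0) f z + snd p *\<^sub>R dderiv (0, 1) f z"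
proof -
  have "dderiv ((fst p, 0) + snd p *\<^sub>R (0, 1)) f z = dderiv (fst p, 0) f z + snd p *\<^sub>R dderiv (0, 1) f z"
    by (simp only: linear_add[OF linear_dderiv[OF assms]] linear_cmul[OF linear_dderiv[OF assms]])
  then show ?thesis by simp
qed

lemma dderiv_slice:
  assumes "f differentiable at (y, t)"
  shows "dderiv u (\<lambda>y. f (y, t)) y = dderiv (u, 0) f (y, t)"
proof -
  have "dderiv u (\<lambda>y. (y, t)) y = (u, 0)" "(\<lambda>y. (y, t)) differentiable at y"
    using dderiv_Pair(1)[of "\<lambda>y. y" y "\<lambda>y. t" u] dderiv_Pair(2)[of "\<lambda>y. y" y "\<lambda>y. t"]
    by (simp_all add: dderiv_bounded_linear[OF bounded_linear_ident])
  then show ?thesis using dderiv_compose[of "\<lambda>y. (y, t)" y f u] assms by simp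
qed

text \<open>The parameter \<open>N\<close> will enter only through the weight \<open>1 / (N + \<rho>)\<close>, which is small together with
  its derivatives when \<open>N\<close> is large.\<close>

locale large_parameter =
  fixes W :: "'x::euclidean_space set" and \<rho> :: "'x \<Rightarrow> real" and N0 :: nat
  assumes openW: "open W" and \<rho>_smooth: "smooth_on \<rho> W"
    and N0_pos: "x \<in> W \<Longrightarrow> 0 < real N0 + \<rho> x"
begin

text \<open>The function \<open>F N\<close> is a smooth function \<open>P\<close> of the point and the weight, defined up to weight
  \<open>0\<close>, and \<open>c\<close> is its value at weight \<open>0\<close>, that is, its limit as \<open>N \<rightarrow> \<infinity>\<close>. The weight ranges over the
  whole real line in order that \<open>P\<close> has an open domain.\<close>

definition expands :: "(nat \<Rightarrow> 'x \<Rightarrow> 'c::real_normed_vector) \<Rightarrow> ('x \<Rightarrow> 'c) \<Rightarrow> bool" where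
  "expands F c \<longleftrightarrow> (\<exists>P. smooth_on P (W \<times> UNIV) \<and> (\<forall>x\<in>W. P (x, 0) = c x) \<and>
     (\<forall>N\<ge>N0. \<forall>x\<in>W. F N x = P (x, inverse (real N + \<rho> x))))"

lemma openP: "open (W \<times> (UNIV :: real set))"
  by (simp add: open_Times openW)

lemma N_pos: "N \<ge> N0 \<Longrightarrow> x \<in> W \<Longrightarrow> 0 < real N + \<rho> x"
  using N0_pos[of x] by linarith

lemma smooth_fst_comp: "smooth_on f W \<Longrightarrow> smooth_on (\<lambda>z. f (fst z)) (W \<times> (UNIV :: real set))"
  by (rule smooth_on_compose[OF openP smooth_on_fst]) auto

lemma expands_cong:
  assumes "expands F c" "\<And>N x. N \<ge> N0 \<Longrightarrow> x \<in> W \<Longrightarrow> F N x = F' N x" "\<And>x. x \<in> W \<Longrightarrow> c x = c' x"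
  shows "expands F' c'"
  using assms unfolding expands_def by metis

lemma expands_const: "smooth_on c W \<Longrightarrow> expands (\<lambda>N. c) c"
  unfolding expands_def using smooth_fst_comp by (intro exI[of _ "\<lambda>z. c (fst z)"]) auto

lemma expands_inverse: "expands (\<lambda>N x. inverse (real N + \<rho> x)) (\<lambda>x. 0)"
  unfolding expands_def by (intro exI[of _ snd]) (auto intro: smooth_on_snd)

lemma expands_bilinear:
  assumes "bounded_bilinear B" "expands F c" "expands F' c'"
  shows "expands (\<lambda>N x. B (F N x) (F' N x)) (\<lambda>x. B (c x) (c' x))"
proof -
  obtain P P' where P: "smooth_on P (W \<times> UNIV)" "\<forall>x\<in>W. P (x, 0) = c x"
    "\<forall>N\<ge>N0. \<forall>x\<in>W. F N x = P (x, inverse (real N + \<rho> x))"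
    and P': "smooth_on P' (W \<times> UNIV)" "\<forall>x\<in>W. P' (x, 0) = c' x"
    "\<forall>N\<ge>N0. \<forall>x\<in>W. F' N x = P' (x, inverse (real N + \<rho> x))"
    using assms(2,3) unfolding expands_def by blast
  show ?thesis
    unfolding expands_def
    by (intro exI[of _ "\<lambda>z. B (P z) (P' z)"])
      (use P P' smooth_on_bilinear_comp[OF assms(1) openP P(1) P'(1)] in auto)
qed

lemma expands_add:
  assumes "expands F c" "expands F' c'"
  shows "expands (\<lambda>N x. F N x + F' N x) (\<lambda>x. c x + c' x)"
proof -
  obtain P P' where P: "smooth_on P (W \<times> UNIV)" "\<forall>x\<in>W. P (x, 0) = c x"
    "\<forall>N\<ge>N0. \<forall>x\<in>W. F N x = P (x, inverse (real N + \<rho> x))"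
    and P': "smooth_on P' (W \<times> UNIV)" "\<forall>x\<in>W. P' (x, 0) = c' x"
    "\<forall>N\<ge>N0. \<forall>x\<in>W. F' N x = P' (x, inverse (real N + \<rho> x))"
    using assms unfolding expands_def by blast
  show ?thesis
    unfolding expands_def
    by (intro exI[of _ "\<lambda>z. P z + P' z"]) (use P P' smooth_on_add[OF openP P(1) P'(1)] in auto)
qed

lemma expands_linear:
  assumes "bounded_linear L" "expands F c"
  shows "expands (\<lambda>N x. L (F N x)) (\<lambda>x. L (c x))"
proof -
  obtain P where P: "smooth_on P (W \<times> UNIV)" "\<forall>x\<in>W. P (x, 0) = c x"
    "\<forall>N\<ge>N0. \<forall>x\<in>W. F N x = P (x, inverse (real N + \<rho> x))"
    using assms(2) unfolding expands_def by blast
  show ?thesis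
    unfolding expands_def
    by (intro exI[of _ "\<lambda>z. L (P z)"]) (use P smooth_on_linear_comp[OF assms(1) openP P(1)] in auto)
qed

lemmas expands_scaleR = expands_bilinear[OF bounded_bilinear_scaleR]
lemmas expands_mult = expands_bilinear[OF bounded_bilinear_mult]

lemma expands_diff:
  "expands F c \<Longrightarrow> expands F' c' \<Longrightarrow> expands (\<lambda>N x. F N x - F' N x) (\<lambda>x. c x - c' x)"
  using expands_add[of F c "\<lambda>N x. - F' N x" "\<lambda>x. - c' x"]
    expands_linear[OF bounded_linear_minus[OF bounded_linear_ident], of F' c'] by simp

lemma expands_sum:
  "(\<And>i. i \<in> I \<Longrightarrow> expands (F i) (c i)) \<Longrightarrow> expands (\<lambda>N x. \<Sum>i\<in>I. F i N x) (\<lambda>x. \<Sum>i\<in>I. c i x)"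
  by (induction I rule: infinite_finite_induct)
    (auto intro: expands_const smooth_on_const expands_add)

text \<open>The derivative of the weight \<open>w\<close> is \<open>- w\<^sup>2 \<partial>\<^sub>v \<rho>\<close>, which is again smooth in the point and the weight
  and vanishes at weight \<open>0\<close>. Hence limits and derivatives commute.\<close>

lemma expands_dderiv:
  assumes "expands F c"
  shows "expands (\<lambda>N. dderiv v (F N)) (dderiv v c)"
proof -
  obtain P where P: "smooth_on P (W \<times> UNIV)" "\<forall>x\<in>W. P (x, 0) = c x"
    "\<forall>N\<ge>N0. \<forall>x\<in>W. F N x = P (x, inverse (real N + \<rho> x))"
    using assms unfolding expands_def by blast
  define Q where "Q z = dderiv (v, 0) P z -
      (snd z * snd z * dderiv v \<rho> (fst z)) *\<^sub>R dderiv (0, 1) P z" for z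
  have dP: "P differentiable at (x, w)" if "x \<in> W" for x w
    by (rule smooth_on_differentiable[OF P(1)]) (use that in auto)
  have "smooth_on Q (W \<times> UNIV)"
    unfolding Q_def
    by (intro smooth_on_diff smooth_on_scaleR smooth_on_mult smooth_on_dderiv P(1) openP smooth_on_snd
        smooth_fst_comp \<rho>_smooth)
  moreover have "Q (x, 0) = dderiv v c x" if x: "x \<in> W" for x
  proof -
    have "dderiv v c x = dderiv v (\<lambda>x. P (x, 0)) x"
      by (rule dderiv_cong_open[OF openW x]) (use P in auto)
    then show ?thesis using dderiv_slice[OF dP[OF x]] by (simp add: Q_def)
  qed
  moreover have "dderiv v (F N) x = Q (x, inverse (real N + \<rho> x))" if N: "N \<ge> N0" and x: "x \<in> W" for N x
  proof -
    have d\<rho>: "\<rho> differentiable at x" by (rule smooth_on_differentiable[OF \<rho>_smooth x])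
    then have d: "(\<lambda>x. real N + \<rho> x) differentiable at x" by simp
    have nz: "real N + \<rho> x \<noteq> 0" using N_pos[OF N x] by simp
    have i: "(\<lambda>x. inverse (real N + \<rho> x)) differentiable at x"
      using d nz by simp
    have w: "dderiv v (\<lambda>x. inverse (real N + \<rho> x)) x =
        - (inverse (real N + \<rho> x) * inverse (real N + \<rho> x) * dderiv v \<rho> x)"
      using dderiv_inverse[of "\<lambda>x. real N + \<rho> x" x v, OF nz d] d\<rho> by (simp add: dderiv_add)
    have id: "dderiv v (\<lambda>x. x) x = v" by (rule dderiv_bounded_linear[OF bounded_linear_ident])
    have "dderiv v (F N) x = dderiv v (\<lambda>x. P (x, inverse (real N + \<rho> x))) x"
      by (rule dderiv_cong_open[OF openW x]) (use P N in auto)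
    also have "\<dots> = dderiv (dderiv v (\<lambda>x. (x, inverse (real N + \<rho> x))) x) P (x, inverse (real N + \<rho> x))"
      by (rule dderiv_compose[OF dderiv_Pair(2)[OF differentiable_ident i] dP[OF x]])
    also have "\<dots> = Q (x, inverse (real N + \<rho> x))"
      by (simp add: dderiv_Pair(1)[OF differentiable_ident i] id w
          dderiv_product_direction[OF dP[OF x], of "(v, - (_ * _ * _))"] Q_def)
    finally show ?thesis .
  qed
  ultimately show ?thesis unfolding expands_def by blast
qed

lemma expands_linear_field:
  assumes "\<And>N. N \<ge> N0 \<Longrightarrow> linear_field W (A N)" "linear_field W A0"
    and "\<And>u. expands (\<lambda>N x. A N x u) (\<lambda>x. A0 x u)" "expands V V0"
  shows "expands (\<lambda>N x. A N x (V N x)) (\<lambda>x. A0 x (V0 x))"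
proof -
  have coord: "expands (\<lambda>N x. V N x \<bullet> i) (\<lambda>x. V0 x \<bullet> i)" for i
    by (rule expands_linear[OF bounded_linear_inner_left assms(4)])
  have sum: "expands (\<lambda>N x. \<Sum>i\<in>Basis. (V N x \<bullet> i) *\<^sub>R A N x i)
      (\<lambda>x. \<Sum>i\<in>Basis. (V0 x \<bullet> i) *\<^sub>R A0 x i)"
    by (rule expands_sum) (rule expands_scaleR[OF coord assms(3)])
  have "(\<Sum>i\<in>Basis. (V N x \<bullet> i) *\<^sub>R A N x i) = A N x (V N x)" if "N \<ge> N0" "x \<in> W" for N x
    by (rule linear_field_expand[OF assms(1)[OF that(1)] that(2), symmetric])
  moreover have "(\<Sum>i\<in>Basis. (V0 x \<bullet> i) *\<^sub>R A0 x i) = A0 x (V0 x)" if "x \<in> W" for x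
    by (rule linear_field_expand[OF assms(2) that, symmetric])
  ultimately show ?thesis by (rule expands_cong[OF sum])
qed

lemma expands_tendsto:
  assumes "expands F c" "x \<in> W"
  shows "(\<lambda>N. F N x) \<longlonglongrightarrow> c x"
proof -
  obtain P where P: "smooth_on P (W \<times> UNIV)" "\<forall>x\<in>W. P (x, 0) = c x"
    "\<forall>N\<ge>N0. \<forall>x\<in>W. F N x = P (x, inverse (real N + \<rho> x))"
    using assms unfolding expands_def by blast
  have "filterlim (\<lambda>N. real N + \<rho> x) at_top sequentially"
    using filterlim_tendsto_add_at_top[OF tendsto_const filterlim_real_sequentially, of "\<rho> x"]
    by (simp add: add.commute)
  then have "(\<lambda>N. inverse (real N + \<rho> x)) \<longlonglongrightarrow> 0"
    by (rule tendsto_inverse_0_at_top)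
  then have "(\<lambda>N. (x, inverse (real N + \<rho> x))) \<longlonglongrightarrow> (x, 0)" by (intro tendsto_intros)
  moreover have "isCont P (x, 0)"
    using smooth_on_continuous[OF P(1)] continuous_on_eq_continuous_at[OF openP] assms(2) by auto
  ultimately have "(\<lambda>N. P (x, inverse (real N + \<rho> x))) \<longlonglongrightarrow> P (x, 0)"
    by (rule isCont_tendsto_compose[rotated])
  moreover have "\<forall>\<^sub>F N in sequentially. P (x, inverse (real N + \<rho> x)) = F N x"
    using eventually_ge_at_top[of N0] by eventually_elim (use P assms(2) in auto)
  ultimately have "(\<lambda>N. F N x) \<longlonglongrightarrow> P (x, 0)" by (rule Lim_transform_eventually)
  then show ?thesis using P(2) assms(2) by simp
qed

lemma expands_unique:
  assumes "expands F c" "expands F' c'" "\<And>N. N \<ge> N0 \<Longrightarrow> F N x = F' N x" "x \<in> W"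
  shows "c x = c' x"
proof -
  have "\<forall>\<^sub>F N in sequentially. F N x = F' N x"
    using eventually_ge_at_top[of N0] by eventually_elim (use assms(3) in auto)
  with expands_tendsto[OF assms(1,4)] have "(\<lambda>N. F' N x) \<longlonglongrightarrow> c x"
    by (rule Lim_transform_eventually)
  then show ?thesis using expands_tendsto[OF assms(2,4)] LIMSEQ_unique by blast
qed

text \<open>Write \<open>N = N0 + (N - N0)\<close>: the first summand is at most \<open>(N0 / c) (N0 + r)\<close> and the second at most
  \<open>N + r\<close>.\<close>

lemma scaled_weight_bound:
  assumes "N \<ge> N0" "0 < c" "c \<le> real N0 + r"
  shows "real N * inverse (real N + r) \<le> real N0 / c + 1"
proof -
  have "real N \<le> (real N0 / c + 1) * (real N + r)"
  proof -
    have "real N0 \<le> real N0 / c * (real N0 + r)"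
      using mult_left_mono[OF assms(3), of "real N0"] assms(2) by (simp add: field_simps)
    also have "\<dots> \<le> real N0 / c * (real N + r)"
      using assms by (intro mult_left_mono) auto
    finally have "real N0 \<le> real N0 / c * (real N + r)" .
    moreover have "real N - real N0 \<le> real N + r" using assms by linarith
    ultimately show ?thesis by (simp add: algebra_simps)
  qed
  moreover have "real N + r > 0" using assms by linarith
  ultimately show ?thesis by (simp add: pos_divide_le_eq divide_inverse[symmetric])
qed

text \<open>By the mean value theorem \<open>P(x, w) = O(w)\<close>, and \<open>N w\<close> is bounded. Positivity of \<open>N0 + \<rho>\<close> on the
  compact set keeps the weight bounded for all \<open>N \<ge> N0\<close> at once.\<close>

lemma expands_0_bounded:
  fixes F :: "nat \<Rightarrow> 'x \<Rightarrow> real"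
  assumes "expands F (\<lambda>x. 0)" "compact K" "K \<subseteq> W"
  shows "\<exists>C. \<forall>N\<ge>N0. \<forall>x\<in>K. \<bar>real N * F N x\<bar> \<le> C"
proof (cases "K = {}")
  case False
  obtain P where P: "smooth_on P (W \<times> UNIV)" "\<forall>x\<in>W. P (x, 0) = 0"
    "\<forall>N\<ge>N0. \<forall>x\<in>W. F N x = P (x, inverse (real N + \<rho> x))"
    using assms(1) unfolding expands_def by blast
  have "continuous_on K (\<lambda>x. real N0 + \<rho> x)"
    by (intro continuous_intros continuous_on_subset[OF smooth_on_continuous[OF \<rho>_smooth] assms(3)])
  then obtain x0 where x0: "x0 \<in> K" "\<forall>x\<in>K. real N0 + \<rho> x0 \<le> real N0 + \<rho> x"
    using continuous_attains_inf[OF assms(2) False] by blast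
  define c where "c = real N0 + \<rho> x0"
  have c: "c > 0" "\<And>x. x \<in> K \<Longrightarrow> c \<le> real N0 + \<rho> x"
    using N0_pos[of x0] x0 assms(3) by (auto simp: c_def)
  have "compact (K \<times> {0..1/c})" using assms(2) by (simp add: compact_Times)
  moreover have "continuous_on (K \<times> {0..1/c}) (dderiv (0, 1) P)"
    by (rule continuous_on_subset[OF smooth_on_continuous[OF smooth_on_dderiv[OF P(1)]]])
      (use assms(3) in auto)
  ultimately have "bounded (dderiv (0, 1) P ` (K \<times> {0..1/c}))"
    by (meson compact_continuous_image compact_imp_bounded)
  then obtain B where B: "B > 0" "\<And>z. z \<in> K \<times> {0..1/c} \<Longrightarrow> \<bar>dderiv (0, 1) P z\<bar> \<le> B"
    by (auto simp: bounded_pos)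
  have "\<bar>real N * F N x\<bar> \<le> B * (real N0 / c + 1)" if N: "N \<ge> N0" and x: "x \<in> K" for N x
  proof -
    define w where "w = inverse (real N + \<rho> x)"
    have xW: "x \<in> W" using x assms(3) by auto
    have w: "0 < w" "w \<le> 1 / c"
      using c(1) c(2)[OF x] N by (auto simp: w_def field_simps)
    have der: "((\<lambda>s. P (x, s)) has_real_derivative dderiv (0, 1) P (x, s)) (at s)" for s
    proof -
      have line: "((\<lambda>s. (x, s)) has_derivative (\<lambda>r. (0, r))) (at s)"
        by (auto intro!: derivative_eq_intros)
      have dP: "P differentiable at (x, s)"
        by (rule smooth_on_differentiable[OF P(1)]) (use xW in auto)
      have "((\<lambda>s. P (x, s)) has_derivative (\<lambda>r. dderiv (0, r) P (x, s))) (at s)"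
        by (rule has_derivative_compose[OF line has_derivative_dderiv[OF dP]])
      moreover have "(\<lambda>r. dderiv (0, r) P (x, s)) = (*) (dderiv (0, 1) P (x, s))"
      proof
        fix r
        show "dderiv (0, r) P (x, s) = dderiv (0, 1) P (x, s) * r"
          using linear_cmul[OF linear_dderiv[OF dP], of r "(0, 1)"] by simp
      qed
      ultimately show ?thesis unfolding has_field_derivative_def by simp
    qed
    obtain s where s: "0 < s" "s < w" "P (x, w) - P (x, 0) = (w - 0) * dderiv (0, 1) P (x, s)"
      using MVT2[OF w(1) der] by blast
    then have "\<bar>P (x, w)\<bar> \<le> w * B"
      using P(2) xW w x B(2)[of "(x, s)"] by (simp add: abs_mult)
    then have "\<bar>real N * F N x\<bar> \<le> real N * (w * B)"
      using P(3) N xW by (simp add: abs_mult w_def mult_left_mono)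
    also have "\<dots> = B * (real N * w)" by simp
    also have "\<dots> \<le> B * (real N0 / c + 1)"
      using scaled_weight_bound[OF N c(1) c(2)[OF x]] B(1) by (simp add: w_def)
    finally show ?thesis .
  qed
  then show ?thesis by blast
qed auto

end

section \<open>A reverse Ricci flow in a coordinate domain\<close>

lemma bounded_linear_embeddings:
  "bounded_linear (\<lambda>u. (u, 0))" "bounded_linear (\<lambda>u. (0, u))"
  by (simp_all add: bounded_linear_Pair bounded_linear_ident bounded_linear_zero)

lemma linear_field_precompose:
  assumes "linear_field S A" "bounded_linear L"
  shows "linear_field S (\<lambda>x u. A x (L u))"
  unfolding linear_field_def
proof (intro conjI ballI allI)
  show "linear (\<lambda>u. A x (L u))" if "x \<in> S" for x
    using linear_compose[OF bounded_linear.linear[OF assms(2)], of "A x"] assms(1) that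
    by (simp add: o_def linear_field_def)
qed (use assms(1) in \<open>auto simp: linear_field_def\<close>)

text \<open>The one-form \<open>v \<mapsto> tr (G\<^sup>-\<^sup>1 \<partial>\<^sub>v G)\<close> is the differential of \<open>log det G\<close>, hence closed.\<close>

lemma (in metric_field) log_det_closed:
  assumes x: "x \<in> S"
  shows "dderiv p (\<lambda>y. \<Sum>k\<in>Basis. dderiv q (\<lambda>z. G z k (dual_vec (G y) k)) y) x
    = dderiv q (\<lambda>y. \<Sum>k\<in>Basis. dderiv p (\<lambda>z. G z k (dual_vec (G y) k)) y) x"
proof -
  define e where "e y k = dual_vec (G y) k" for y k
  define dG where "dG p y u v = dderiv p (\<lambda>z. G z u v) y" for p y u v
  have lf: "linear_field S (\<lambda>y. dG q y k)" for q k
    unfolding dG_def by (rule linear_field_dderiv[OF bilinear_field_slots(1)[OF field]])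
  have bil: "bilinear (dG q x)" for q
    using bilinear_field_dderiv[OF field, of q] x by (simp add: bilinear_field_def dG_def[abs_def])
  have sym: "dG q x u v = dG q x v u" for q u v
    unfolding dG_def by (rule dderiv_cong_open[OF openS x]) (rule Gsym)
  have sme: "smooth_on (\<lambda>y. e y k) S" for k unfolding e_def by (rule smooth_dual)
  have de: "dderiv p (\<lambda>y. e y k) x = - (\<Sum>l\<in>Basis. dG p x (e x k) l *\<^sub>R e x l)" for p k
    unfolding e_def dG_def by (rule dderiv_dual[OF x])
  have term_eq: "dG q x k (dderiv p (\<lambda>y. e y k) x) = - (\<Sum>l\<in>Basis. dG p x (e x k) l * dG q x k (e x l))"
    for p q k
    unfolding de
    by (simp add: linear_neg[OF bilinearD(1)[OF bil]] linear_sum[OF bilinearD(1)[OF bil]]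
        bilinear_rmul[OF bil])
  have expand: "dderiv p (\<lambda>y. \<Sum>k\<in>Basis. dG q y k (e y k)) x
      = (\<Sum>k\<in>Basis. dderiv p (\<lambda>y. dG q y k (e x k)) x)
        - (\<Sum>k\<in>Basis. \<Sum>l\<in>Basis. dG p x (e x k) l * dG q x k (e x l))" for p q
  proof -
    have "dderiv p (\<lambda>y. \<Sum>k\<in>Basis. dG q y k (e y k)) x = (\<Sum>k\<in>Basis. dderiv p (\<lambda>y. dG q y k (e y k)) x)"
      by (rule dderiv_sum) (rule smooth_on_differentiable[OF linear_field_apply(1)[OF lf sme] x])
    then show ?thesis
      by (simp add: linear_field_apply(2)[OF lf sme x] term_eq sum.distrib sum_subtractf)
  qed
  have "dderiv p (\<lambda>y. dG q y k v) x = dderiv q (\<lambda>y. dG p y k v) x" for k v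
    unfolding dG_def by (rule dderiv_commute[OF openS Gsmooth x])
  moreover have "(\<Sum>k\<in>Basis. \<Sum>l\<in>Basis. dG p x (e x k) l * dG q x k (e x l))
      = (\<Sum>k\<in>Basis. \<Sum>l\<in>Basis. dG q x (e x k) l * dG p x k (e x l))"
    by (subst sum.swap) (simp add: sym[of _ _ "e x _"] mult.commute)
  ultimately have "dderiv p (\<lambda>y. \<Sum>k\<in>Basis. dG q y k (e y k)) x
      = dderiv q (\<lambda>y. \<Sum>k\<in>Basis. dG p y k (e y k)) x"
    unfolding expand by simp
  then show ?thesis unfolding dG_def e_def .
qed

text \<open>A family of metrics on \<open>U\<close> is a field of inner products of \<open>\<real>\<^sup>n\<close> over \<open>U \<times> I\<close>. Its connection and
  curvature are those of the time slices, read as functions of space and time so that they can be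
  differentiated in time as well.\<close>

locale flow_chart = metric_field "U \<times> I" \<gamma>
  for U :: "'e::euclidean_space set" and I :: "real set" and \<gamma> :: "'e \<times> real \<Rightarrow> 'e \<Rightarrow> 'e \<Rightarrow> real" +
  assumes openU: "open U" and openI: "open I"
    and flow: "x \<in> U \<times> I \<Longrightarrow>
      dderiv (0, 1) (\<lambda>x. \<gamma> x u v) x = 2 * ricci_form (\<lambda>y. \<gamma> (y, snd x)) (fst x) u v"
begin

abbreviation "W \<equiv> U \<times> I"

definition "conn x = levi_civita (\<lambda>y. \<gamma> (y, snd x)) (fst x)"
definition "Rc x = ricci_form (\<lambda>y. \<gamma> (y, snd x)) (fst x)"
definition "R x = scalar_curv (\<lambda>y. \<gamma> (y, snd x)) (fst x)"

lemma slice_chart: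
  assumes "t \<in> I" shows "metric_chart U (\<lambda>y. \<gamma> (y, t))"
proof unfold_locales
  have "smooth_on (\<lambda>y. \<gamma> (y, t) u v) U" for u v
    by (rule smooth_on_compose[OF openU _ Gsmooth])
      (use assms in \<open>auto intro: smooth_on_Pair[OF openU] smooth_on_const
        smooth_on_bounded_linear[OF bounded_linear_ident]\<close>)
  then show "bilinear_field U (\<lambda>y. \<gamma> (y, t))"
    using openU Gbil assms by (simp add: bilinear_field_def)
qed (use assms Gsym Gpos in auto)

lemma fst_snd_mem: "x \<in> W \<Longrightarrow> fst x \<in> U" "x \<in> W \<Longrightarrow> snd x \<in> I"
  by auto

lemma dderiv_slice':
  assumes "smooth_on f W" "x \<in> W"
  shows "dderiv u (\<lambda>y. f (y, snd x)) (fst x) = dderiv (u, 0) f x"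
  using dderiv_slice[of f "fst x" "snd x" u] smooth_on_differentiable[OF assms] by simp

lemma conn_eq_raise:
  assumes x: "x \<in> W"
  shows "conn x X Y = raise (\<gamma> x) (\<lambda>Z. (dderiv (X, 0) (\<lambda>x. \<gamma> x Y Z) x
    + dderiv (Y, 0) (\<lambda>x. \<gamma> x X Z) x - dderiv (Z, 0) (\<lambda>x. \<gamma> x X Y) x) / 2)"
  by (simp add: conn_def levi_civita_def koszul_def[abs_def] dderiv_slice'[OF Gsmooth x])

lemma conn_field: "bilinear_field W conn"
  unfolding bilinear_field_def
proof (intro conjI ballI allI)
  show "bilinear (conn x)" if "x \<in> W" for x
    unfolding conn_def
    using metric_chart.lc_bil[OF slice_chart] fst_snd_mem[OF that] by blast
  have "smooth_on (\<lambda>x. raise (\<gamma> x) (\<lambda>Z. (dderiv (X, 0) (\<lambda>x. \<gamma> x Y Z) x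
    + dderiv (Y, 0) (\<lambda>x. \<gamma> x X Z) x - dderiv (Z, 0) (\<lambda>x. \<gamma> x X Y) x) / 2)) W" for X Y
    by (intro smooth_raise smooth_on_linear_comp[OF bounded_linear_divide] smooth_on_diff smooth_on_add
        smooth_on_dderiv Gsmooth openS)
  then show "smooth_on (\<lambda>x. conn x X Y) W" for X Y
    by (rule smooth_on_cong[OF openS]) (rule conn_eq_raise[symmetric])
qed (rule openS)

lemma conn_bil: "x \<in> W \<Longrightarrow> bilinear (conn x)"
  by (rule bilinear_fieldD(1)[OF conn_field])

lemma conn_smooth: "smooth_on (\<lambda>x. conn x X Y) W"
  using conn_field by (simp add: bilinear_field_def)

lemma conn_koszul:
  assumes x: "x \<in> W"
  shows "\<gamma> x (conn x X Y) Z = (dderiv (X, 0) (\<lambda>x. \<gamma> x Y Z) x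
    + dderiv (Y, 0) (\<lambda>x. \<gamma> x X Z) x - dderiv (Z, 0) (\<lambda>x. \<gamma> x X Y) x) / 2"
  using metric_chart.levi_civita_koszul[OF slice_chart[OF fst_snd_mem(2)[OF x]] fst_snd_mem(1)[OF x], of X Y Z]
  by (simp add: conn_def koszul_def dderiv_slice'[OF Gsmooth x])

lemma conn_sym: "x \<in> W \<Longrightarrow> conn x X Y = conn x Y X"
  unfolding conn_def by (rule metric_chart.levi_civita_sym[OF slice_chart]) auto

lemma conn_compatible:
  assumes x: "x \<in> W"
  shows "dderiv (X, 0) (\<lambda>x. \<gamma> x Y Z) x = \<gamma> x (conn x X Y) Z + \<gamma> x Y (conn x X Z)"
  using metric_chart.metric_compatible[OF slice_chart[OF fst_snd_mem(2)[OF x]] fst_snd_mem(1)[OF x], of X Y Z]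
  by (simp add: conn_def dderiv_slice'[OF Gsmooth x])

lemma slice_curvature:
  assumes x: "x \<in> W"
  shows "connection_curvature (levi_civita (\<lambda>y. \<gamma> (y, snd x))) (fst x) X Y Z =
    dderiv (X, 0) (\<lambda>y. conn y Y Z) x - dderiv (Y, 0) (\<lambda>y. conn y X Z) x
    + conn x X (conn x Y Z) - conn x Y (conn x X Z)"
proof -
  have "levi_civita (\<lambda>y. \<gamma> (y, snd x)) = (\<lambda>y. conn (y, snd x))"
    by (simp add: conn_def fun_eq_iff)
  then show ?thesis
    unfolding connection_curvature_def by (simp add: dderiv_slice'[OF conn_smooth x])
qed

lemma Rc_eq: "x \<in> W \<Longrightarrow> Rc x Y Z = (\<Sum>k\<in>Basis. (dderiv (k, 0) (\<lambda>y. conn y Y Z) x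
    - dderiv (Y, 0) (\<lambda>y. conn y k Z) x + conn x k (conn x Y Z) - conn x Y (conn x k Z)) \<bullet> k)"
  by (simp add: Rc_def ricci_form_def slice_curvature)

lemma Rc_field: "bilinear_field W Rc"
  unfolding bilinear_field_def
proof (intro conjI ballI allI)
  show "bilinear (Rc x)" if "x \<in> W" for x
    unfolding Rc_def
    using metric_chart.ricci_bil[OF slice_chart] fst_snd_mem[OF that] by blast
  have "smooth_on (\<lambda>x. \<Sum>k\<in>Basis. (dderiv (k, 0) (\<lambda>y. conn y Y Z) x
      - dderiv (Y, 0) (\<lambda>y. conn y k Z) x + conn x k (conn x Y Z) - conn x Y (conn x k Z)) \<bullet> k) W" for Y Z
    by (intro smooth_on_sum smooth_on_inner_left smooth_on_diff smooth_on_add smooth_on_dderiv openS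
        conn_smooth linear_field_apply(1)[OF bilinear_field_slots(1)[OF conn_field] conn_smooth])
  then show "smooth_on (\<lambda>x. Rc x Y Z) W" for Y Z
    by (rule smooth_on_cong[OF openS]) (rule Rc_eq[symmetric])
qed (rule openS)

lemma Rc_bil: "x \<in> W \<Longrightarrow> bilinear (Rc x)"
  by (rule bilinear_fieldD(1)[OF Rc_field])

lemma Rc_smooth: "smooth_on (\<lambda>x. Rc x X Y) W"
  using Rc_field by (simp add: bilinear_field_def)

lemma flow': "x \<in> W \<Longrightarrow> dderiv (0, 1) (\<lambda>x. \<gamma> x u v) x = 2 * Rc x u v"
  unfolding Rc_def by (rule flow)

lemma Rc_sym:
  assumes x: "x \<in> W" shows "Rc x u v = Rc x v u"
proof -
  have "dderiv (0, 1) (\<lambda>x. \<gamma> x u v) x = dderiv (0, 1) (\<lambda>x. \<gamma> x v u) x"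
    by (rule dderiv_cong_open[OF openS x]) (rule Gsym)
  then show ?thesis by (simp add: flow'[OF x])
qed

lemma R_eq: "R x = metric_trace (\<gamma> x) (Rc x)"
  by (simp add: R_def scalar_curv_def Rc_def)

lemma R_smooth: "smooth_on R W"
  using smooth_metric_trace[OF Rc_field] R_eq by (simp add: R_eq[abs_def])

text \<open>The Ricci endomorphism \<open>R\<^sup>k\<^sub>i\<close>.\<close>

definition "A x X = raise (\<gamma> x) (Rc x X)"

lemma A_field: "linear_field W A"
  unfolding A_def[abs_def] raise_def
  by (rule linear_field_sum[OF openS linear_field_scaleR[OF bilinear_field_slots(2)[OF Rc_field] smooth_dual]])

lemma A_linear: "x \<in> W \<Longrightarrow> linear (A x)"
  by (rule linear_fieldD(1)[OF A_field])

lemma A_smooth: "smooth_on (\<lambda>x. A x X) W"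
  using A_field by (simp add: linear_field_def)

lemma A_form: "x \<in> W \<Longrightarrow> \<gamma> x (A x X) Z = Rc x X Z"
  unfolding A_def by (rule inner_form.raise[OF inner_form bilinearD(1)[OF Rc_bil]])

lemma trace_A: "x \<in> W \<Longrightarrow> (\<Sum>k\<in>Basis. A x k \<bullet> k) = R x"
  by (simp add: inner_form.trace_eq_metric_trace[OF inner_form] A_form R_eq metric_trace_def
      Rc_sym[of x _ "dual_vec _ _"])

definition "grad x = raise (\<gamma> x) (\<lambda>Z. dderiv (Z, 0) R x)"

lemma linear_dR: "linear_field W (\<lambda>x X. dderiv (X, 0) R x)"
  using linear_field_precompose[OF linear_field_direction[OF openS R_smooth] bounded_linear_embeddings(1)] .

lemma grad_form: "x \<in> W \<Longrightarrow> \<gamma> x (grad x) Z = dderiv (Z, 0) R x"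
  unfolding grad_def
  by (rule inner_form.raise[OF inner_form linear_fieldD(1)[OF linear_dR]])

lemma grad_smooth: "smooth_on grad W"
  unfolding grad_def[abs_def] by (intro smooth_raise smooth_on_dderiv R_smooth)

text \<open>The covariant derivative of the Ricci tensor within a time slice.\<close>

definition "nabla_Rc x X Y Z =
  dderiv (X, 0) (\<lambda>x. Rc x Y Z) x - Rc x (conn x X Y) Z - Rc x Y (conn x X Z)"

lemma nabla_Rc_sym:
  assumes x: "x \<in> W" shows "nabla_Rc x X Y Z = nabla_Rc x X Z Y"
proof -
  have "dderiv (X, 0) (\<lambda>x. Rc x Y Z) x = dderiv (X, 0) (\<lambda>x. Rc x Z Y) x"
    by (rule dderiv_cong_open[OF openS x]) (rule Rc_sym)
  then show ?thesis by (simp add: nabla_Rc_def Rc_sym[OF x, of Y] Rc_sym[OF x, of Z])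
qed

lemma nabla_Rc_bil:
  assumes x: "x \<in> W" shows "bilinear (\<lambda>X Y. nabla_Rc x X Y Z)"
proof -
  have 1: "linear (\<lambda>X. dderiv (X, 0) (\<lambda>x. Rc x Y Z) x)" for Y
    by (rule linear_fieldD(1)[OF linear_field_precompose[OF
          linear_field_direction[OF openS Rc_smooth] bounded_linear_embeddings(1)] x])
  have 2: "linear (\<lambda>Y. dderiv (X, 0) (\<lambda>x. Rc x Y Z) x)" for X
    by (rule linear_fieldD(1)[OF linear_field_dderiv[OF bilinear_field_slots(2)[OF Rc_field]] x])
  have 3: "linear (\<lambda>X. Rc x (conn x X Y) Z)" "linear (\<lambda>X. Rc x Y (conn x X Z))"
    "linear (\<lambda>Y. Rc x (conn x X Y) Z)" for X Y
    using linear_compose[OF bilinearD(2)[OF conn_bil[OF x]] bilinearD(2)[OF Rc_bil[OF x]]]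
      linear_compose[OF bilinearD(2)[OF conn_bil[OF x]] bilinearD(1)[OF Rc_bil[OF x]]]
      linear_compose[OF bilinearD(1)[OF conn_bil[OF x]] bilinearD(2)[OF Rc_bil[OF x]]]
    by (simp_all add: o_def)
  show ?thesis
    unfolding bilinear_def nabla_Rc_def
    by (intro conjI allI linear_compose_sub 1 2 3 bilinearD(2)[OF Rc_bil[OF x]])
qed

lemma flow_bianchi:
  assumes x: "x \<in> W"
  shows "2 * metric_trace (\<gamma> x) (\<lambda>X Y. nabla_Rc x X Y Z) = dderiv (Z, 0) R x"
proof -
  interpret s: metric_chart U "\<lambda>y. \<gamma> (y, snd x)" by (rule slice_chart[OF fst_snd_mem(2)[OF x]])
  have "cov_deriv (\<lambda>y. \<gamma> (y, snd x)) (ricci_form (\<lambda>y. \<gamma> (y, snd x))) (fst x) X Y Z = nabla_Rc x X Y Z" for X Y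
    using dderiv_slice'[OF Rc_smooth x, of X Y Z]
    unfolding cov_deriv_def nabla_Rc_def by (simp add: Rc_def conn_def)
  then show ?thesis
    using s.contracted_bianchi[OF fst_snd_mem(1)[OF x], of Z] dderiv_slice'[OF R_smooth x, of Z]
    by (simp add: R_def)
qed

text \<open>Since the metric is parallel, lowering the index of \<open>\<nabla>A\<close> gives \<open>\<nabla>Ric\<close>.\<close>

lemma nabla_A_form:
  assumes x: "x \<in> W"
  shows "\<gamma> x (dderiv (X, 0) (\<lambda>y. A y Y) x + conn x X (A x Y) - A x (conn x X Y)) Z = nabla_Rc x X Y Z"
proof -
  have "dderiv (X, 0) (\<lambda>y. Rc y Y Z) x = dderiv (X, 0) (\<lambda>y. \<gamma> y (A y Y) Z) x"
    by (rule dderiv_cong_open[OF openS x]) (rule A_form[symmetric])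
  also have "\<dots> = \<gamma> x (conn x X (A x Y)) Z + \<gamma> x (A x Y) (conn x X Z) + \<gamma> x (dderiv (X, 0) (\<lambda>y. A y Y) x) Z"
    by (simp only: linear_field_apply(2)[OF bilinear_field_slots(2)[OF field] A_smooth x] conn_compatible[OF x])
  finally show ?thesis
    by (simp add: nabla_Rc_def bilinear_simps[OF Gbil[OF x]] A_form[OF x])
qed

text \<open>The contracted Bianchi identity with the index of the Ricci tensor raised.\<close>

lemma divergence_A:
  assumes x: "x \<in> W"
  shows "(\<Sum>k\<in>Basis. (dderiv (k, 0) (\<lambda>y. A y Y) x + conn x k (A x Y) - A x (conn x k Y)) \<bullet> k)
    = dderiv (Y, 0) R x / 2"
proof -
  have "(\<Sum>k\<in>Basis. (dderiv (k, 0) (\<lambda>y. A y Y) x + conn x k (A x Y) - A x (conn x k Y)) \<bullet> k)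
      = (\<Sum>k\<in>Basis. nabla_Rc x k Y (dual_vec (\<gamma> x) k))"
    unfolding inner_form.trace_eq_metric_trace[OF inner_form[OF x]] nabla_A_form[OF x] ..
  also have "\<dots> = metric_trace (\<gamma> x) (\<lambda>X Z. nabla_Rc x Z X Y)"
    unfolding metric_trace_def nabla_Rc_sym[OF x, of _ Y] ..
  also have "\<dots> = metric_trace (\<gamma> x) (\<lambda>X Z. nabla_Rc x X Z Y)"
    by (rule inner_form.metric_trace_swap[OF inner_form[OF x] nabla_Rc_bil[OF x]])
  finally show ?thesis using flow_bianchi[OF x, of Y] by simp
qed

text \<open>The connection enters \<open>\<nabla>\<^sub>Y A\<close> through a commutator, which is traceless.\<close>

lemma trace_nabla_A:
  assumes x: "x \<in> W"
  shows "(\<Sum>k\<in>Basis. (dderiv (Y, 0) (\<lambda>y. A y k) x + conn x Y (A x k) - A x (conn x Y k)) \<bullet> k)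
    = dderiv (Y, 0) R x"
proof -
  have "dderiv (Y, 0) R x = dderiv (Y, 0) (\<lambda>y. \<Sum>k\<in>Basis. A y k \<bullet> k) x"
    by (rule dderiv_cong_open[OF openS x]) (rule trace_A[symmetric])
  also have "\<dots> = (\<Sum>k\<in>Basis. dderiv (Y, 0) (\<lambda>y. A y k) x \<bullet> k)"
    using smooth_on_differentiable[OF A_smooth x]
    by (subst dderiv_sum) (simp_all add: dderiv_linear_comp[OF bounded_linear_inner_left]
        differentiable_linear_comp[OF bounded_linear_inner_left])
  finally show ?thesis
    using trace_commute[OF bilinearD(1)[OF conn_bil[OF x]] A_linear[OF x], of Y]
    by (simp add: inner_add_left inner_diff_left sum.distrib sum_subtractf)
qed

text \<open>The formula \<open>\<Gamma>\<^sup>k\<^sub>k\<^sub>j = \<partial>\<^sub>j log \<surd>(det g)\<close>: the other two terms of the Koszul formula cancel in the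
  trace.\<close>

lemma trace_conn:
  assumes x: "x \<in> W"
  shows "(\<Sum>k\<in>Basis. conn x k Z \<bullet> k) = (\<Sum>k\<in>Basis. dderiv (Z, 0) (\<lambda>y. \<gamma> y k (dual_vec (\<gamma> x) k)) x) / 2"
proof -
  define B where "B X Y = dderiv (X, 0) (\<lambda>y. \<gamma> y Z Y) x" for X Y
  have "linear (\<lambda>X. B X Y)" for Y
    unfolding B_def
    by (rule linear_fieldD(1)[OF linear_field_precompose[OF
          linear_field_direction[OF openS Gsmooth] bounded_linear_embeddings(1)] x])
  moreover have "linear (B X)" for X
    unfolding B_def[abs_def]
    by (rule linear_fieldD(1)[OF linear_field_dderiv[OF bilinear_field_slots(1)[OF field]] x])
  ultimately have "bilinear B" by (simp add: bilinear_def)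
  from inner_form.metric_trace_swap[OF inner_form[OF x] this]
  have swap: "(\<Sum>k\<in>Basis. B k (dual_vec (\<gamma> x) k)) = (\<Sum>k\<in>Basis. B (dual_vec (\<gamma> x) k) k)"
    by (simp add: metric_trace_def)
  have sym: "dderiv (X, 0) (\<lambda>y. \<gamma> y k Z) x = B X k" for X k
    unfolding B_def by (rule dderiv_cong_open[OF openS x]) (rule Gsym)
  show ?thesis
    unfolding inner_form.trace_eq_metric_trace[OF inner_form[OF x]] conn_koszul[OF x]
    using swap by (simp add: sym B_def[symmetric] sum_divide_distrib[symmetric] sum.distrib sum_subtractf)
qed

text \<open>By the flow equation \<open>\<partial>\<^sub>t log \<surd>(det g) = R\<close>, and the left hand side is
  \<open>\<partial>\<^sub>t \<partial>\<^sub>Z log \<surd>(det g)\<close>.\<close>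

lemma trace_dt_conn:
  assumes x: "x \<in> W"
  shows "(\<Sum>k\<in>Basis. dderiv (0, 1) (\<lambda>y. conn y k Z) x \<bullet> k) = dderiv (Z, 0) R x"
proof -
  define L where "L v y = (\<Sum>k\<in>Basis. dderiv v (\<lambda>z. \<gamma> z k (dual_vec (\<gamma> y) k)) y)" for v y
  have Lsm: "smooth_on (L v) W" for v
    unfolding L_def[abs_def]
    by (intro smooth_on_sum openS
        linear_field_apply(1)[OF linear_field_dderiv[OF bilinear_field_slots(1)[OF field]] smooth_dual])
  have half: "dderiv v (\<lambda>y. L w y / 2) x = dderiv v (L w) x / 2" for v w
    by (rule dderiv_linear_comp[OF bounded_linear_divide smooth_on_differentiable[OF Lsm x]])
  have R: "R y = L (0, 1) y / 2" if "y \<in> W" for y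
    by (simp add: L_def flow'[OF that] R_eq metric_trace_def Rc_sym[OF that, of _ "dual_vec _ _"]
        sum_distrib_left[symmetric])
  have "(\<Sum>k\<in>Basis. dderiv (0, 1) (\<lambda>y. conn y k Z) x \<bullet> k) = dderiv (0, 1) (\<lambda>y. \<Sum>k\<in>Basis. conn y k Z \<bullet> k) x"
    using smooth_on_differentiable[OF conn_smooth x]
    by (subst dderiv_sum) (simp_all add: dderiv_linear_comp[OF bounded_linear_inner_left]
        differentiable_linear_comp[OF bounded_linear_inner_left])
  also have "\<dots> = dderiv (0, 1) (\<lambda>y. L (Z, 0) y / 2) x"
    by (rule dderiv_cong_open[OF openS x]) (simp only: trace_conn L_def)
  also have "\<dots> = dderiv (Z, 0) (\<lambda>y. L (0, 1) y / 2) x"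
    unfolding half using log_det_closed[OF x, of "(0, 1)" "(Z, 0)"] by (simp add: L_def[abs_def])
  also have "\<dots> = dderiv (Z, 0) R x"
    by (rule dderiv_cong_open[OF openS x]) (rule R[symmetric])
  finally show ?thesis .
qed

text \<open>The Laplacian of \<open>R\<close>, written as a divergence and as the trace of the Hessian.\<close>

lemma divergence_grad:
  assumes x: "x \<in> W"
  shows "(\<Sum>k\<in>Basis. (dderiv (k, 0) grad x + conn x k (grad x)) \<bullet> k) =
    metric_trace (\<gamma> x) (\<lambda>X Y. dderiv (X, 0) (\<lambda>y. dderiv (Y, 0) R y) x - dderiv (conn x X Y, 0) R x)"
proof -
  define T where "T X Y = dderiv (X, 0) (\<lambda>y. dderiv (Y, 0) R y) x - dderiv (conn x X Y, 0) R x" for X Y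
  have form: "\<gamma> x (dderiv (X, 0) grad x + conn x X (grad x)) Y = T X Y" for X Y
  proof -
    have "dderiv (X, 0) (\<lambda>y. dderiv (Y, 0) R y) x = dderiv (X, 0) (\<lambda>y. \<gamma> y (grad y) Y) x"
      by (rule dderiv_cong_open[OF openS x]) (rule grad_form[symmetric])
    also have "\<dots> = \<gamma> x (conn x X (grad x)) Y + \<gamma> x (grad x) (conn x X Y) + \<gamma> x (dderiv (X, 0) grad x) Y"
      by (simp only: linear_field_apply(2)[OF bilinear_field_slots(2)[OF field] grad_smooth x] conn_compatible[OF x])
    finally show ?thesis by (simp add: T_def bilinear_simps[OF Gbil[OF x]] grad_form[OF x])
  qed
  have dRsm: "smooth_on (\<lambda>y. dderiv (Y, 0) R y) W" for Y
    by (rule smooth_on_dderiv[OF R_smooth])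
  have "linear (\<lambda>X. dderiv (X, 0) (\<lambda>y. dderiv (Y, 0) R y) x)" for Y
    by (rule linear_fieldD(1)[OF linear_field_precompose[OF
          linear_field_direction[OF openS dRsm] bounded_linear_embeddings(1)] x])
  moreover have "linear (\<lambda>Y. dderiv (X, 0) (\<lambda>y. dderiv (Y, 0) R y) x)" for X
    by (rule linear_fieldD(1)[OF linear_field_dderiv[OF linear_dR] x])
  moreover have "linear (\<lambda>X. dderiv (conn x X Y, 0) R x)" "linear (\<lambda>Y. dderiv (conn x X Y, 0) R x)" for X Y
    using linear_compose[OF bilinearD(2)[OF conn_bil[OF x]] linear_fieldD(1)[OF linear_dR x]]
      linear_compose[OF bilinearD(1)[OF conn_bil[OF x]] linear_fieldD(1)[OF linear_dR x]]
    by (simp_all add: o_def)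
  ultimately have bil: "bilinear T"
    unfolding bilinear_def T_def by (intro conjI allI linear_compose_sub)
  have "(\<Sum>k\<in>Basis. (dderiv (k, 0) grad x + conn x k (grad x)) \<bullet> k) = metric_trace (\<gamma> x) (\<lambda>X Y. T Y X)"
    unfolding inner_form.trace_eq_metric_trace[OF inner_form[OF x]] form metric_trace_def ..
  also have "\<dots> = metric_trace (\<gamma> x) T"
    by (rule inner_form.metric_trace_swap[OF inner_form[OF x] bil])
  finally show ?thesis by (simp add: T_def[abs_def])
qed

lemma trace_A_squared:
  assumes x: "x \<in> W"
  shows "(\<Sum>k\<in>Basis. A x (A x k) \<bullet> k) = metric_trace (\<gamma> x) (\<lambda>X Y. Rc x Y (A x X))"
proof -
  have "(\<Sum>k\<in>Basis. A x (A x k) \<bullet> k) = metric_trace (\<gamma> x) (\<lambda>X Y. Rc x (A x Y) X)"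
    unfolding inner_form.trace_eq_metric_trace[OF inner_form[OF x]] A_form[OF x] metric_trace_def ..
  also have "\<dots> = metric_trace (\<gamma> x) (\<lambda>X Y. Rc x (A x X) Y)"
    by (rule inner_form.metric_trace_swap[OF inner_form[OF x]])
      (use linear_compose[OF A_linear[OF x] bilinearD(2)[OF Rc_bil[OF x]]] bilinearD(1)[OF Rc_bil[OF x]]
        in \<open>auto simp: bilinear_def o_def\<close>)
  also have "\<dots> = metric_trace (\<gamma> x) (\<lambda>X Y. Rc x Y (A x X))"
    using Rc_sym[OF x] by (simp add: metric_trace_def)
  finally show ?thesis .
qed

end

section \<open>The space-time metric in a coordinate domain\<close>

lemma sum_Basis_time:
  fixes f :: "'a::euclidean_space \<times> real \<Rightarrow> 'c::comm_monoid_add"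
  shows "sum f Basis = (\<Sum>k\<in>Basis. f (k, 0)) + f (0, 1)"
proof -
  have "sum f Basis = sum f ((\<lambda>u. (u, 0)) ` Basis) + sum f ((\<lambda>v. (0, v)) ` Basis)"
    unfolding Basis_prod_def by (rule sum.union_disjoint) auto
  then show ?thesis by (simp add: sum.reindex inj_on_def)
qed

locale soliton_chart = flow_chart U I \<gamma>
  for U :: "'e::euclidean_space set" and I and \<gamma> +
  fixes N0 :: nat
  assumes time_positive: "x \<in> U \<times> I \<Longrightarrow> 0 < real N0 + R x"
begin

sublocale large_parameter W R N0
  by unfold_locales (use openS R_smooth time_positive in auto)

definition "st_metric N x p q = \<gamma> x (fst p) (fst q) + (real N + R x) * snd p * snd q"

lemma smooth_time_weight: "smooth_on (\<lambda>x. (real N + R x) * r) W"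
  by (intro smooth_on_linear_comp[OF bounded_linear_mult_left] smooth_on_add smooth_on_const R_smooth openS)

lemma st_metric_chart:
  assumes N: "N \<ge> N0" shows "metric_chart W (st_metric N)"
proof unfold_locales
  show "bilinear_field W (st_metric N)"
    unfolding bilinear_field_def
  proof (intro conjI ballI allI)
    show "bilinear (st_metric N x)" if "x \<in> W" for x
      unfolding bilinear_def st_metric_def
      by (auto intro!: linearI simp: bilinear_simps[OF Gbil[OF that]] algebra_simps)
    show "smooth_on (\<lambda>x. st_metric N x p q) W" for p q
      unfolding st_metric_def mult.assoc
      by (intro smooth_on_add Gsmooth smooth_time_weight openS)
  qed (rule openS)
  show "st_metric N x u v = st_metric N x v u" if "x \<in> W" for x u v
    by (simp add: st_metric_def Gsym[OF that, of "fst u"])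
  show "0 < st_metric N x u u" if "x \<in> W" "u \<noteq> 0" for x u
  proof (cases "fst u = 0")
    case True
    then have "snd u \<noteq> 0" using that(2) by (simp add: prod_eq_iff)
    then have "0 < snd u * snd u" by (simp add: zero_less_mult_iff linorder_neq_iff[symmetric])
    then show ?thesis
      using True N_pos[OF N that(1)]
      by (simp add: st_metric_def bilinear_simps[OF Gbil[OF that(1)]] mult.assoc)
  next
    case False
    have "0 \<le> (real N + R x) * (snd u * snd u)"
      by (rule mult_nonneg_nonneg[OF less_imp_le[OF N_pos[OF N that(1)]] zero_le_square])
    then show ?thesis using Gpos[OF that(1) False] by (simp add: st_metric_def mult.assoc)
  qed
qed

text \<open>The space component of the space-time connection.\<close>

definition "C x p q = conn x (fst p) (fst q) + snd p *\<^sub>R A x (fst q) + snd q *\<^sub>R A x (fst p)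
  - (snd p * snd q / 2) *\<^sub>R grad x"

text \<open>The time component of the space-time connection, multiplied by \<open>N + R\<close>. As \<open>N \<rightarrow> \<infinity>\<close> it is the limit of
  the Hessian of \<open>- N \<tau>\<close>.\<close>

definition "E x p q = snd p / 2 * dderiv (fst q, 0) R x + snd q / 2 * dderiv (fst p, 0) R x
  + snd p * snd q / 2 * dderiv (0, 1) R x - Rc x (fst p) (fst q)"

definition "limit_conn x p q = (C x p q, 0 :: real)"

lemma C_smooth: "smooth_on (\<lambda>x. C x p q) W"
  unfolding C_def
  by (intro smooth_on_add smooth_on_diff smooth_on_scaleR conn_smooth A_smooth grad_smooth
      smooth_on_const openS)

lemma E_smooth: "smooth_on (\<lambda>x. E x p q) W"
  unfolding E_def
  by (intro smooth_on_add smooth_on_diff smooth_on_mult Rc_smooth smooth_on_dderiv R_smooth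
      smooth_on_const openS)

lemma limit_conn_field: "bilinear_field W limit_conn"
proof -
  have fixed: "linear_field W (\<lambda>x p. C x p q)" "linear_field W (\<lambda>x p. C x q p)" for q
    unfolding C_def
    using linear_field_precompose[OF bilinear_field_slots(2)[OF conn_field] bounded_linear_fst]
      linear_field_precompose[OF bilinear_field_slots(1)[OF conn_field] bounded_linear_fst]
      linear_field_precompose[OF A_field bounded_linear_fst] A_smooth grad_smooth conn_smooth openS
    by (auto simp: linear_field_def linear_iff algebra_simps scaleR_left_distrib add_divide_distrib
        intro!: smooth_on_add smooth_on_diff smooth_on_scaleR smooth_on_const)
  show ?thesis
    unfolding limit_conn_def[abs_def]
    by (rule bilinear_fieldI) (rule linear_field_bounded_linear[OF bounded_linear_embeddings(1) fixed(2)],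
      rule linear_field_bounded_linear[OF bounded_linear_embeddings(1) fixed(1)])
qed

lemma dderiv_st_metric:
  assumes x: "x \<in> W"
  shows "dderiv p (\<lambda>y. st_metric N y q r) x = dderiv (fst p, 0) (\<lambda>y. \<gamma> y (fst q) (fst r)) x
    + 2 * snd p * Rc x (fst q) (fst r)
    + (dderiv (fst p, 0) R x + snd p * dderiv (0, 1) R x) * snd q * snd r"
proof -
  have dR: "R differentiable at x" by (rule smooth_on_differentiable[OF R_smooth x])
  have "dderiv p (\<lambda>y. st_metric N y q r) x
      = dderiv p (\<lambda>y. \<gamma> y (fst q) (fst r)) x + dderiv p (\<lambda>y. (real N + R y) * (snd q * snd r)) x"
    unfolding st_metric_def mult.assoc
    by (rule dderiv_add[OF Gdiff[OF x] smooth_on_differentiable[OF smooth_time_weight x]])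
  also have "dderiv p (\<lambda>y. (real N + R y) * (snd q * snd r)) x = dderiv p R x * (snd q * snd r)"
    using dR by (simp add: dderiv_linear_comp[OF bounded_linear_mult_left] dderiv_add)
  also have "dderiv p R x = dderiv (fst p, 0) R x + snd p * dderiv (0, 1) R x"
    using dderiv_product_direction[OF dR, of p] by simp
  also have "dderiv p (\<lambda>y. \<gamma> y (fst q) (fst r)) x
      = dderiv (fst p, 0) (\<lambda>y. \<gamma> y (fst q) (fst r)) x + snd p * (2 * Rc x (fst q) (fst r))"
    using dderiv_product_direction[OF Gdiff[OF x], of p] by (simp add: flow'[OF x])
  finally show ?thesis by simp
qed

text \<open>By the flow equation the time derivative of the metric is twice the Ricci tensor. The parameter
  \<open>N\<close> enters through the inverse of the metric in the time direction alone.\<close>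

lemma levi_civita_st_metric:
  assumes N: "N \<ge> N0" and x: "x \<in> W"
  shows "levi_civita (st_metric N) x p q = (C x p q, inverse (real N + R x) * E x p q)"
proof (rule metric_chart.levi_civita_unique[OF st_metric_chart[OF N] x])
  fix z :: "'e \<times> real"
  have nz: "real N + R x \<noteq> 0" using N_pos[OF N x] by simp
  have weight: "(real N + R x) * (inverse (real N + R x) * E x p q) * snd z = E x p q * snd z"
    using nz by simp
  have space: "\<gamma> x (C x p q) Z = (dderiv (fst p, 0) (\<lambda>x. \<gamma> x (fst q) Z) x
      + dderiv (fst q, 0) (\<lambda>x. \<gamma> x (fst p) Z) x - dderiv (Z, 0) (\<lambda>x. \<gamma> x (fst p) (fst q)) x) / 2
      + snd p * Rc x (fst q) Z + snd q * Rc x (fst p) Z - snd p * snd q / 2 * dderiv (Z, 0) R x" for Z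
    unfolding C_def
    by (simp add: bilinear_simps[OF Gbil[OF x]] conn_koszul[OF x] A_form[OF x] grad_form[OF x])
  have lhs: "st_metric N x (C x p q, inverse (real N + R x) * E x p q) z
      = \<gamma> x (C x p q) (fst z) + E x p q * snd z"
    by (simp only: st_metric_def fst_conv snd_conv weight)
  show "st_metric N x (C x p q, inverse (real N + R x) * E x p q) z = koszul (st_metric N) x p q z"
    unfolding lhs unfolding koszul_def dderiv_st_metric[OF x] space E_def by (simp add: field_simps)
qed

lemma conn_expands: "expands (\<lambda>N x. levi_civita (st_metric N) x p q) (\<lambda>x. limit_conn x p q)"
proof -
  have 1: "expands (\<lambda>N x. limit_conn x p q) (\<lambda>x. limit_conn x p q)"
    by (rule expands_const[OF bilinear_fieldD(2)[OF limit_conn_field]])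
  have 2: "expands (\<lambda>N x. (0 :: 'e, E x p q)) (\<lambda>x. (0, E x p q))"
    by (rule expands_const) (intro smooth_on_Pair openS smooth_on_const E_smooth)
  show ?thesis
    by (rule expands_cong[OF expands_add[OF 1 expands_scaleR[OF expands_inverse 2]]])
      (simp_all add: levi_civita_st_metric limit_conn_def)
qed

lemma conn_apply_expands:
  assumes "expands V V0"
  shows "expands (\<lambda>N x. levi_civita (st_metric N) x p (V N x)) (\<lambda>x. limit_conn x p (V0 x))"
    "expands (\<lambda>N x. levi_civita (st_metric N) x (V N x) p) (\<lambda>x. limit_conn x (V0 x) p)"
  by (rule expands_linear_field[OF bilinear_field_slots(1)[OF metric_chart.levi_civita_field[OF st_metric_chart]]
        bilinear_field_slots(1)[OF limit_conn_field] conn_expands assms], assumption)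
    (rule expands_linear_field[OF bilinear_field_slots(2)[OF metric_chart.levi_civita_field[OF st_metric_chart]]
        bilinear_field_slots(2)[OF limit_conn_field] conn_expands assms], assumption)

lemma curvature_expands:
  "expands (\<lambda>N x. connection_curvature (levi_civita (st_metric N)) x p q r)
    (\<lambda>x. connection_curvature limit_conn x p q r)"
  unfolding connection_curvature_def
  by (intro expands_diff[OF expands_add[OF expands_diff]] expands_dderiv[OF conn_expands]
      conn_apply_expands(1)[OF conn_expands])

definition "limit_ricci x p q = (\<Sum>i\<in>Basis. connection_curvature limit_conn x i p q \<bullet> i)"

lemma ricci_expands: "expands (\<lambda>N x. ricci_form (st_metric N) x p q) (\<lambda>x. limit_ricci x p q)"
  unfolding ricci_form_def limit_ricci_def
  by (intro expands_sum expands_linear[OF bounded_linear_inner_left] curvature_expands)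

lemma limit_ricci_field: "bilinear_field W limit_ricci"
  using connection_chart.connection_ricci_field[OF connection_chart.intro[OF limit_conn_field]]
  unfolding limit_ricci_def[abs_def] .

text \<open>The limit connection has no time component, so that only the space directions contribute to
  the trace.\<close>

lemma limit_ricci_eq:
  assumes x: "x \<in> W"
  shows "limit_ricci x p q = (\<Sum>k\<in>Basis. (dderiv (k, 0) (\<lambda>y. C y p q) x - dderiv p (\<lambda>y. C y (k, 0) q) x
    + C x (k, 0) (C x p q, 0) - C x p (C x (k, 0) q, 0)) \<bullet> k)"
proof -
  have "dderiv r (\<lambda>y. (C y p q, 0 :: real)) x = (dderiv r (\<lambda>y. C y p q) x, 0)" for r p q
    using dderiv_linear_comp[OF bounded_linear_embeddings(1) smooth_on_differentiable[OF C_smooth x]] .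
  then show ?thesis
    unfolding limit_ricci_def connection_curvature_def limit_conn_def
    by (simp add: sum_Basis_time inner_Pair)
qed

lemma C_simps:
  assumes "x \<in> W"
  shows "C x (X, 0) (Y, 0) = conn x X Y" "C x (0, 1) (Y, 0) = A x Y" "C x (X, 0) (0, 1) = A x X"
    "C x (0, 1) (0, 1) = - ((1/2) *\<^sub>R grad x)"
  by (simp_all add: C_def bilinear_simps[OF conn_bil[OF assms]] linear_0[OF A_linear[OF assms]])

lemma dderiv_C:
  assumes x: "x \<in> W"
  shows "dderiv v (\<lambda>y. C y (X, 0) (Y, 0)) x = dderiv v (\<lambda>y. conn y X Y) x"
    "dderiv v (\<lambda>y. C y (0, 1) (Y, 0)) x = dderiv v (\<lambda>y. A y Y) x"
    "dderiv v (\<lambda>y. C y (X, 0) (0, 1)) x = dderiv v (\<lambda>y. A y X) x"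
    "dderiv v (\<lambda>y. C y (0, 1) (0, 1)) x = - ((1/2) *\<^sub>R dderiv v grad x)"
proof -
  have "dderiv v (\<lambda>y. - ((1/2) *\<^sub>R grad y)) x = - ((1/2) *\<^sub>R dderiv v grad x)"
    by (rule dderiv_linear_comp[OF bounded_linear_minus[OF bounded_linear_scaleR_right]
          smooth_on_differentiable[OF grad_smooth x]])
  moreover have "dderiv v (\<lambda>y. C y (0, 1) (0, 1)) x = dderiv v (\<lambda>y. - ((1/2) *\<^sub>R grad y)) x"
    by (rule dderiv_cong_open[OF openS x]) (rule C_simps(4))
  ultimately show "dderiv v (\<lambda>y. C y (0, 1) (0, 1)) x = - ((1/2) *\<^sub>R dderiv v grad x)"
    by (rule trans[rotated])
qed (rule dderiv_cong_open[OF openS x C_simps(1)] dderiv_cong_open[OF openS x C_simps(2)]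
    dderiv_cong_open[OF openS x C_simps(3)], assumption)+

lemma limit_ricci_space_space:
  assumes x: "x \<in> W" shows "limit_ricci x (Y, 0) (Z, 0) = Rc x Y Z"
  by (simp add: limit_ricci_eq[OF x] dderiv_C[OF x] C_simps[OF x] Rc_eq[OF x])

text \<open>The divergence of the Ricci endomorphism contributes one half of \<open>\<partial>\<^sub>Y R\<close> by the Bianchi identity
  and the derivative of its trace the whole with the opposite sign.\<close>

lemma limit_ricci_space_time:
  assumes x: "x \<in> W" shows "limit_ricci x (Y, 0) (0, 1) = - dderiv (Y, 0) R x / 2"
proof -
  have "limit_ricci x (Y, 0) (0, 1) =
      (\<Sum>k\<in>Basis. (dderiv (k, 0) (\<lambda>y. A y Y) x + conn x k (A x Y) - A x (conn x k Y)) \<bullet> k)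
      - (\<Sum>k\<in>Basis. (dderiv (Y, 0) (\<lambda>y. A y k) x + conn x Y (A x k) - A x (conn x Y k)) \<bullet> k)"
    unfolding sum_subtractf[symmetric] limit_ricci_eq[OF x] dderiv_C[OF x] C_simps[OF x]
    by (intro sum.cong refl) (simp add: conn_sym[OF x, of Y] inner_add_left inner_diff_left)
  then show ?thesis by (simp add: divergence_A[OF x] trace_nabla_A[OF x])
qed

text \<open>As for the opposite order of the arguments, except that the negative term is now the time
  derivative of \<open>\<Gamma>\<^sup>k\<^sub>k\<^sub>Z\<close>.\<close>

lemma limit_ricci_time_space:
  assumes x: "x \<in> W" shows "limit_ricci x (0, 1) (Z, 0) = - dderiv (Z, 0) R x / 2"
proof -
  have "limit_ricci x (0, 1) (Z, 0) =
      (\<Sum>k\<in>Basis. (dderiv (k, 0) (\<lambda>y. A y Z) x + conn x k (A x Z) - A x (conn x k Z)) \<bullet> k)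
      - (\<Sum>k\<in>Basis. dderiv (0, 1) (\<lambda>y. conn y k Z) x \<bullet> k)"
    unfolding sum_subtractf[symmetric] limit_ricci_eq[OF x] dderiv_C[OF x] C_simps[OF x]
    by (intro sum.cong refl) (simp add: inner_add_left inner_diff_left)
  then show ?thesis by (simp add: divergence_A[OF x] trace_dt_conn[OF x])
qed

text \<open>In the inverse of the space-time metric the time direction carries the weight \<open>1 / (N + R)\<close>; its
  contribution to a trace disappears in the limit.\<close>

lemma metric_trace_st_metric:
  assumes N: "N \<ge> N0" and x: "x \<in> W" and T: "bilinear T"
  shows "metric_trace (st_metric N x) T =
    (\<Sum>k\<in>Basis. \<Sum>l\<in>Basis. (dual_vec (\<gamma> x) k \<bullet> l) * T (l, 0) (k, 0))
    + inverse (real N + R x) * T (0, 1) (0, 1)"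
proof -
  interpret i: inner_form "\<gamma> x" by (rule inner_form[OF x])
  interpret s: inner_form "st_metric N x"
    by (rule metric_field.inner_form[OF metric_chart.axioms(1)[OF st_metric_chart[OF N]] x])
  have nz: "real N + R x \<noteq> 0" using N_pos[OF N x] by simp
  have space: "dual_vec (st_metric N x) (k, 0) = (dual_vec (\<gamma> x) k, 0)" for k
    by (rule s.nondegenerate, subst s.dual') (simp add: st_metric_def i.dual' inner_prod_def)
  have time: "dual_vec (st_metric N x) (0, 1) = (0, inverse (real N + R x))"
    by (rule s.nondegenerate, subst s.dual')
      (simp add: st_metric_def bilinear_simps[OF i.bil] inner_prod_def nz)
  have "T (dual_vec (\<gamma> x) k, 0) (k, 0) = (\<Sum>l\<in>Basis. (dual_vec (\<gamma> x) k \<bullet> l) * T (l, 0) (k, 0))" for k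
    using linear_expand[OF linear_compose[OF bounded_linear.linear[OF bounded_linear_embeddings(1)]
        bilinearD(2)[OF T, of "(k, 0)"]], where u = "dual_vec (\<gamma> x) k"]
    unfolding o_def real_scaleR_def .
  moreover have "T (0, inverse (real N + R x)) (0, 1) = inverse (real N + R x) * T (0, 1) (0, 1)"
    using bilinear_lmul[OF T, of "inverse (real N + R x)" "(0, 1)" "(0, 1)"] by simp
  ultimately show ?thesis
    unfolding metric_trace_def by (simp add: sum_Basis_time space time)
qed

text \<open>The limit of \<open>\<nabla>\<^sub>u Ric(v, \<partial>\<^sub>\<tau>)\<close> for the space-time metrics.\<close>

definition "limit_nabla x u v = dderiv u (\<lambda>y. limit_ricci y v (0, 1)) x
  - limit_ricci x (limit_conn x u v) (0, 1) - limit_ricci x v (limit_conn x u (0, 1))"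

lemma nabla_expands:
  "expands (\<lambda>N x. cov_deriv (st_metric N) (ricci_form (st_metric N)) x u v (0, 1))
    (\<lambda>x. limit_nabla x u v)"
  unfolding cov_deriv_def limit_nabla_def
  by (intro expands_diff expands_dderiv[OF ricci_expands])
    ((rule expands_linear_field[OF bilinear_field_slots(2)[OF metric_chart.ricci_field[OF st_metric_chart]]
        bilinear_field_slots(2)[OF limit_ricci_field] ricci_expands conn_expands], assumption),
      (rule expands_linear_field[OF bilinear_field_slots(1)[OF metric_chart.ricci_field[OF st_metric_chart]]
        bilinear_field_slots(1)[OF limit_ricci_field] ricci_expands conn_expands], assumption))

lemma nabla_bilinear:
  assumes N: "N \<ge> N0" and x: "x \<in> W"
  shows "bilinear (\<lambda>u v. cov_deriv (st_metric N) (ricci_form (st_metric N)) x u v z)"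
proof -
  interpret m: metric_chart W "st_metric N" by (rule st_metric_chart[OF N])
  note lc = bilinear_fieldD(1)[OF m.levi_civita_field x]
  have "linear (\<lambda>v. dderiv u (\<lambda>y. ricci_form (st_metric N) y v z) x)" for u
    by (rule linear_fieldD(1)[OF linear_field_dderiv[OF bilinear_field_slots(2)[OF m.ricci_field]] x])
  moreover have "linear (\<lambda>u. dderiv u (\<lambda>y. ricci_form (st_metric N) y v z) x)" for v
    by (rule linear_dderiv[OF smooth_on_differentiable[OF m.ricci_smooth x]])
  moreover note linear_compose[OF bilinearD(1)[OF lc] bilinearD(2)[OF m.ricci_bil[OF x]]]
    linear_compose[OF bilinearD(2)[OF lc] bilinearD(2)[OF m.ricci_bil[OF x]]]
    linear_compose[OF bilinearD(2)[OF lc] bilinearD(1)[OF m.ricci_bil[OF x]]]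
  ultimately show ?thesis
    unfolding bilinear_def cov_deriv_def o_def
    by (intro conjI allI linear_compose_sub bilinearD(2)[OF m.ricci_bil[OF x]])
qed

text \<open>The \<open>N \<rightarrow> \<infinity>\<close> limit of the time component of the contracted Bianchi identity of the
  space-time metric is the evolution equation of the scalar curvature.\<close>

lemma limit_bianchi:
  assumes x: "x \<in> W"
  shows "2 * metric_trace (\<gamma> x) (\<lambda>X Y. limit_nabla x (X, 0) (Y, 0)) = dderiv (0, 1) R x"
proof -
  have dual: "expands (\<lambda>N x. dual_vec (\<gamma> x) k \<bullet> l) (\<lambda>x. dual_vec (\<gamma> x) k \<bullet> l)" for k l
    by (rule expands_const) (intro smooth_on_inner_left smooth_dual openS)
  have scal: "expands (\<lambda>N. scalar_curv (st_metric N)) R"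
  proof (rule expands_cong)
    show "expands (\<lambda>N x. (\<Sum>k\<in>Basis. \<Sum>l\<in>Basis. (dual_vec (\<gamma> x) k \<bullet> l) * ricci_form (st_metric N) x (l, 0) (k, 0))
        + inverse (real N + R x) * ricci_form (st_metric N) x (0, 1) (0, 1))
      (\<lambda>x. (\<Sum>k\<in>Basis. \<Sum>l\<in>Basis. (dual_vec (\<gamma> x) k \<bullet> l) * limit_ricci x (l, 0) (k, 0))
        + 0 * limit_ricci x (0, 1) (0, 1))"
      by (intro expands_add expands_sum expands_mult[OF dual ricci_expands]
          expands_mult[OF expands_inverse ricci_expands])
    show "(\<Sum>k\<in>Basis. \<Sum>l\<in>Basis. (dual_vec (\<gamma> x) k \<bullet> l) * ricci_form (st_metric N) x (l, 0) (k, 0))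
        + inverse (real N + R x) * ricci_form (st_metric N) x (0, 1) (0, 1) = scalar_curv (st_metric N) x"
      if "N \<ge> N0" "x \<in> W" for N x
      unfolding scalar_curv_def
      by (rule metric_trace_st_metric[OF that
            bilinear_fieldD(1)[OF metric_chart.ricci_field[OF st_metric_chart[OF that(1)]] that(2)], symmetric])
    show "(\<Sum>k\<in>Basis. \<Sum>l\<in>Basis. (dual_vec (\<gamma> x) k \<bullet> l) * limit_ricci x (l, 0) (k, 0))
        + 0 * limit_ricci x (0, 1) (0, 1) = R x" if "x \<in> W" for x
    proof -
      have "(\<Sum>l\<in>Basis. (u \<bullet> l) * Rc x l v) = Rc x u v" for u v
        using linear_expand[OF bilinearD(2)[OF Rc_bil[OF that]], where u = u, symmetric]
        unfolding real_scaleR_def .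
      then show ?thesis
        unfolding R_eq metric_trace_def limit_ricci_space_space[OF that] by simp
    qed
  qed
  have trace: "expands (\<lambda>N x. 2 * ((\<Sum>k\<in>Basis. \<Sum>l\<in>Basis. (dual_vec (\<gamma> x) k \<bullet> l) *
        cov_deriv (st_metric N) (ricci_form (st_metric N)) x (l, 0) (k, 0) (0, 1))
        + inverse (real N + R x) *
          cov_deriv (st_metric N) (ricci_form (st_metric N)) x (0, 1) (0, 1) (0, 1)))
      (\<lambda>x. 2 * ((\<Sum>k\<in>Basis. \<Sum>l\<in>Basis. (dual_vec (\<gamma> x) k \<bullet> l) * limit_nabla x (l, 0) (k, 0))
        + 0 * limit_nabla x (0, 1) (0, 1)))"
    by (intro expands_linear[OF bounded_linear_mult_right] expands_add expands_sum
        expands_mult[OF dual nabla_expands] expands_mult[OF expands_inverse nabla_expands])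
  have "2 * ((\<Sum>k\<in>Basis. \<Sum>l\<in>Basis. (dual_vec (\<gamma> x) k \<bullet> l) * limit_nabla x (l, 0) (k, 0))
        + 0 * limit_nabla x (0, 1) (0, 1)) = dderiv (0, 1) R x"
  proof (rule expands_unique[OF trace expands_dderiv[OF scal] _ x])
    fix N assume N: "N \<ge> N0"
    show "2 * ((\<Sum>k\<in>Basis. \<Sum>l\<in>Basis. (dual_vec (\<gamma> x) k \<bullet> l) *
        cov_deriv (st_metric N) (ricci_form (st_metric N)) x (l, 0) (k, 0) (0, 1))
        + inverse (real N + R x) *
          cov_deriv (st_metric N) (ricci_form (st_metric N)) x (0, 1) (0, 1) (0, 1))
      = dderiv (0, 1) (scalar_curv (st_metric N)) x"
      unfolding metric_trace_st_metric[OF N x nabla_bilinear[OF N x], symmetric]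
      by (rule metric_chart.contracted_bianchi[OF st_metric_chart[OF N] x])
  qed
  moreover have "(\<Sum>l\<in>Basis. (u \<bullet> l) * limit_nabla x (l, 0) v) = limit_nabla x (u, 0) v" for u v
  proof -
    note lc = bilinear_fieldD(1)[OF limit_conn_field x]
    note ric = bilinear_fieldD(1)[OF limit_ricci_field x]
    have "linear (\<lambda>u. dderiv u (\<lambda>y. limit_ricci y v (0, 1)) x)"
      by (rule linear_dderiv[OF smooth_on_differentiable[OF bilinear_fieldD(2)[OF limit_ricci_field] x]])
    with linear_compose[OF bilinearD(2)[OF lc] bilinearD(2)[OF ric]]
      linear_compose[OF bilinearD(2)[OF lc] bilinearD(1)[OF ric]]
    have "linear (\<lambda>u. limit_nabla x u v)"
      unfolding limit_nabla_def o_def by (intro linear_compose_sub)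
    from linear_expand[OF linear_compose[OF bounded_linear.linear[OF bounded_linear_embeddings(1)] this],
        where u = u]
    show ?thesis unfolding o_def real_scaleR_def by (rule sym)
  qed
  ultimately show ?thesis by (simp add: metric_trace_def)
qed

text \<open>With \<open>h = \<Delta>R\<close> and \<open>a = \<bar>Ric\<bar>\<^sup>2\<close> the limit curvature is \<open>- h / 2 - \<partial>\<^sub>\<tau> R - a\<close>, and the evolution equation
  of the scalar curvature is \<open>\<partial>\<^sub>\<tau> R = - h - 2 a\<close>.\<close>

lemma limit_ricci_time_time:
  assumes x: "x \<in> W" shows "limit_ricci x (0, 1) (0, 1) = - dderiv (0, 1) R x / 2"
proof -
  define H where "H X Y = dderiv (X, 0) (\<lambda>y. dderiv (Y, 0) R y) x - dderiv (conn x X Y, 0) R x" for X Y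
  have nabla: "limit_nabla x (X, 0) (Y, 0) = - (1/2) * H X Y - Rc x Y (A x X)" for X Y
  proof -
    have "dderiv (X, 0) (\<lambda>y. limit_ricci y (Y, 0) (0, 1)) x
        = dderiv (X, 0) (\<lambda>y. - (1/2) * dderiv (Y, 0) R y) x"
      by (rule dderiv_cong_open[OF openS x]) (simp add: limit_ricci_space_time)
    also have "\<dots> = - (1/2) * dderiv (X, 0) (\<lambda>y. dderiv (Y, 0) R y) x"
      by (rule dderiv_linear_comp[OF bounded_linear_mult_right
            smooth_on_differentiable[OF smooth_on_dderiv[OF R_smooth] x]])
    finally show ?thesis
      unfolding limit_nabla_def limit_conn_def C_simps[OF x] limit_ricci_space_time[OF x]
        limit_ricci_space_space[OF x] H_def by (simp add: algebra_simps)
  qed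
  define h where "h = metric_trace (\<gamma> x) H"
  define a where "a = metric_trace (\<gamma> x) (\<lambda>X Y. Rc x Y (A x X))"
  have "metric_trace (\<gamma> x) (\<lambda>X Y. limit_nabla x (X, 0) (Y, 0)) = - (1/2) * h - a"
    unfolding nabla h_def a_def metric_trace_def by (simp add: sum_subtractf sum_distrib_left)
  then have evolution: "- h - 2 * a = dderiv (0, 1) R x" using limit_bianchi[OF x] by simp
  have dA: "(\<Sum>k\<in>Basis. dderiv (0, 1) (\<lambda>y. A y k) x \<bullet> k) = dderiv (0, 1) R x"
  proof -
    have "dderiv (0, 1) R x = dderiv (0, 1) (\<lambda>y. \<Sum>k\<in>Basis. A y k \<bullet> k) x"
      by (rule dderiv_cong_open[OF openS x]) (rule trace_A[symmetric])
    then show ?thesis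
      using smooth_on_differentiable[OF A_smooth x]
      by (simp add: dderiv_sum dderiv_linear_comp[OF bounded_linear_inner_left]
        differentiable_linear_comp[OF bounded_linear_inner_left])
  qed
  have "limit_ricci x (0, 1) (0, 1) =
      - (1/2) * (\<Sum>k\<in>Basis. (dderiv (k, 0) grad x + conn x k (grad x)) \<bullet> k)
      - (\<Sum>k\<in>Basis. dderiv (0, 1) (\<lambda>y. A y k) x \<bullet> k) - (\<Sum>k\<in>Basis. A x (A x k) \<bullet> k)"
    unfolding sum_subtractf[symmetric] sum_distrib_left limit_ricci_eq[OF x] dderiv_C[OF x] C_simps[OF x]
    by (intro sum.cong refl)
      (simp add: inner_add_left inner_diff_left linear_neg[OF bilinearD(1)[OF conn_bil[OF x]]]
        bilinear_rmul[OF conn_bil[OF x]] algebra_simps)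
  also have "\<dots> = - (1/2) * h - dderiv (0, 1) R x - a"
    unfolding divergence_grad[OF x] trace_A_squared[OF x] dA h_def a_def H_def[abs_def] ..
  also have "\<dots> = - dderiv (0, 1) R x / 2" using evolution by simp
  finally show ?thesis .
qed

lemma limit_ricci_value:
  assumes x: "x \<in> W" shows "limit_ricci x p q = - E x p q"
proof -
  note ric = bilinear_fieldD(1)[OF limit_ricci_field x]
  have "limit_ricci x p q = limit_ricci x ((fst p, 0) + snd p *\<^sub>R (0, 1)) ((fst q, 0) + snd q *\<^sub>R (0, 1))"
    by simp
  also have "\<dots> = limit_ricci x (fst p, 0) (fst q, 0) + snd q * limit_ricci x (fst p, 0) (0, 1)
      + snd p * limit_ricci x (0, 1) (fst q, 0) + snd p * snd q * limit_ricci x (0, 1) (0, 1)"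
    by (simp only: bilinear_ladd[OF ric] bilinear_radd[OF ric] bilinear_lmul[OF ric] bilinear_rmul[OF ric]
        real_scaleR_def) (simp add: algebra_simps)
  also have "\<dots> = - E x p q"
    unfolding limit_ricci_space_space[OF x] limit_ricci_space_time[OF x] limit_ricci_time_space[OF x]
      limit_ricci_time_time[OF x] E_def by (simp add: field_simps)
  finally show ?thesis .
qed

text \<open>The Hessian of \<open>- N \<tau>\<close> is \<open>N\<close> times the time component of the connection, hence equal to
  \<open>N w E = E - R w E\<close> for \<open>w = 1 / (N + R)\<close>; it tends to \<open>E\<close>, the negative of the limit of the Ricci
  tensor.\<close>

theorem soliton_error_expands:
  "expands (\<lambda>N x. ricci_form (st_metric N) x p q + real N * snd (levi_civita (st_metric N) x p q)) (\<lambda>x. 0)"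
proof -
  have E: "expands (\<lambda>N x. E x p q) (\<lambda>x. E x p q)" by (rule expands_const[OF E_smooth])
  have R: "expands (\<lambda>N. R) R" by (rule expands_const[OF R_smooth])
  have "expands (\<lambda>N x. ricci_form (st_metric N) x p q
        + (E x p q - R x * (inverse (real N + R x) * E x p q)))
      (\<lambda>x. limit_ricci x p q + (E x p q - R x * (0 * E x p q)))"
    by (intro expands_add ricci_expands expands_diff E expands_mult[OF R expands_mult[OF expands_inverse E]])
  then show ?thesis
  proof (rule expands_cong)
    fix N x assume N: "N \<ge> N0" and x: "x \<in> W"
    have "real N * inverse (real N + R x) = 1 - R x * inverse (real N + R x)"
      using N_pos[OF N x] by (simp add: field_simps)
    then have "real N * (inverse (real N + R x) * E x p q) = E x p q - R x * (inverse (real N + R x) * E x p q)"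
      by (metis left_diff_distrib mult.assoc mult_1)
    then show "ricci_form (st_metric N) x p q + (E x p q - R x * (inverse (real N + R x) * E x p q))
        = ricci_form (st_metric N) x p q + real N * snd (levi_civita (st_metric N) x p q)"
      by (simp add: levi_civita_st_metric[OF N x])
  qed (simp add: limit_ricci_value)
qed

end

section \<open>Tensors on a manifold read in a chart\<close>

lemma bilinear_expand:
  assumes "bilinear (B :: 'e::euclidean_space \<Rightarrow> 'e \<Rightarrow> real)"
  shows "B u v = (\<Sum>i\<in>Basis. \<Sum>j\<in>Basis. (u \<bullet> i) * ((v \<bullet> j) * B i j))"
proof -
  have "B i v = (\<Sum>j\<in>Basis. (v \<bullet> j) * B i j)" for i
    using linear_expand[OF bilinearD(1)[OF assms], where u = v] by simp
  then show ?thesis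
    using linear_expand[OF bilinearD(2)[OF assms], where u = u and v1 = v]
    by (simp add: sum_distrib_left)
qed

lemma bilinear_fieldI_basis:
  fixes B :: "'x::real_normed_vector \<Rightarrow> 'e::euclidean_space \<Rightarrow> 'e \<Rightarrow> real"
  assumes "open S" "\<And>x. x \<in> S \<Longrightarrow> bilinear (B x)"
    and "\<And>i j. i \<in> Basis \<Longrightarrow> j \<in> Basis \<Longrightarrow> smooth_on (\<lambda>x. B x i j) S"
  shows "bilinear_field S B"
  unfolding bilinear_field_def
proof (intro conjI ballI allI)
  have "smooth_on (\<lambda>x. \<Sum>i\<in>Basis. \<Sum>j\<in>Basis. (u \<bullet> i) * ((v \<bullet> j) * B x i j)) S" for u v
    by (intro smooth_on_sum smooth_on_mult smooth_on_const assms(1,3))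
  then show "smooth_on (\<lambda>x. B x u v) S" for u v
    by (rule smooth_on_cong[OF assms(1)]) (rule bilinear_expand[OF assms(2), symmetric])
qed (use assms in auto)

lemma metric_chart_of_riemannian:
  assumes "riemannian_metric Y G" "\<alpha> \<in> charts Y" "open (chart_image Y \<alpha>)"
  shows "metric_chart (chart_image Y \<alpha>) (\<lambda>y. G \<alpha> (chart_inv Y \<alpha> y))"
proof unfold_locales
  have dom: "chart_inv Y \<alpha> y \<in> chart_dom Y \<alpha>" if "y \<in> chart_image Y \<alpha>" for y
    using that unfolding chart_inv_def by (rule inv_into_into)
  show "bilinear_field (chart_image Y \<alpha>) (\<lambda>y. G \<alpha> (chart_inv Y \<alpha> y))"
    by (rule bilinear_fieldI_basis[OF assms(3)])
      (use assms(1,2) dom in \<open>auto simp: riemannian_metric_def smooth_tensor2_def\<close>)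
  show "G \<alpha> (chart_inv Y \<alpha> x) u v = G \<alpha> (chart_inv Y \<alpha> x) v u" if "x \<in> chart_image Y \<alpha>" for x u v
    using assms(1,2) dom[OF that] by (simp add: riemannian_metric_def)
  show "0 < G \<alpha> (chart_inv Y \<alpha> x) u u" if "x \<in> chart_image Y \<alpha>" "u \<noteq> 0" for x u
    using assms(1,2) dom[OF that(1)] that(2) by (simp add: riemannian_metric_def positive_definite_def)
qed

text \<open>The metric \<open>G\<close> read in the chart \<open>\<alpha>\<close>. The coordinate expression \<open>Gc\<close> is prescribed on the chart image
  only, so that any convenient formula can be used for it.\<close>

locale chart_representation =
  fixes Y :: "('i, 'a, 'e::euclidean_space) charted_space" and G :: "('i, 'a, 'e) tensor2"
    and \<alpha> :: 'i and Gc :: "'e \<Rightarrow> 'e \<Rightarrow> 'e \<Rightarrow> real"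
  assumes inj: "inj_on (chart_map Y \<alpha>) (chart_dom Y \<alpha>)"
    and chart: "metric_chart (chart_image Y \<alpha>) Gc"
    and repr: "y \<in> chart_image Y \<alpha> \<Longrightarrow> G \<alpha> (chart_inv Y \<alpha> y) = Gc y"
begin

sublocale metric_chart "chart_image Y \<alpha>" Gc by (rule chart)

lemma inv_chart: "p \<in> chart_dom Y \<alpha> \<Longrightarrow> chart_inv Y \<alpha> (chart_map Y \<alpha> p) = p"
  unfolding chart_inv_def by (rule inv_into_f_f[OF inj])

lemma chart_inv: "y \<in> chart_image Y \<alpha> \<Longrightarrow> chart_map Y \<alpha> (chart_inv Y \<alpha> y) = y"
  "y \<in> chart_image Y \<alpha> \<Longrightarrow> chart_inv Y \<alpha> y \<in> chart_dom Y \<alpha>"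
  unfolding chart_inv_def by (auto intro: f_inv_into_f inv_into_into)

lemma repr_at: "p \<in> chart_dom Y \<alpha> \<Longrightarrow> G \<alpha> p = Gc (chart_map Y \<alpha> p)"
  using repr[of "chart_map Y \<alpha> p"] inv_chart by simp

lemma pderiv_chart_eq:
  assumes p: "p \<in> chart_dom Y \<alpha>" and "\<And>q. q \<in> chart_dom Y \<alpha> \<Longrightarrow> f q = F (chart_map Y \<alpha> q)"
  shows "pderiv_chart Y \<alpha> i f p = dderiv i F (chart_map Y \<alpha> p)"
proof -
  have "pderiv_chart Y \<alpha> i f p = dderiv i (\<lambda>y. f (chart_inv Y \<alpha> y)) (chart_map Y \<alpha> p)"
    by (simp add: pderiv_chart_def dderiv_def o_def)
  also have "\<dots> = dderiv i F (chart_map Y \<alpha> p)"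
    by (rule dderiv_cong_open[OF openS]) (use assms chart_inv in auto)
  finally show ?thesis .
qed

lemma inv_metric_eq: "inv_metric G \<alpha> p i j = dual_vec (G \<alpha> p) j \<bullet> i"
  by (simp add: inv_metric_def dual_vec_def)

lemma christoffel_eq:
  assumes p: "p \<in> chart_dom Y \<alpha>"
  shows "christoffel Y G \<alpha> p k i j = \<Gamma> (chart_map Y \<alpha> p) i j \<bullet> k"
proof -
  have "pderiv_chart Y \<alpha> i (\<lambda>q. G \<alpha> q u v) p = dderiv i (\<lambda>y. Gc y u v) (chart_map Y \<alpha> p)" for i u v
    by (rule pderiv_chart_eq[OF p]) (simp add: repr_at)
  then show ?thesis
    unfolding christoffel_def inv_metric_eq repr_at[OF p] levi_civita_def raise_def koszul_def
    by (simp add: inner_sum_left sum_distrib_left mult_ac)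
qed

lemma riemann_eq:
  assumes p: "p \<in> chart_dom Y \<alpha>"
  shows "riemann Y G \<alpha> p l k i j = connection_curvature \<Gamma> (chart_map Y \<alpha> p) i j k \<bullet> l"
proof -
  have mem: "chart_map Y \<alpha> p \<in> chart_image Y \<alpha>" using p by blast
  have d: "pderiv_chart Y \<alpha> i (\<lambda>q. christoffel Y G \<alpha> q l j k) p
      = dderiv i (\<lambda>y. \<Gamma> y j k) (chart_map Y \<alpha> p) \<bullet> l" for i j
  proof -
    have "pderiv_chart Y \<alpha> i (\<lambda>q. christoffel Y G \<alpha> q l j k) p
        = dderiv i (\<lambda>y. \<Gamma> y j k \<bullet> l) (chart_map Y \<alpha> p)"
      by (rule pderiv_chart_eq[OF p]) (rule christoffel_eq)
    also have "\<dots> = dderiv i (\<lambda>y. \<Gamma> y j k) (chart_map Y \<alpha> p) \<bullet> l"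
      by (rule dderiv_linear_comp[OF bounded_linear_inner_left
            smooth_on_differentiable[OF smooth_connection mem]])
    finally show ?thesis .
  qed
  have q: "(\<Sum>m\<in>Basis. christoffel Y G \<alpha> p l i m * christoffel Y G \<alpha> p m j k)
      = \<Gamma> (chart_map Y \<alpha> p) i (\<Gamma> (chart_map Y \<alpha> p) j k) \<bullet> l" for i j
  proof -
    have "\<Gamma> (chart_map Y \<alpha> p) i u \<bullet> l = (\<Sum>m\<in>Basis. (u \<bullet> m) * (\<Gamma> (chart_map Y \<alpha> p) i m \<bullet> l))" for u
      using arg_cong[OF linear_expand[OF bilinearD(1)[OF lc_bil[OF mem]], where u = u],
          of "\<lambda>w. w \<bullet> l"] unfolding inner_sum_left inner_scaleR_left .
    from this[of "\<Gamma> (chart_map Y \<alpha> p) j k"] show ?thesis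
      unfolding christoffel_eq[OF p] by (simp add: mult.commute)
  qed
  show ?thesis
    unfolding riemann_def d sum_subtractf q connection_curvature_def
    by (simp add: inner_add_left inner_diff_left)
qed

lemma ricci_eq: "p \<in> chart_dom Y \<alpha> \<Longrightarrow> ricci Y G \<alpha> p = ricci_form Gc (chart_map Y \<alpha> p)"
  by (simp add: fun_eq_iff ricci_def ricci_form_def riemann_eq)

lemma scalar_curvature_eq:
  assumes p: "p \<in> chart_dom Y \<alpha>"
  shows "scalar_curvature Y G \<alpha> p = scalar_curv Gc (chart_map Y \<alpha> p)"
proof -
  have mem: "chart_map Y \<alpha> p \<in> chart_image Y \<alpha>" using p by blast
  have "ricci_form Gc (chart_map Y \<alpha> p) u j = (\<Sum>i\<in>Basis. (u \<bullet> i) * ricci_form Gc (chart_map Y \<alpha> p) i j)" for u j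
    using linear_expand[OF bilinearD(2)[OF ricci_bil[OF mem]], where u = u] unfolding real_scaleR_def .
  then have "scalar_curv Gc (chart_map Y \<alpha> p) = (\<Sum>j\<in>Basis. \<Sum>i\<in>Basis.
      (dual_vec (Gc (chart_map Y \<alpha> p)) j \<bullet> i) * ricci_form Gc (chart_map Y \<alpha> p) i j)"
    unfolding scalar_curv_def metric_trace_def by (intro sum.cong refl)
  then show ?thesis
    unfolding scalar_curvature_def ricci_eq[OF p] inv_metric_eq repr_at[OF p]
    by (subst sum.swap) simp
qed

end

text \<open>A linear function has no second coordinate derivatives, so that its Hessian consists of the
  Christoffel symbols of the time component alone.\<close>

lemma hessian_linear_time:
  fixes Y :: "('i, 'a, 'e::euclidean_space \<times> real) charted_space"
  assumes "chart_representation Y G \<alpha> Gc" and p: "p \<in> chart_dom Y \<alpha>"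
    and f: "\<And>q. q \<in> chart_dom Y \<alpha> \<Longrightarrow> f q = - c * snd (chart_map Y \<alpha> q)"
  shows "hessian Y G f \<alpha> p u v = c * snd (levi_civita Gc (chart_map Y \<alpha> p) u v)"
proof -
  interpret chart_representation Y G \<alpha> Gc by fact
  have lin: "bounded_linear (\<lambda>z :: 'e \<times> real. - c * snd z)"
    by (rule bounded_linear_compose[OF bounded_linear_mult_right bounded_linear_snd])
  have first: "pderiv_chart Y \<alpha> w f q = - c * snd w" if "q \<in> chart_dom Y \<alpha>" for w q
    using pderiv_chart_eq[OF that, where F = "\<lambda>z. - c * snd z", OF f] dderiv_bounded_linear[OF lin] by simp
  have "pderiv_chart Y \<alpha> u (\<lambda>q. pderiv_chart Y \<alpha> v f q) p = dderiv u (\<lambda>z. - c * snd v) (chart_map Y \<alpha> p)"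
    by (rule pderiv_chart_eq[OF p]) (rule first)
  then show ?thesis
    unfolding hessian_def first[OF p] christoffel_eq[OF p]
    by (simp add: sum_Basis_time inner_prod_def)
qed


section \<open>The norm of a bilinear form\<close>

definition form_norm_sq ::
  "('e::euclidean_space \<Rightarrow> 'e \<Rightarrow> real) \<Rightarrow> ('e \<Rightarrow> 'e \<Rightarrow> real) \<Rightarrow> real" where
  "form_norm_sq B T = metric_trace B (\<lambda>u v. metric_trace B (\<lambda>u' v'. T u u' * T v v'))"

lemma bilinear_metric_trace_product:
  assumes "bilinear T"
  shows "bilinear (\<lambda>u v. metric_trace B (\<lambda>u' v'. T u u' * T v v'))"
  unfolding bilinear_def metric_trace_def
  by (auto intro!: linearI simp: bilinear_simps[OF assms] algebra_simps sum.distrib sum_distrib_left)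

lemma form_norm_sq_pullback:
  fixes A :: "'e::euclidean_space \<Rightarrow> 'e"
  assumes "inner_form B" "inner_form B'" "linear A" "\<And>u v. B' u v = B (A u) (A v)"
    and T: "bilinear T" and T': "\<And>u v. T' u v = T (A u) (A v)"
  shows "form_norm_sq B' T' = form_norm_sq B T"
proof -
  have "bilinear (\<lambda>u' v'. T u u' * T v v')" for u v
    unfolding bilinear_def
    by (auto intro!: linearI simp: bilinear_simps[OF T] algebra_simps)
  note inner = metric_trace_pullback[OF assms(1-4) this]
  show ?thesis
    unfolding form_norm_sq_def T' inner
    by (rule metric_trace_pullback[OF assms(1-4) bilinear_metric_trace_product[OF T]])
qed

text \<open>Iterated metric traces are independent of coordinates, which is not apparent from the formula
  in components.\<close>

lemma tensor2_norm_eq: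
  assumes T: "bilinear (T \<alpha> p)"
  shows "tensor2_norm h T \<alpha> p = sqrt (form_norm_sq (h \<alpha> p) (T \<alpha> p))"
proof -
  define e where "e = dual_vec (h \<alpha> p)"
  have inv: "inv_metric h \<alpha> p i j = e j \<bullet> i" for i j
    by (simp add: inv_metric_def dual_vec_def e_def)
  have expand: "T \<alpha> p (e k) (e l) = (\<Sum>i\<in>Basis. \<Sum>j\<in>Basis. (e k \<bullet> i) * ((e l \<bullet> j) * T \<alpha> p i j))" for k l
    by (rule bilinear_expand[OF T])
  have "form_norm_sq (h \<alpha> p) (T \<alpha> p) = (\<Sum>k\<in>Basis. \<Sum>l\<in>Basis. T \<alpha> p (e k) (e l) * T \<alpha> p k l)"
    by (simp add: form_norm_sq_def metric_trace_def e_def)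
  also have "\<dots> = (\<Sum>k\<in>Basis. \<Sum>l\<in>Basis. \<Sum>i\<in>Basis. \<Sum>j\<in>Basis.
      inv_metric h \<alpha> p i k * inv_metric h \<alpha> p j l * T \<alpha> p i j * T \<alpha> p k l)"
    unfolding expand inv by (simp add: sum_distrib_right mult.assoc)
  also have "\<dots> = (\<Sum>k\<in>Basis. \<Sum>i\<in>Basis. \<Sum>l\<in>Basis. \<Sum>j\<in>Basis.
      inv_metric h \<alpha> p i k * inv_metric h \<alpha> p j l * T \<alpha> p i j * T \<alpha> p k l)"
    by (rule sum.cong[OF refl sum.swap])
  also have "\<dots> = (\<Sum>i\<in>Basis. \<Sum>k\<in>Basis. \<Sum>l\<in>Basis. \<Sum>j\<in>Basis.
      inv_metric h \<alpha> p i k * inv_metric h \<alpha> p j l * T \<alpha> p i j * T \<alpha> p k l)"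
    by (rule sum.swap)
  also have "\<dots> = (\<Sum>i\<in>Basis. \<Sum>k\<in>Basis. \<Sum>j\<in>Basis. \<Sum>l\<in>Basis.
      inv_metric h \<alpha> p i k * inv_metric h \<alpha> p j l * T \<alpha> p i j * T \<alpha> p k l)"
    by (rule sum.cong[OF refl], rule sum.cong[OF refl sum.swap])
  also have "\<dots> = (\<Sum>i\<in>Basis. \<Sum>j\<in>Basis. \<Sum>k\<in>Basis. \<Sum>l\<in>Basis.
      inv_metric h \<alpha> p i k * inv_metric h \<alpha> p j l * T \<alpha> p i j * T \<alpha> p k l)"
    by (rule sum.cong[OF refl sum.swap])
  finally show ?thesis by (simp add: tensor2_norm_def)
qed

lemma tensor2_norm_le:
  fixes h T :: "('i, 'a, 'e::euclidean_space) tensor2"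
  assumes "\<And>i j. i \<in> Basis \<Longrightarrow> j \<in> Basis \<Longrightarrow> \<bar>inv_metric h \<alpha> p i j\<bar> \<le> D"
    and "\<And>i j. i \<in> Basis \<Longrightarrow> j \<in> Basis \<Longrightarrow> \<bar>T \<alpha> p i j\<bar> \<le> C"
  shows "tensor2_norm h T \<alpha> p \<le> sqrt (\<Sum>i\<in>(Basis :: 'e set). \<Sum>j\<in>(Basis :: 'e set).
    \<Sum>k\<in>(Basis :: 'e set). \<Sum>l\<in>(Basis :: 'e set). D * D * C * C)"
  unfolding tensor2_norm_def
proof (intro real_sqrt_le_mono sum_mono)
  fix i j k l :: 'e assume b: "i \<in> Basis" "j \<in> Basis" "k \<in> Basis" "l \<in> Basis"
  have "inv_metric h \<alpha> p i k * inv_metric h \<alpha> p j l * T \<alpha> p i j * T \<alpha> p k l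
      \<le> \<bar>inv_metric h \<alpha> p i k\<bar> * \<bar>inv_metric h \<alpha> p j l\<bar> * \<bar>T \<alpha> p i j\<bar> * \<bar>T \<alpha> p k l\<bar>"
    unfolding abs_mult[symmetric] by (rule abs_ge_self)
  also have "\<dots> \<le> D * D * C * C"
    using assms(1)[OF b(1,3)] assms(1)[OF b(2,4)] assms(2)[OF b(1,2)] assms(2)[OF b(3,4)]
    by (intro mult_mono) (auto intro: order_trans[OF abs_ge_zero])
  finally show "inv_metric h \<alpha> p i k * inv_metric h \<alpha> p j l * T \<alpha> p i j * T \<alpha> p k l \<le> D * D * C * C" .
qed

section \<open>The reverse Ricci flow on a manifold\<close>

lemma coordinate_changeI:
  fixes G :: "'e::euclidean_space \<Rightarrow> 'e \<Rightarrow> 'e \<Rightarrow> real"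
  assumes "metric_chart S G" "open S'" "smooth_on \<phi> S'" "\<phi> ` S' \<subseteq> S"
    and "metric_field S' G'" "\<And>y. y \<in> S' \<Longrightarrow> G' y = pullback \<phi> G y"
  shows "coordinate_change S G S' \<phi>"
proof -
  interpret metric_chart S G by fact
  interpret G': metric_field S' G' by fact
  show ?thesis
  proof
    fix y u assume y: "y \<in> S'" and "dderiv u \<phi> y = 0"
    then have "G' y u u = 0"
      using bilinear_lzero[OF Gbil] assms(4) by (auto simp: assms(6) pullback_def)
    then show "u = 0" using G'.Gpos[OF y] by fastforce
  qed (use assms in auto)
qed

lemma metric_field_subset:
  assumes "metric_field S G" "open T" "T \<subseteq> S"
  shows "metric_field T G"
proof -
  interpret metric_field S G by fact
  have "bilinear_field T G"
    using assms(2,3) Gbil smooth_on_subset[OF Gsmooth assms(3)] by (auto simp: bilinear_field_def)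
  then show ?thesis using assms(3) Gsym Gpos by unfold_locales auto
qed

lemma riemannian_inner_form:
  assumes "riemannian_metric Y h" "\<alpha> \<in> charts Y" "p \<in> chart_dom Y \<alpha>"
  shows "inner_form (h \<alpha> p)"
  using assms by unfold_locales
    (auto simp: riemannian_metric_def smooth_tensor2_def positive_definite_def)

lemma uniform_bound_finite:
  assumes "finite A" "\<And>i j. i \<in> A \<Longrightarrow> j \<in> A \<Longrightarrow> \<exists>C. \<forall>x\<in>D. \<bar>f i j x\<bar> \<le> (C :: real)"
  shows "\<exists>C. \<forall>i\<in>A. \<forall>j\<in>A. \<forall>x\<in>D. \<bar>f i j x\<bar> \<le> C"
proof -
  obtain C where C: "\<And>i j x. i \<in> A \<Longrightarrow> j \<in> A \<Longrightarrow> x \<in> D \<Longrightarrow> \<bar>f i j x\<bar> \<le> C i j"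
    using assms(2) by metis
  have "\<bar>f i j x\<bar> \<le> (\<Sum>i\<in>A. \<Sum>j\<in>A. \<bar>C i j\<bar>)" if "i \<in> A" "j \<in> A" "x \<in> D" for i j x
  proof -
    have "\<bar>f i j x\<bar> \<le> \<bar>C i j\<bar>" using C[OF that] by linarith
    also have "\<dots> \<le> (\<Sum>j\<in>A. \<bar>C i j\<bar>)" by (rule member_le_sum[OF that(2)]) (use assms(1) in auto)
    also have "\<dots> \<le> (\<Sum>i\<in>A. \<Sum>j\<in>A. \<bar>C i j\<bar>)"
      by (rule member_le_sum[OF that(1)]) (use assms(1) in \<open>auto intro: sum_nonneg\<close>)
    finally show ?thesis .
  qed
  then show ?thesis by blast
qed

lemma smooth_manifold_chart:
  assumes "smooth_manifold M" "\<alpha> \<in> charts M"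
  shows "openin (mtop M) (chart_dom M \<alpha>)" "open (chart_image M \<alpha>)"
    "homeomorphic_map (subtopology (mtop M) (chart_dom M \<alpha>)) (top_of_set (chart_image M \<alpha>)) (chart_map M \<alpha>)"
    "inj_on (chart_map M \<alpha>) (chart_dom M \<alpha>)"
proof -
  show 1: "openin (mtop M) (chart_dom M \<alpha>)" "open (chart_image M \<alpha>)"
    "homeomorphic_map (subtopology (mtop M) (chart_dom M \<alpha>)) (top_of_set (chart_image M \<alpha>)) (chart_map M \<alpha>)"
    using assms by (auto simp: smooth_manifold_def)
  have "topspace (subtopology (mtop M) (chart_dom M \<alpha>)) = chart_dom M \<alpha>"
    using openin_subset[OF 1(1)] by (auto simp: topspace_subtopology)
  then show "inj_on (chart_map M \<alpha>) (chart_dom M \<alpha>)"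
    using homeomorphic_imp_injective_map[OF 1(3)] by simp
qed

locale flow_manifold =
  fixes M :: "('i, 'a, 'e::euclidean_space) charted_space" and a b :: real
    and g :: "real \<Rightarrow> ('i, 'a, 'e) tensor2"
  assumes manifold: "smooth_manifold M" and ab: "a < b" and ricci_flow: "reverse_ricci_flow M a b g"
begin

abbreviation "J \<equiv> {a<..<b}"
abbreviation "X \<equiv> spacetime M a b"
abbreviation "V \<alpha> \<equiv> chart_image M \<alpha>"

lemmas chart = smooth_manifold_chart[OF manifold]

lemma inv_chart: "\<alpha> \<in> charts M \<Longrightarrow> p \<in> chart_dom M \<alpha> \<Longrightarrow> chart_inv M \<alpha> (chart_map M \<alpha> p) = p"
  unfolding chart_inv_def by (rule inv_into_f_f[OF chart(4)])

lemma chart_inv: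
  assumes "y \<in> V \<alpha>"
  shows "chart_map M \<alpha> (chart_inv M \<alpha> y) = y" "chart_inv M \<alpha> y \<in> chart_dom M \<alpha>"
  using f_inv_into_f[OF assms] inv_into_into[OF assms] by (simp_all add: chart_inv_def)

lemma spacetime_simps:
  "charts X = charts M" "chart_dom X \<alpha> = chart_dom M \<alpha> \<times> J"
  "chart_map X \<alpha> q = (chart_map M \<alpha> (fst q), snd q)"
  "mtop X = prod_topology (mtop M) (top_of_set J)"
  by (simp_all add: spacetime_def split_beta)

lemma chart_image_spacetime: "chart_image X \<alpha> = V \<alpha> \<times> J"
  by (auto simp: spacetime_simps image_iff)

lemma inj_spacetime: "\<alpha> \<in> charts M \<Longrightarrow> inj_on (chart_map X \<alpha>) (chart_dom X \<alpha>)"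
  using chart(4) by (auto simp: inj_on_def spacetime_simps)

lemma chart_inv_spacetime:
  assumes "\<alpha> \<in> charts M" "z \<in> V \<alpha> \<times> J"
  shows "chart_inv X \<alpha> z = (chart_inv M \<alpha> (fst z), snd z)"
  unfolding chart_inv_def[of X]
  by (rule inv_into_f_eq[OF inj_spacetime[OF assms(1)]])
    (use assms(2) chart_inv[of "fst z" \<alpha>] in \<open>auto simp: spacetime_simps\<close>)

definition "\<gamma> \<alpha> z = g (snd z) \<alpha> (chart_inv M \<alpha> (fst z))"

text \<open>The space-time metric as a function on the coordinate domain.\<close>

definition "stm N \<alpha> z p q = \<gamma> \<alpha> z (fst p) (fst q)
  + (real N + scalar_curv (\<lambda>y. \<gamma> \<alpha> (y, snd z)) (fst z)) * snd p * snd q"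

lemma metric_at: "t \<in> J \<Longrightarrow> riemannian_metric M (g t)"
  using ricci_flow by (simp add: reverse_ricci_flow_def)

lemma slice_representation:
  assumes "\<alpha> \<in> charts M" "t \<in> J"
  shows "chart_representation M (g t) \<alpha> (\<lambda>y. \<gamma> \<alpha> (y, t))"
  using metric_chart_of_riemannian[OF metric_at[OF assms(2)] assms(1) chart(2)[OF assms(1)]]
  by (simp add: chart_representation_def \<gamma>_def chart(4)[OF assms(1)])

text \<open>The flow equation is given for the components with respect to the basis; both sides are bilinear.\<close>

lemma flow_in_chart:
  assumes \<alpha>: "\<alpha> \<in> charts M"
  shows "flow_chart (V \<alpha>) J (\<gamma> \<alpha>)"
proof -
  have slice: "metric_chart (V \<alpha>) (\<lambda>y. \<gamma> \<alpha> (y, t))" if "t \<in> J" for t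
    by (rule chart_representation.chart[OF slice_representation[OF \<alpha> that]])
  have bil: "bilinear (\<gamma> \<alpha> z)" if "z \<in> V \<alpha> \<times> J" for z
    using metric_field.Gbil[OF metric_chart.axioms(1)[OF slice], of "snd z" "fst z"] that by auto
  have field: "bilinear_field (V \<alpha> \<times> J) (\<gamma> \<alpha>)"
  proof (rule bilinear_fieldI_basis)
    show "open (V \<alpha> \<times> J)" by (simp add: open_Times chart(2)[OF \<alpha>])
    show "smooth_on (\<lambda>x. \<gamma> \<alpha> x i j) (V \<alpha> \<times> J)" if "i \<in> Basis" "j \<in> Basis" for i j
      using ricci_flow \<alpha> that unfolding reverse_ricci_flow_def \<gamma>_def split_beta by blast
  qed (rule bil)
  interpret metric_field "V \<alpha> \<times> J" "\<gamma> \<alpha>"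
  proof
    show "bilinear_field (V \<alpha> \<times> J) (\<gamma> \<alpha>)" by (rule field)
    show "\<gamma> \<alpha> x u v = \<gamma> \<alpha> x v u" if "x \<in> V \<alpha> \<times> J" for x u v
      using metric_field.Gsym[OF metric_chart.axioms(1)[OF slice], of "snd x" "fst x"] that by auto
    show "0 < \<gamma> \<alpha> x u u" if "x \<in> V \<alpha> \<times> J" "u \<noteq> 0" for x u
      using metric_field.Gpos[OF metric_chart.axioms(1)[OF slice], of "snd x" "fst x" u] that by auto
  qed
  show ?thesis
  proof
    show "open (V \<alpha>)" "open J" using chart(2)[OF \<alpha>] by auto
    fix x u v assume x: "x \<in> V \<alpha> \<times> J"
    define y where "y = fst x"
    define t where "t = snd x"
    have yt: "x = (y, t)" "y \<in> V \<alpha>" "t \<in> J" using x by (auto simp: y_def t_def)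
    interpret s: chart_representation M "g t" \<alpha> "\<lambda>y. \<gamma> \<alpha> (y, t)"
      by (rule slice_representation[OF \<alpha> yt(3)])
    have "(\<lambda>u v. dderiv (0, 1) (\<lambda>x. \<gamma> \<alpha> x u v) x) = (\<lambda>u v. 2 * ricci_form (\<lambda>y. \<gamma> \<alpha> (y, t)) y u v)"
    proof (rule bilinear_eq_stdbasis)
      show "bilinear (\<lambda>u v. dderiv (0, 1) (\<lambda>x. \<gamma> \<alpha> x u v) x)"
        by (rule bilinear_fieldD(1)[OF bilinear_field_dderiv[OF field] x])
      show "bilinear (\<lambda>u v. 2 * ricci_form (\<lambda>y. \<gamma> \<alpha> (y, t)) y u v)"
        unfolding bilinear_def
        by (auto intro!: linearI simp: bilinear_simps[OF s.ricci_bil[OF yt(2)]] algebra_simps)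
      fix i j :: 'e assume ij: "i \<in> Basis" "j \<in> Basis"
      have "((\<lambda>s. (y, s)) has_derivative (\<lambda>r. (0, r))) (at t)"
        by (auto intro!: derivative_eq_intros)
      moreover have d: "(\<lambda>x. \<gamma> \<alpha> x i j) differentiable at (y, t)" using Gdiff[OF x] yt by simp
      ultimately have "((\<lambda>s. \<gamma> \<alpha> (y, s) i j) has_derivative (\<lambda>r. dderiv (0, r) (\<lambda>x. \<gamma> \<alpha> x i j) (y, t))) (at t)"
        by (rule has_derivative_compose[OF _ has_derivative_dderiv])
      then have 1: "dderiv 1 (\<lambda>s. \<gamma> \<alpha> (y, s) i j) t = dderiv (0, 1) (\<lambda>x. \<gamma> \<alpha> x i j) (y, t)"
        by (rule dderiv_eqI)
      have "((\<lambda>s. g s \<alpha> (chart_inv M \<alpha> y) i j) has_real_derivative 2 * ricci M (g t) \<alpha> (chart_inv M \<alpha> y) i j) (at t)"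
        using ricci_flow \<alpha> yt(3) chart_inv(2)[OF yt(2)] ij unfolding reverse_ricci_flow_def by blast
      then have "dderiv 1 (\<lambda>s. \<gamma> \<alpha> (y, s) i j) t = 2 * ricci M (g t) \<alpha> (chart_inv M \<alpha> y) i j"
        unfolding has_field_derivative_def \<gamma>_def fst_conv snd_conv
        by (simp add: dderiv_eqI)
      then show "dderiv (0, 1) (\<lambda>x. \<gamma> \<alpha> x i j) x = 2 * ricci_form (\<lambda>y. \<gamma> \<alpha> (y, t)) y i j"
        using s.ricci_eq[OF chart_inv(2)[OF yt(2)]] 1 by (simp add: chart_inv(1)[OF yt(2)] yt(1))
    qed
    then show "dderiv (0, 1) (\<lambda>x. \<gamma> \<alpha> x u v) x = 2 * ricci_form (\<lambda>y. \<gamma> \<alpha> (y, snd x)) (fst x) u v"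
      unfolding y_def t_def by meson
  qed
qed

lemma soliton_metric_eq:
  assumes \<alpha>: "\<alpha> \<in> charts M" and z: "z \<in> V \<alpha> \<times> J"
  shows "soliton_metric M g N \<alpha> (chart_inv X \<alpha> z) = stm N \<alpha> z"
proof (intro ext)
  fix p q
  have z': "fst z \<in> V \<alpha>" "snd z \<in> J" using z by auto
  have "scalar_curvature M (g (snd z)) \<alpha> (chart_inv M \<alpha> (fst z)) = scalar_curv (\<lambda>y. \<gamma> \<alpha> (y, snd z)) (fst z)"
    using chart_representation.scalar_curvature_eq[OF slice_representation[OF \<alpha> z'(2)] chart_inv(2)[OF z'(1)]]
    by (simp add: chart_inv(1)[OF z'(1)])
  then show "soliton_metric M g N \<alpha> (chart_inv X \<alpha> z) p q = stm N \<alpha> z p q"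
    by (simp add: soliton_metric_def chart_inv_spacetime[OF \<alpha> z] stm_def \<gamma>_def split_beta)
qed

end

text \<open>If the space-time metric is positive definite for \<open>N0\<close>, then \<open>N0 + R > 0\<close> everywhere. In the
  application \<open>N0\<close> is the least admissible value, so that all admissible \<open>N\<close> satisfy \<open>N \<ge> N0\<close>.\<close>

locale flow_manifold_large = flow_manifold M a b g
  for M :: "('i, 'a, 'e::euclidean_space) charted_space" and a b g +
  fixes N0 :: nat
  assumes positive: "positive_definite X (soliton_metric M g N0)"
begin

lemma soliton_in_chart:
  assumes \<alpha>: "\<alpha> \<in> charts M"
  shows "soliton_chart (V \<alpha>) J (\<gamma> \<alpha>) N0"
proof -
  interpret flow_chart "V \<alpha>" J "\<gamma> \<alpha>" by (rule flow_in_chart[OF \<alpha>])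
  show ?thesis
  proof
    fix x assume x: "x \<in> V \<alpha> \<times> J"
    have "chart_inv X \<alpha> x \<in> chart_dom X \<alpha>"
      using x chart_inv(2)[of "fst x" \<alpha>] by (auto simp: chart_inv_spacetime[OF \<alpha> x] spacetime_simps)
    moreover have "(0, 1) \<noteq> (0 :: 'e \<times> real)" by (simp add: zero_prod_def)
    ultimately have "0 < soliton_metric M g N0 \<alpha> (chart_inv X \<alpha> x) (0, 1) (0, 1)"
      using positive \<alpha> unfolding positive_definite_def spacetime_simps(1) by blast
    then show "0 < real N0 + R x"
      by (simp add: soliton_metric_eq[OF \<alpha> x] stm_def R_def bilinear_lzero[OF Gbil[OF x]])
  qed
qed

lemma stm_eq:
  assumes "\<alpha> \<in> charts M"
  shows "stm N \<alpha> = soliton_chart.st_metric (\<gamma> \<alpha>) N"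
proof -
  interpret soliton_chart "V \<alpha>" J "\<gamma> \<alpha>" N0 by (rule soliton_in_chart[OF assms])
  show ?thesis by (simp add: fun_eq_iff stm_def st_metric_def R_def)
qed

lemma stm_chart: "\<alpha> \<in> charts M \<Longrightarrow> N \<ge> N0 \<Longrightarrow> metric_chart (V \<alpha> \<times> J) (stm N \<alpha>)"
  using soliton_chart.st_metric_chart[OF soliton_in_chart] stm_eq by simp

lemma soliton_representation:
  assumes "\<alpha> \<in> charts M" "N \<ge> N0"
  shows "chart_representation X (soliton_metric M g N) \<alpha> (stm N \<alpha>)"
  using stm_chart[OF assms] soliton_metric_eq[OF assms(1)] inj_spacetime[OF assms(1)]
  by (simp add: chart_representation_def chart_image_spacetime)

text \<open>The error \<open>Ric + Hess(- N \<tau>)\<close> in coordinates.\<close>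

definition "err N \<alpha> z u v = ricci_form (stm N \<alpha>) z u v + real N * snd (levi_civita (stm N \<alpha>) z u v)"

definition "scaled_error N = (\<lambda>\<beta> q i j. real N *
  (ricci X (soliton_metric M g N) \<beta> q i j
   + hessian X (soliton_metric M g N) (\<lambda>(x, \<tau>). - real N * \<tau>) \<beta> q i j))"

lemma scaled_error_eq:
  assumes \<alpha>: "\<alpha> \<in> charts M" and N: "N \<ge> N0" and p: "p \<in> chart_dom X \<alpha>"
  shows "scaled_error N \<alpha> p = (\<lambda>u v. real N * err N \<alpha> (chart_map X \<alpha> p) u v)"
proof -
  note rep = soliton_representation[OF \<alpha> N]
  have "hessian X (soliton_metric M g N) (\<lambda>(x, \<tau>). - real N * \<tau>) \<alpha> p u v
      = real N * snd (levi_civita (stm N \<alpha>) (chart_map X \<alpha> p) u v)" for u v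
    by (rule hessian_linear_time[OF rep p]) (simp add: spacetime_simps split_beta)
  then show ?thesis
    by (simp add: scaled_error_def err_def chart_representation.ricci_eq[OF rep p])
qed

lemma scaled_error_bilinear:
  assumes \<alpha>: "\<alpha> \<in> charts M" and N: "N \<ge> N0" and p: "p \<in> chart_dom X \<alpha>"
  shows "bilinear (scaled_error N \<alpha> p)"
proof -
  interpret chart_representation X "soliton_metric M g N" \<alpha> "stm N \<alpha>"
    by (rule soliton_representation[OF \<alpha> N])
  have z: "chart_map X \<alpha> p \<in> chart_image X \<alpha>" using p by blast
  show ?thesis
    unfolding scaled_error_eq[OF assms] err_def bilinear_def
    by (intro conjI allI linearI)
      (simp_all add: bilinear_simps[OF ricci_bil[OF z]] bilinear_simps[OF lc_bil[OF z]] algebra_simps)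
qed

text \<open>A transition map of the space-time acts on the space factor only, so that it preserves
  the time components of the Christoffel symbols.\<close>

lemma transition:
  assumes \<alpha>: "\<alpha> \<in> charts M" and \<beta>: "\<beta> \<in> charts M"
    and p: "p \<in> chart_dom X \<alpha> \<inter> chart_dom X \<beta>"
  obtains D where "linear D"
    "\<And>u. D u = frechet_derivative (chart_map X \<beta> \<circ> chart_inv X \<alpha>) (at (chart_map X \<alpha> p)) u"
    "\<And>N u v. N \<ge> N0 \<Longrightarrow> scaled_error N \<alpha> p u v = scaled_error N \<beta> p (D u) (D v)"
proof -
  define \<psi> where "\<psi> = chart_map M \<beta> \<circ> chart_inv M \<alpha>"
  define S0 where "S0 = chart_map M \<alpha> ` (chart_dom M \<alpha> \<inter> chart_dom M \<beta>)"
  define \<Psi> where "\<Psi> = chart_map X \<beta> \<circ> chart_inv X \<alpha>"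
  define S where "S = S0 \<times> J"
  have S0_sub: "S0 \<subseteq> V \<alpha>" by (auto simp: S0_def)
  have S0_inv: "chart_inv M \<alpha> y \<in> chart_dom M \<alpha> \<inter> chart_dom M \<beta>" if "y \<in> S0" for y
    using that inv_chart[OF \<alpha>] by (auto simp: S0_def)
  have openS0: "open S0"
  proof -
    have "openin (subtopology (mtop M) (chart_dom M \<alpha>)) (chart_dom M \<alpha> \<inter> chart_dom M \<beta>)"
      using chart(1)[OF \<beta>] by (rule openin_subtopology_Int2)
    then have "openin (top_of_set (V \<alpha>)) S0"
      using homeomorphic_imp_open_map[OF chart(3)[OF \<alpha>]] unfolding S0_def open_map_def by blast
    then show ?thesis using openin_open_trans chart(2)[OF \<alpha>] by blast
  qed
  then have openS: "open S" by (simp add: S_def open_Times)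
  have sm\<psi>: "smooth_on \<psi> S0"
    using manifold \<alpha> \<beta> unfolding smooth_manifold_def S0_def \<psi>_def by blast
  have \<psi>_into: "\<psi> ` S0 \<subseteq> V \<beta>" using S0_inv by (auto simp: \<psi>_def)
  have d\<psi>: "\<psi> differentiable at y" if "y \<in> S0" for y
    by (rule smooth_on_differentiable[OF sm\<psi> that])
  have \<Psi>: "\<Psi> z = (\<psi> (fst z), snd z)" if "z \<in> S" for z
    using that S0_sub chart_inv_spacetime[OF \<alpha>, of z]
    by (auto simp: \<Psi>_def \<psi>_def S_def spacetime_simps)
  have sm\<Psi>: "smooth_on \<Psi> S"
  proof (rule smooth_on_cong[OF openS])
    show "smooth_on (\<lambda>z. (\<psi> (fst z), snd z)) S"
      by (intro smooth_on_Pair openS smooth_on_compose[OF openS smooth_on_fst sm\<psi>] smooth_on_snd)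
        (auto simp: S_def)
  qed (rule \<Psi>[symmetric])
  have \<Psi>_into: "\<Psi> ` S \<subseteq> V \<beta> \<times> J" using \<Psi> \<psi>_into by (auto simp: S_def)
  have d\<Psi>: "dderiv u \<Psi> z = (dderiv (fst u) \<psi> (fst z), snd u)" if z: "z \<in> S" for u z
  proof -
    have f: "fst z \<in> S0" using z by (auto simp: S_def)
    have l: "(fst :: 'e \<times> real \<Rightarrow> 'e) differentiable at z" "(snd :: 'e \<times> real \<Rightarrow> real) differentiable at z"
      by (simp_all add: bounded_linear_imp_differentiable bounded_linear_fst bounded_linear_snd)
    have "dderiv u \<Psi> z = dderiv u (\<lambda>z. (\<psi> (fst z), snd z)) z"
      by (rule dderiv_cong_open[OF openS z \<Psi>])
    also have "\<dots> = (dderiv u (\<lambda>z. \<psi> (fst z)) z, dderiv u snd z)"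
      by (rule dderiv_Pair(1)[OF differentiable_compose_at[OF l(1) d\<psi>[OF f]] l(2)])
    also have "dderiv u (\<lambda>z. \<psi> (fst z)) z = dderiv (dderiv u fst z) \<psi> (fst z)"
      by (rule dderiv_compose[OF l(1) d\<psi>[OF f]])
    finally show ?thesis
      by (simp add: dderiv_bounded_linear[OF bounded_linear_fst] dderiv_bounded_linear[OF bounded_linear_snd])
  qed
  have \<gamma>: "\<gamma> \<alpha> (y, t) = pullback \<psi> (\<lambda>y. \<gamma> \<beta> (y, t)) y" if y: "y \<in> S0" and t: "t \<in> J" for y t
  proof (intro ext)
    fix u v
    define q where "q = chart_inv M \<alpha> y"
    have q: "q \<in> chart_dom M \<alpha> \<inter> chart_dom M \<beta>" unfolding q_def by (rule S0_inv[OF y])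
    have "chart_map M \<alpha> q = y" using chart_inv(1) S0_sub y by (auto simp: q_def)
    moreover have "chart_inv M \<beta> (\<psi> y) = q" using inv_chart[OF \<beta>] q by (simp add: \<psi>_def q_def)
    moreover have "g t \<alpha> q u v = g t \<beta> q (frechet_derivative \<psi> (at (chart_map M \<alpha> q)) u)
        (frechet_derivative \<psi> (at (chart_map M \<alpha> q)) v)"
      using metric_at[OF t] \<alpha> \<beta> q unfolding riemannian_metric_def smooth_tensor2_def Let_def \<psi>_def by blast
    ultimately show "\<gamma> \<alpha> (y, t) u v = pullback \<psi> (\<lambda>y. \<gamma> \<beta> (y, t)) y u v"
      by (simp add: \<gamma>_def pullback_def q_def dderiv_def)
  qed
  have scal: "scalar_curv (\<lambda>y. \<gamma> \<alpha> (y, t)) y = scalar_curv (\<lambda>y. \<gamma> \<beta> (y, t)) (\<psi> y)"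
    if y: "y \<in> S0" and t: "t \<in> J" for y t
  proof -
    interpret A: metric_chart "V \<alpha>" "\<lambda>y. \<gamma> \<alpha> (y, t)"
      by (rule chart_representation.chart[OF slice_representation[OF \<alpha> t]])
    have fieldS0: "metric_field S0 (\<lambda>y. \<gamma> \<alpha> (y, t))"
      by (rule metric_field_subset[OF A.metric_field_axioms openS0 S0_sub])
    interpret c: coordinate_change "V \<beta>" "\<lambda>y. \<gamma> \<beta> (y, t)" S0 \<psi>
      by (rule coordinate_changeI[OF chart_representation.chart[OF slice_representation[OF \<beta> t]]
            openS0 sm\<psi> \<psi>_into fieldS0 \<gamma>[OF _ t]])
    have "scalar_curv (\<lambda>y. \<gamma> \<alpha> (y, t)) y = scalar_curv (pullback \<psi> (\<lambda>y. \<gamma> \<beta> (y, t))) y"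
      by (rule scalar_curv_cong_open[OF openS0 y \<gamma>[OF _ t]])
    then show ?thesis using c.scalar_curv_pullback[OF y] by simp
  qed
  have stm: "stm N \<alpha> z = pullback \<Psi> (stm N \<beta>) z" if z: "z \<in> S" for N z
  proof (intro ext)
    fix u v
    have "fst z \<in> S0" "snd z \<in> J" using z by (auto simp: S_def)
    then show "stm N \<alpha> z u v = pullback \<Psi> (stm N \<beta>) z u v"
      using \<gamma>[of "fst z" "snd z"] scal[of "fst z" "snd z"]
      by (simp add: stm_def pullback_def \<Psi>[OF z] d\<Psi>[OF z])
  qed
  define z where "z = chart_map X \<alpha> p"
  have z: "z \<in> S" using p by (auto simp: z_def S_def S0_def spacetime_simps)
  have \<Psi>z: "\<Psi> z = chart_map X \<beta> p"
    using p inv_chart[OF \<alpha>] by (auto simp: \<Psi>[OF z]) (auto simp: z_def \<psi>_def spacetime_simps)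
  show ?thesis
  proof (rule that[of "\<lambda>u. dderiv u \<Psi> z"])
    show "linear (\<lambda>u. dderiv u \<Psi> z)"
      by (rule linear_dderiv[OF smooth_on_differentiable[OF sm\<Psi> z]])
    show "dderiv u \<Psi> z = frechet_derivative (chart_map X \<beta> \<circ> chart_inv X \<alpha>) (at (chart_map X \<alpha> p)) u" for u
      by (simp add: dderiv_def \<Psi>_def z_def)
    fix N u v assume N: "N \<ge> N0"
    interpret A: metric_chart "V \<alpha> \<times> J" "stm N \<alpha>" by (rule stm_chart[OF \<alpha> N])
    have "S \<subseteq> V \<alpha> \<times> J" using S0_sub by (auto simp: S_def)
    then have fieldS: "metric_field S (stm N \<alpha>)"
      by (rule metric_field_subset[OF A.metric_field_axioms openS])
    interpret c: coordinate_change "V \<beta> \<times> J" "stm N \<beta>" S \<Psi>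
      by (rule coordinate_changeI[OF stm_chart[OF \<beta> N] openS sm\<Psi> \<Psi>_into fieldS stm])
    have ric: "ricci_form (stm N \<alpha>) z = ricci_form (pullback \<Psi> (stm N \<beta>)) z"
      by (rule ricci_form_cong_open[OF openS z stm])
    have lc: "levi_civita (stm N \<alpha>) z = levi_civita (pullback \<Psi> (stm N \<beta>)) z"
      by (rule levi_civita_cong_open[OF openS z stm])
    have "snd (dderiv u (dderiv v \<Psi>) z) = dderiv u (\<lambda>z. snd (dderiv v \<Psi> z)) z"
      by (rule dderiv_linear_comp[OF bounded_linear_snd
            smooth_on_differentiable[OF smooth_on_dderiv[OF sm\<Psi>] z], symmetric])
    also have "\<dots> = dderiv u (\<lambda>z. snd v) z"
      by (rule dderiv_cong_open[OF openS z]) (simp add: d\<Psi>)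
    finally have H: "snd (dderiv u (dderiv v \<Psi>) z) = 0" by simp
    have "snd (levi_civita (stm N \<alpha>) z u v) = snd (dderiv (levi_civita (stm N \<alpha>) z u v) \<Psi> z)"
      by (simp add: d\<Psi>[OF z])
    also have "\<dots> = snd (levi_civita (stm N \<beta>) (\<Psi> z) (dderiv u \<Psi> z) (dderiv v \<Psi> z))"
      unfolding lc c.levi_civita_pullback[OF z] by (simp add: H)
    finally have "err N \<alpha> z u v = err N \<beta> (\<Psi> z) (dderiv u \<Psi> z) (dderiv v \<Psi> z)"
      unfolding err_def ric c.ricci_pullback[OF z] pullback_def by simp
    then show "scaled_error N \<alpha> p u v = scaled_error N \<beta> p (dderiv u \<Psi> z) (dderiv v \<Psi> z)"
      using p by (simp add: scaled_error_eq[OF \<alpha> N] scaled_error_eq[OF \<beta> N] \<Psi>z z_def[symmetric])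
  qed
qed

text \<open>A point may lie in infinitely many charts, and the bound has to be the same for all of them;
  by invariance a bound in one chart suffices.\<close>

lemma scaled_error_norm_invariant:
  assumes h: "riemannian_metric X h" and \<alpha>: "\<alpha> \<in> charts M" and \<beta>: "\<beta> \<in> charts M"
    and p: "p \<in> chart_dom X \<alpha> \<inter> chart_dom X \<beta>" and N: "N \<ge> N0"
  shows "tensor2_norm h (scaled_error N) \<alpha> p = tensor2_norm h (scaled_error N) \<beta> p"
proof -
  obtain D where D: "linear D"
    "\<And>u. D u = frechet_derivative (chart_map X \<beta> \<circ> chart_inv X \<alpha>) (at (chart_map X \<alpha> p)) u"
    "\<And>N u v. N \<ge> N0 \<Longrightarrow> scaled_error N \<alpha> p u v = scaled_error N \<beta> p (D u) (D v)"
    using transition[OF \<alpha> \<beta> p] by blast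
  have hD: "h \<alpha> p u v = h \<beta> p (D u) (D v)" for u v
    using h \<alpha> \<beta> p unfolding riemannian_metric_def smooth_tensor2_def Let_def D(2) spacetime_simps(1) by blast
  have inner: "inner_form (h \<beta> p)" "inner_form (h \<alpha> p)"
    using riemannian_inner_form[OF h] \<alpha> \<beta> p by (auto simp: spacetime_simps(1))
  have "form_norm_sq (h \<alpha> p) (scaled_error N \<alpha> p) = form_norm_sq (h \<beta> p) (scaled_error N \<beta> p)"
    by (rule form_norm_sq_pullback[OF inner D(1) hD scaled_error_bilinear[OF \<beta> N] D(3)[OF N]])
      (use p in auto)
  then show ?thesis
    using p by (simp add: tensor2_norm_eq scaled_error_bilinear[OF \<alpha> N] scaled_error_bilinear[OF \<beta> N])
qed

lemma chart_neighbourhood: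
  assumes \<alpha>: "\<alpha> \<in> charts M" and p: "p \<in> chart_dom X \<alpha>"
  obtains Q K where "openin (mtop X) Q" "p \<in> Q" "Q \<subseteq> chart_dom X \<alpha>" "compact K"
    "K \<subseteq> V \<alpha> \<times> J" "chart_map X \<alpha> ` Q \<subseteq> K"
proof -
  define z where "z = chart_map X \<alpha> p"
  have "z \<in> V \<alpha> \<times> J" using p by (auto simp: z_def spacetime_simps)
  moreover have "open (V \<alpha> \<times> J)" by (simp add: open_Times chart(2)[OF \<alpha>])
  ultimately obtain r where r: "r > 0" "cball z r \<subseteq> V \<alpha> \<times> J"
    using open_contains_cball by blast
  obtain A B where AB: "open A" "open B" "z \<in> A \<times> B" "A \<times> B \<subseteq> ball z r"
    using open_prod_elim[OF open_ball, of z z r] r(1) by (metis centre_in_ball)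
  define Q0 where "Q0 = {q \<in> chart_dom M \<alpha>. chart_map M \<alpha> q \<in> A}"
  have top: "topspace (subtopology (mtop M) (chart_dom M \<alpha>)) = chart_dom M \<alpha>"
    using openin_subset[OF chart(1)[OF \<alpha>]] by (auto simp: topspace_subtopology)
  have "openin (subtopology (mtop M) (chart_dom M \<alpha>))
      {q \<in> topspace (subtopology (mtop M) (chart_dom M \<alpha>)). chart_map M \<alpha> q \<in> V \<alpha> \<inter> A}"
    by (rule openin_continuous_map_preimage[OF homeomorphic_imp_continuous_map[OF chart(3)[OF \<alpha>]]
          openin_open_Int[OF AB(1)]])
  moreover have "{q \<in> topspace (subtopology (mtop M) (chart_dom M \<alpha>)). chart_map M \<alpha> q \<in> V \<alpha> \<inter> A} = Q0"
    unfolding top Q0_def by auto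
  ultimately have "openin (mtop M) Q0"
    using openin_open_subtopology[OF chart(1)[OF \<alpha>]] by simp
  moreover have "openin (top_of_set J) (J \<inter> B)" by (rule openin_open_Int[OF AB(2)])
  ultimately have Q: "openin (mtop X) (Q0 \<times> (J \<inter> B))"
    by (simp add: spacetime_simps openin_prod_Times_iff)
  show ?thesis
  proof (rule that[OF Q _ _ compact_cball r(2)])
    show "p \<in> Q0 \<times> (J \<inter> B)"
      using p AB(3) by (auto simp: Q0_def z_def spacetime_simps)
    show "Q0 \<times> (J \<inter> B) \<subseteq> chart_dom X \<alpha>" by (auto simp: Q0_def spacetime_simps)
    show "chart_map X \<alpha> ` (Q0 \<times> (J \<inter> B)) \<subseteq> cball z r"
      using AB(4) ball_subset_cball by (fastforce simp: Q0_def spacetime_simps)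
  qed
qed

text \<open>Near \<open>p\<close> the components in one chart around \<open>p\<close> are bounded uniformly in \<open>N\<close>, and so are those of
  the inverse of \<open>h\<close>.\<close>

lemma locally_bounded:
  assumes h: "riemannian_metric X h" and p: "p \<in> topspace (mtop X)"
  obtains Q C where "openin (mtop X) Q" "p \<in> Q"
    "\<And>N q \<beta>. N \<ge> N0 \<Longrightarrow> q \<in> Q \<Longrightarrow> \<beta> \<in> charts M \<Longrightarrow> q \<in> chart_dom X \<beta> \<Longrightarrow>
      tensor2_norm h (scaled_error N) \<beta> q \<le> C"
proof -
  have "fst p \<in> topspace (mtop M)" "snd p \<in> J" using p by (auto simp: spacetime_simps)
  then obtain \<alpha> where \<alpha>: "\<alpha> \<in> charts M" and p\<alpha>: "p \<in> chart_dom X \<alpha>"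
    using manifold unfolding smooth_manifold_def spacetime_simps by (metis UN_E mem_Times_iff)
  obtain Q K where Q: "openin (mtop X) Q" "p \<in> Q" "Q \<subseteq> chart_dom X \<alpha>" "compact K"
    "K \<subseteq> V \<alpha> \<times> J" "chart_map X \<alpha> ` Q \<subseteq> K"
    using chart_neighbourhood[OF \<alpha> p\<alpha>] by blast
  interpret s: soliton_chart "V \<alpha>" J "\<gamma> \<alpha>" N0 by (rule soliton_in_chart[OF \<alpha>])
  have "\<exists>C. \<forall>y\<in>{N0..} \<times> K. \<bar>real (fst y) * err (fst y) \<alpha> (snd y) i j\<bar> \<le> C" for i j
    using s.expands_0_bounded[OF s.soliton_error_expands Q(4,5), of i j]
    unfolding err_def stm_eq[OF \<alpha>] by force
  from uniform_bound_finite[where f = "\<lambda>i j y. real (fst y) * err (fst y) \<alpha> (snd y) i j",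
      OF finite_Basis this]
  obtain C where C: "\<And>i j N z. i \<in> Basis \<Longrightarrow> j \<in> Basis \<Longrightarrow> N \<ge> N0 \<Longrightarrow> z \<in> K \<Longrightarrow>
      \<bar>real N * err N \<alpha> z i j\<bar> \<le> C" by force
  interpret hc: metric_chart "V \<alpha> \<times> J" "\<lambda>z. h \<alpha> (chart_inv X \<alpha> z)"
    using metric_chart_of_riemannian[OF h, of \<alpha>] \<alpha> chart(2)[OF \<alpha>]
    by (simp add: chart_image_spacetime spacetime_simps(1) open_Times)
  have "\<exists>C. \<forall>z\<in>K. \<bar>dual_vec (h \<alpha> (chart_inv X \<alpha> z)) j \<bullet> i\<bar> \<le> C" for i j
  proof -
    have "continuous_on K (\<lambda>z. dual_vec (h \<alpha> (chart_inv X \<alpha> z)) j \<bullet> i)"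
      by (rule continuous_on_subset[OF smooth_on_continuous[OF
              smooth_on_inner_left[OF hc.openS hc.smooth_dual]] Q(5)])
    then have "bounded ((\<lambda>z. dual_vec (h \<alpha> (chart_inv X \<alpha> z)) j \<bullet> i) ` K)"
      using Q(4) compact_continuous_image compact_imp_bounded by blast
    then show ?thesis by (auto simp: bounded_iff)
  qed
  from uniform_bound_finite[where f = "\<lambda>i j z. dual_vec (h \<alpha> (chart_inv X \<alpha> z)) j \<bullet> i",
      OF finite_Basis this]
  obtain E where E: "\<And>i j z. i \<in> Basis \<Longrightarrow> j \<in> Basis \<Longrightarrow> z \<in> K \<Longrightarrow>
      \<bar>dual_vec (h \<alpha> (chart_inv X \<alpha> z)) j \<bullet> i\<bar> \<le> E" by metis
  show ?thesis
  proof (rule that[OF Q(1,2)])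
    fix N q \<beta> assume N: "N \<ge> N0" and q: "q \<in> Q" and \<beta>: "\<beta> \<in> charts M" "q \<in> chart_dom X \<beta>"
    have q\<alpha>: "q \<in> chart_dom X \<alpha>" and z: "chart_map X \<alpha> q \<in> K" using q Q by auto
    have inv: "chart_inv X \<alpha> (chart_map X \<alpha> q) = q"
      unfolding chart_inv_def by (rule inv_into_f_f[OF inj_spacetime[OF \<alpha>] q\<alpha>])
    have "tensor2_norm h (scaled_error N) \<beta> q = tensor2_norm h (scaled_error N) \<alpha> q"
      by (rule scaled_error_norm_invariant[OF h \<beta>(1) \<alpha> _ N]) (use q\<alpha> \<beta>(2) in auto)
    also have "\<dots> \<le> sqrt (\<Sum>i\<in>(Basis :: ('e \<times> real) set). \<Sum>j\<in>(Basis :: ('e \<times> real) set).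
        \<Sum>k\<in>(Basis :: ('e \<times> real) set). \<Sum>l\<in>(Basis :: ('e \<times> real) set). E * E * C * C)"
    proof (rule tensor2_norm_le)
      fix i j :: "'e \<times> real" assume ij: "i \<in> Basis" "j \<in> Basis"
      show "\<bar>inv_metric h \<alpha> q i j\<bar> \<le> E"
        using E[OF ij z] by (simp add: inv inv_metric_def dual_vec_def)
      show "\<bar>scaled_error N \<alpha> q i j\<bar> \<le> C"
        using C[OF ij N z] by (simp add: scaled_error_eq[OF \<alpha> N q\<alpha>])
    qed
    finally show "tensor2_norm h (scaled_error N) \<beta> q \<le> sqrt (\<Sum>i\<in>(Basis :: ('e \<times> real) set).
        \<Sum>j\<in>(Basis :: ('e \<times> real) set). \<Sum>k\<in>(Basis :: ('e \<times> real) set).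
        \<Sum>l\<in>(Basis :: ('e \<times> real) set). E * E * C * C)" .
  qed
qed

lemma bounded_on_compact:
  assumes h: "riemannian_metric X h" and K: "compactin (mtop X) K"
  shows "\<exists>C. \<forall>N\<ge>N0. \<forall>p\<in>K. \<forall>\<alpha>\<in>charts M. p \<in> chart_dom X \<alpha> \<longrightarrow>
    tensor2_norm h (scaled_error N) \<alpha> p \<le> C"
proof -
  define good where "good Q C \<longleftrightarrow> (\<forall>N\<ge>N0. \<forall>p\<in>Q. \<forall>\<alpha>\<in>charts M. p \<in> chart_dom X \<alpha> \<longrightarrow>
    tensor2_norm h (scaled_error N) \<alpha> p \<le> C)" for Q C
  define \<U> where "\<U> = {Q. openin (mtop X) Q \<and> (\<exists>C. good Q C)}"
  have "K \<subseteq> \<Union>\<U>"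
  proof
    fix p assume "p \<in> K"
    then have "p \<in> topspace (mtop X)" using compactin_subset_topspace[OF K] by blast
    then obtain Q C where "openin (mtop X) Q" "p \<in> Q" "good Q C"
      using locally_bounded[OF h] unfolding good_def by metis
    then show "p \<in> \<Union>\<U>" by (auto simp: \<U>_def)
  qed
  then obtain \<F> where \<F>: "finite \<F>" "\<F> \<subseteq> \<U>" "K \<subseteq> \<Union>\<F>"
    using K unfolding compactin_def \<U>_def by (metis (no_types, lifting) mem_Collect_eq)
  have "\<forall>Q\<in>\<F>. \<exists>C. good Q C" using \<F>(2) by (auto simp: \<U>_def)
  then obtain C where C: "\<And>Q. Q \<in> \<F> \<Longrightarrow> good Q (C Q)" by metis
  have "tensor2_norm h (scaled_error N) \<alpha> p \<le> (\<Sum>Q\<in>\<F>. \<bar>C Q\<bar>)"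
    if "N \<ge> N0" "p \<in> K" "\<alpha> \<in> charts M" "p \<in> chart_dom X \<alpha>" for N p \<alpha>
  proof -
    obtain Q where Q: "Q \<in> \<F>" "p \<in> Q" using \<F>(3) \<open>p \<in> K\<close> by blast
    have "tensor2_norm h (scaled_error N) \<alpha> p \<le> \<bar>C Q\<bar>"
      using C[OF Q(1)] that Q(2) unfolding good_def by (meson abs_ge_self order_trans)
    also have "\<dots> \<le> (\<Sum>Q\<in>\<F>. \<bar>C Q\<bar>)" by (rule member_le_sum[OF Q(1)]) (use \<F>(1) in auto)
    finally show ?thesis .
  qed
  then show ?thesis by blast
qed

end

theorem theorem5p1:
  fixes M :: "('i, 'a, 'e::euclidean_space) charted_space"
    and a b :: real
    and g :: "real \<Rightarrow> ('i, 'a, 'e) tensor2"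
  assumes "smooth_manifold M"
    and "a < b"
    and "reverse_ricci_flow M a b g"
    and "bounded_curvature M a b g"
  shows "\<forall>h K. riemannian_metric (spacetime M a b) h \<and>
           compactin (mtop (spacetime M a b)) K \<longrightarrow>
           (\<exists>C. \<forall>N::nat. positive_definite (spacetime M a b) (soliton_metric M g N) \<longrightarrow>
             (\<forall>p\<in>K. \<forall>\<alpha>\<in>charts (spacetime M a b). p \<in> chart_dom (spacetime M a b) \<alpha> \<longrightarrow>
               tensor2_norm h
                 (\<lambda>\<beta> q i j. real N *
                    (ricci (spacetime M a b) (soliton_metric M g N) \<beta> q i j
                     + hessian (spacetime M a b) (soliton_metric M g N)
                         (\<lambda>(x, \<tau>). - real N * \<tau>) \<beta> q i j))
                 \<alpha> p \<le> C))"
proof (intro allI impI, elim conjE)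
  fix h K
  assume h: "riemannian_metric (spacetime M a b) h" and K: "compactin (mtop (spacetime M a b)) K"
  interpret flow_manifold M a b g by unfold_locales (use assms in auto)
  show "\<exists>C. \<forall>N::nat. positive_definite X (soliton_metric M g N) \<longrightarrow>
      (\<forall>p\<in>K. \<forall>\<alpha>\<in>charts X. p \<in> chart_dom X \<alpha> \<longrightarrow>
        tensor2_norm h (\<lambda>\<beta> q i j. real N *
          (ricci X (soliton_metric M g N) \<beta> q i j
           + hessian X (soliton_metric M g N) (\<lambda>(x, \<tau>). - real N * \<tau>) \<beta> q i j)) \<alpha> p \<le> C)"
  proof (cases "\<exists>N. positive_definite X (soliton_metric M g N)")
    case True
    define N0 where "N0 = (LEAST N. positive_definite X (soliton_metric M g N))"
    interpret flow_manifold_large M a b g N0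
      by unfold_locales (use LeastI_ex[OF True] in \<open>simp add: N0_def\<close>)
    have "N \<ge> N0" if "positive_definite X (soliton_metric M g N)" for N
      using Least_le[of "\<lambda>N. positive_definite X (soliton_metric M g N)" N, OF that] by (simp add: N0_def)
    then show ?thesis
      using bounded_on_compact[OF h K] unfolding scaled_error_def spacetime_simps(1) by blast
  qed auto
qed

end
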